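(* Let $f:\mathbb R^n\to\mathbb R$ be a continuous function and let $\Omega\subset\mathbb R^n$ be a bounded region with piecewise smooth boundary. Define $$\Sigma_\Omega^f(X)=\int_{P\in\Omega}f(P-X)\,dP,\qquad X\in\mathbb R^n.$$ Then a point $m\in\mathbb R^n$ is a critical point of the function $\Sigma_\Omega^f$ if and only if $$\int_{P\in\partial\Omega}f(P-m)\,\overrightarrow{n(P)}\,dP=0,$$ where $\overrightarrow{n(P)}$ is the unit outward normal vector to the boundary of $\Omega$ at the point $P$.
   Context: The integral over $\Omega$ is with respect to Lebesgue measure on $\mathbb R^n$; the integral over $\partial\Omega$ is a vector-valued integral with respect to $(n-1)$-dimensional surface measure. A point $m$ is critical for a function $g:\mathbb R^n\to\mathbb R$ if $g(m+\delta)-g(m)=o(|\delta|)$ as the vector $\delta\to0$, i.e. $g$ is differentiable at $m$ with zero gradient. *)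

theory Defs
  imports "HOL-Analysis.Analysis"
begin

section \<open>Surface measure\<close>

text \<open>
  Surface measure of dimension \<open>d\<close> is \<open>d\<close>-dimensional Hausdorff measure, normalised by the volume
  of the unit ball so that it agrees with the area of \<open>C\<^sup>1\<close> surfaces.  Empty covering sets are
  treated separately because \<open>0 ^ 0 = 1\<close>: for \<open>d = 0\<close> a singleton has to count as 1 (giving the
  counting measure) and the empty set as 0.  Boundedness is required because \<^const>\<open>diameter\<close> is
  unspecified on unbounded sets.
\<close>

definition hausdorff_pre :: "nat \<Rightarrow> real \<Rightarrow> 'a::metric_space set \<Rightarrow> ennreal" where
  "hausdorff_pre d \<delta> A =
     (INF C \<in> {C :: nat \<Rightarrow> 'a set. A \<subseteq> (\<Union>i. C i) \<and> (\<forall>i. bounded (C i) \<and> diameter (C i) \<le> \<delta>)}.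
        \<Sum>i. if C i = {} then 0
             else ennreal (unit_ball_vol (real d) * (diameter (C i) / 2) ^ d))"

definition hausdorff_outer :: "nat \<Rightarrow> 'a::metric_space set \<Rightarrow> ennreal" where
  "hausdorff_outer d A = (SUP \<delta> \<in> {0<..}. hausdorff_pre d \<delta> A)"

text \<open>
  The outer measure is a metric outer measure, hence countably additive on the Borel sets
  (Caratheodory), so that the \<^const>\<open>emeasure\<close> of a Borel set is its outer measure.
\<close>

definition hausdorff_measure :: "nat \<Rightarrow> 'a::metric_space measure" where
  "hausdorff_measure d = measure_of UNIV (sets borel) (hausdorff_outer d)"


section \<open>Regions with piecewise smooth boundary\<close>

text \<open>
  A region is an open set together with none, some or all of its boundary points.
  Connectedness is not needed and not demanded.
\<close>

definition region :: "'a::topological_space set \<Rightarrow> bool" where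
  "region \<Omega> \<longleftrightarrow> \<Omega> \<noteq> {} \<and> \<Omega> \<subseteq> closure (interior \<Omega>)"

text \<open>
  \<open>r\<close> is a \<open>C\<^sup>1\<close> function with nowhere vanishing gradient \<open>G\<close> near \<open>p\<close>, and \<open>\<Omega>\<close> lies, near \<open>p\<close>,
  exactly on the side \<open>r < 0\<close>.  Points with \<open>r = 0\<close> may or may not belong to \<open>\<Omega>\<close>; since \<open>G\<close> does
  not vanish, they are exactly the points of \<^term>\<open>frontier \<Omega>\<close> near \<open>p\<close>.
\<close>

definition local_defining_function ::
    "('a::euclidean_space) set \<Rightarrow> 'a \<Rightarrow> ('a \<Rightarrow> real) \<Rightarrow> ('a \<Rightarrow> 'a) \<Rightarrow> bool" where
  "local_defining_function \<Omega> p r G \<longleftrightarrow>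
     (\<exists>U. open U \<and> p \<in> U \<and> continuous_on U G \<and>
       (\<forall>x\<in>U. (r has_derivative (\<lambda>h. G x \<bullet> h)) (at x) \<and> G x \<noteq> 0 \<and>
              (r x < 0 \<longrightarrow> x \<in> \<Omega>) \<and> (r x > 0 \<longrightarrow> x \<notin> \<Omega>)))"

definition smooth_boundary_points :: "('a::euclidean_space) set \<Rightarrow> 'a set" where
  "smooth_boundary_points \<Omega> = {p \<in> frontier \<Omega>. \<exists>r G. local_defining_function \<Omega> p r G}"

text \<open>
  The boundary has finite area and consists of smooth (\<open>C\<^sup>1\<close>) hypersurface pieces with \<open>\<Omega>\<close> on one
  side, apart from a set of edges and corners of vanishing \<open>(n-1)\<close>-dimensional measure.  Both
  conditions hold when the boundary is a finite union of compact smooth pieces that meet along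
  sets of lower dimension.
\<close>

definition piecewise_smooth_boundary :: "('a::euclidean_space) set \<Rightarrow> bool" where
  "piecewise_smooth_boundary \<Omega> \<longleftrightarrow>
     emeasure (hausdorff_measure (DIM('a) - 1)) (frontier \<Omega>) < \<infinity> \<and>
     emeasure (hausdorff_measure (DIM('a) - 1)) (frontier \<Omega> - smooth_boundary_points \<Omega>) = 0"

text \<open>
  The normalised gradient does not depend on the choice of the local defining function.  Edges and
  corners, which have no normal, form a null set; the value there is set to 0.
\<close>

definition outward_normal :: "('a::euclidean_space) set \<Rightarrow> 'a \<Rightarrow> 'a" where
  "outward_normal \<Omega> p =
     (if p \<in> smooth_boundary_points \<Omega>
      then THE v. \<exists>r G. local_defining_function \<Omega> p r G \<and> v = G p /\<^sub>R norm (G p)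
      else 0)"


section \<open>The translated integral and its critical points\<close>

definition Sigma_fun :: "(real ^ 'n \<Rightarrow> real) \<Rightarrow> (real ^ 'n) set \<Rightarrow> real ^ 'n \<Rightarrow> real" where
  "Sigma_fun f \<Omega> X = (LINT P:\<Omega>|lebesgue. f (P - X))"

definition critical_point :: "('a::real_normed_vector \<Rightarrow> real) \<Rightarrow> 'a \<Rightarrow> bool" where
  "critical_point g m \<longleftrightarrow> (g has_derivative (\<lambda>\<delta>. 0)) (at m)"

end

theory Submission
  imports Defs
begin

text \<open>
  Up to null sets, \<open>\<Sigma> (m + \<delta>) - \<Sigma> m\<close> is the integral of \<open>f (x - m)\<close> against the difference of the
  indicators of \<open>\<Omega> - \<delta>\<close> and \<open>\<Omega>\<close>, and this difference lives on the tube swept out by the boundary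
  under the shift.  Covering a compact set \<open>S\<close> by small balls bounds the volume of its tube by a
  constant times \<open>\<bar>\<delta>\<bar>\<close> times the area of \<open>S\<close>, so edges and corners contribute \<open>o(\<bar>\<delta>\<bar>)\<close>.  Near a
  smooth point the boundary is almost flat: shifts along the normal \<open>\<nu>\<close> are computed by Fubini's theorem, other
  shifts are squeezed between two normal ones because \<open>\<Omega>\<close> is monotone along a cone of directions
  around \<open>\<nu>\<close>, and the area of the boundary piece is comparable to that of its projection.  A
  partition of unity shows that \<open>\<Sigma>\<close> is differentiable, with gradient a negative multiple of the boundary integral.
\<close>

section \<open>Hausdorff measure\<close>

text \<open>Since \<open>f\<close> is merely continuous, nothing can be differentiated under the
  integral sign: a translation of the variable puts the whole increment on the region, and the
  first-order term must come from the geometry of the boundary. Two obstacles shape the argument.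
  The normalisation of Hausdorff measure against Lebesgue measure on a hyperplane stays an
  unevaluated constant \<open>c > 0\<close>; the vanishing of a gradient is insensitive to it,
  provided that one \<open>c\<close> serves all directions. And the errors of the flat approximation
  have to survive summation over a number of pieces that is not controlled as \<epsilon> shrinks.
  Each local error is therefore measured as a multiple of \<epsilon> times the surface integral of
  the piece's share of \<open>f\<close>; for \<open>f\<close> of one sign these shares add up to one
  integral over the whole boundary, whatever the number of pieces. Only the remainders of smaller
  order than the shift are fixed after that number is known.\<close>

definition hausdorff_weight :: "nat \<Rightarrow> 'a::metric_space set \<Rightarrow> ennreal" where
  "hausdorff_weight d C = (if C = {} then 0 else ennreal (unit_ball_vol (real d) * (diameter C / 2) ^ d))"

lemma hausdorff_weight_empty [simp]: "hausdorff_weight d {} = 0"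
  by (simp add: hausdorff_weight_def)

section \<open>Covers at a fixed mesh\<close>

lemma hausdorff_pre_le:
  assumes "A \<subseteq> (\<Union>i. C i)" "\<And>i. bounded (C i)" "\<And>i. diameter (C i) \<le> \<delta>"
  shows "hausdorff_pre d \<delta> A \<le> (\<Sum>i. hausdorff_weight d (C i))"
  unfolding hausdorff_pre_def hausdorff_weight_def using assms by (intro INF_lower) auto

lemma hausdorff_pre_greatest:
  assumes "\<And>C :: nat \<Rightarrow> 'a::metric_space set. A \<subseteq> (\<Union>i. C i) \<Longrightarrow> (\<And>i. bounded (C i)) \<Longrightarrow>
      (\<And>i. diameter (C i) \<le> \<delta>) \<Longrightarrow> u \<le> (\<Sum>i. hausdorff_weight d (C i))"
  shows "u \<le> hausdorff_pre d \<delta> A"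
  unfolding hausdorff_pre_def hausdorff_weight_def[symmetric] using assms by (intro INF_greatest) auto

lemma hausdorff_pre_lessE:
  assumes "hausdorff_pre d \<delta> A < u"
  obtains C :: "nat \<Rightarrow> 'a::metric_space set" where "A \<subseteq> (\<Union>i. C i)" "\<And>i. bounded (C i)"
    "\<And>i. diameter (C i) \<le> \<delta>" "(\<Sum>i. hausdorff_weight d (C i)) < u"
  using assms hausdorff_pre_greatest[of A \<delta> u d] by (meson not_le)

lemma hausdorff_pre_mono: "A \<subseteq> B \<Longrightarrow> hausdorff_pre d \<delta> A \<le> hausdorff_pre d \<delta> B"
  by (intro hausdorff_pre_greatest hausdorff_pre_le) auto

lemma hausdorff_pre_antimono: "\<delta> \<le> \<delta>' \<Longrightarrow> hausdorff_pre d \<delta>' A \<le> hausdorff_pre d \<delta> A"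
  by (intro hausdorff_pre_greatest hausdorff_pre_le) (auto intro: order_trans)

lemma hausdorff_pre_empty: "0 \<le> \<delta> \<Longrightarrow> hausdorff_pre d \<delta> {} = 0"
  using hausdorff_pre_le[of "{}" "\<lambda>_. {}" \<delta> d] by simp

text \<open>Each \<open>A i\<close> gets a cover within \<open>e / 2 ^ (i + 1)\<close> of the
  infimum, and \<open>prod_decode\<close> merges the double sequence into one cover. The mesh
  condition survives because it concerns each covering set separately.\<close>

lemma hausdorff_pre_UN:
  fixes A :: "nat \<Rightarrow> 'a::metric_space set"
  shows "hausdorff_pre d \<delta> (\<Union>i. A i) \<le> (\<Sum>i. hausdorff_pre d \<delta> (A i))"
proof (rule ennreal_le_epsilon)
  fix e :: real assume fin: "(\<Sum>i. hausdorff_pre d \<delta> (A i)) < top" and e: "0 < e"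
  have "\<exists>C. A i \<subseteq> (\<Union>j. C j) \<and> (\<forall>j. bounded (C j) \<and> diameter (C j) \<le> \<delta>) \<and>
      (\<Sum>j. hausdorff_weight d (C j)) \<le> hausdorff_pre d \<delta> (A i) + ennreal (e * (1/2) ^ Suc i)" for i
  proof -
    have "hausdorff_pre d \<delta> (A i) < top"
      using fin ennreal_suminf_lessD by blast
    then have "hausdorff_pre d \<delta> (A i) < hausdorff_pre d \<delta> (A i) + ennreal (e * (1/2) ^ Suc i)"
      using e by (simp add: ennreal_zero_less_mult_iff)
    from hausdorff_pre_lessE[OF this] show ?thesis by (metis less_imp_le)
  qed
  then obtain C where C: "\<And>i. A i \<subseteq> (\<Union>j. C i j)" "\<And>i j. bounded (C i j)" "\<And>i j. diameter (C i j) \<le> \<delta>"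
     "\<And>i. (\<Sum>j. hausdorff_weight d (C i j)) \<le> hausdorff_pre d \<delta> (A i) + ennreal (e * (1/2) ^ Suc i)"
    by metis
  have "hausdorff_pre d \<delta> (\<Union>i. A i) \<le> (\<Sum>k. hausdorff_weight d (case prod_decode k of (i, j) \<Rightarrow> C i j))"
  proof (rule hausdorff_pre_le)
    show "(\<Union>i. A i) \<subseteq> (\<Union>k. case prod_decode k of (i, j) \<Rightarrow> C i j)"
    proof
      fix x assume "x \<in> (\<Union>i. A i)"
      then obtain i j where "x \<in> C i j" using C(1) by blast
      then have "x \<in> (case prod_decode (prod_encode (i, j)) of (i, j) \<Rightarrow> C i j)" by simp
      then show "x \<in> (\<Union>k. case prod_decode k of (i, j) \<Rightarrow> C i j)" by (rule UN_I[OF UNIV_I])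
    qed
  qed (auto simp: C split: prod.splits)
  also have "\<dots> = (\<Sum>k. (\<lambda>p. hausdorff_weight d (C (fst p) (snd p))) (prod_decode k))"
    by (simp add: case_prod_beta)
  also have "\<dots> = (\<Sum>i. \<Sum>j. hausdorff_weight d (C i j))"
    by (subst suminf_ennreal_2dimen[where g = "\<lambda>i. \<Sum>j. hausdorff_weight d (C i j)"]) auto
  also have "\<dots> \<le> (\<Sum>i. hausdorff_pre d \<delta> (A i) + ennreal (e * (1/2) ^ Suc i))"
    by (intro suminf_le C) auto
  also have "\<dots> = (\<Sum>i. hausdorff_pre d \<delta> (A i)) + (\<Sum>i. ennreal (e * (1/2) ^ Suc i))"
    by (simp add: suminf_add)
  also have "(\<Sum>i. ennreal (e * (1/2) ^ Suc i)) = ennreal e"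
    using e sums_mult[OF power_half_series, of e] by (intro suminf_ennreal_eq) auto
  finally show "hausdorff_pre d \<delta> (\<Union>i. A i) \<le> (\<Sum>i. hausdorff_pre d \<delta> (A i)) + ennreal e" .
qed

section \<open>The limit of vanishing mesh\<close>

lemma hausdorff_pre_le_outer: "0 < \<delta> \<Longrightarrow> hausdorff_pre d \<delta> A \<le> hausdorff_outer d A"
  unfolding hausdorff_outer_def by (auto intro: SUP_upper)

lemma hausdorff_outer_least: "(\<And>\<delta>. 0 < \<delta> \<Longrightarrow> hausdorff_pre d \<delta> A \<le> u) \<Longrightarrow> hausdorff_outer d A \<le> u"
  unfolding hausdorff_outer_def by (auto intro: SUP_least)

lemma hausdorff_outer_mono: "A \<subseteq> B \<Longrightarrow> hausdorff_outer d A \<le> hausdorff_outer d B"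
  by (intro hausdorff_outer_least) (meson hausdorff_pre_le_outer hausdorff_pre_mono order_trans)

lemma hausdorff_outer_empty [simp]: "hausdorff_outer d {} = 0"
  by (rule antisym, intro hausdorff_outer_least) (auto simp: hausdorff_pre_empty)

lemma hausdorff_outer_UN: "hausdorff_outer d (\<Union>i. A i) \<le> (\<Sum>i. hausdorff_outer d (A i))"
  by (intro hausdorff_outer_least order_trans[OF hausdorff_pre_UN] suminf_le)
     (auto simp: hausdorff_pre_le_outer)

lemma hausdorff_outer_Un: "hausdorff_outer d (A \<union> B) \<le> hausdorff_outer d A + hausdorff_outer d B"
proof -
  have "A \<union> B = (\<Union>i. binaryset A B i)" by (simp add: UN_binaryset_eq)
  moreover have "(\<Sum>i. hausdorff_outer d (binaryset A B i)) = hausdorff_outer d A + hausdorff_outer d B"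
    by (rule suminf_binaryset_eq) auto
  ultimately show ?thesis using hausdorff_outer_UN[of d "binaryset A B"] by simp
qed

text \<open>The premeasures increase as the mesh shrinks, so the supremum is a limit along one
  sequence of meshes. In this form inequalities between sums of premeasures pass to the outer
  measure.\<close>

lemma hausdorff_outer_tendsto:
  "((\<lambda>k. hausdorff_pre d (1 / real (Suc k)) A) \<longlongrightarrow> hausdorff_outer d A) sequentially"
proof -
  have "incseq (\<lambda>k. hausdorff_pre d (1 / real (Suc k)) A)"
    by (intro incseq_SucI hausdorff_pre_antimono) (auto simp: field_simps)
  moreover have "(SUP k. hausdorff_pre d (1 / real (Suc k)) A) = hausdorff_outer d A"
  proof (rule antisym)
    show "(SUP k. hausdorff_pre d (1 / real (Suc k)) A) \<le> hausdorff_outer d A"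
      by (intro SUP_least hausdorff_pre_le_outer) auto
    show "hausdorff_outer d A \<le> (SUP k. hausdorff_pre d (1 / real (Suc k)) A)"
    proof (rule hausdorff_outer_least)
      fix \<delta> :: real assume "0 < \<delta>"
      then obtain k where "1 / real (Suc k) < \<delta>" using nat_approx_posE by blast
      then have "hausdorff_pre d \<delta> A \<le> hausdorff_pre d (1 / real (Suc k)) A"
        by (intro hausdorff_pre_antimono) auto
      then show "hausdorff_pre d \<delta> A \<le> (SUP k. hausdorff_pre d (1 / real (Suc k)) A)"
        by (meson SUP_upper UNIV_I order_trans)
    qed
  qed
  ultimately show ?thesis using LIMSEQ_SUP by metis
qed

text \<open>A set of diameter below \<rho> cannot meet both \<open>A\<close> and \<open>B\<close>. A
  fine cover of the union thus splits into a cover of \<open>A\<close> and a cover of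
  \<open>B\<close> that share no nonempty set, and the weights add.\<close>

lemma hausdorff_outer_separated:
  fixes A B :: "'a::metric_space set"
  assumes "0 < \<rho>" and sep: "\<And>x y. x \<in> A \<Longrightarrow> y \<in> B \<Longrightarrow> \<rho> \<le> dist x y"
  shows "hausdorff_outer d A + hausdorff_outer d B \<le> hausdorff_outer d (A \<union> B)"
proof -
  have pre: "hausdorff_pre d \<delta> A + hausdorff_pre d \<delta> B \<le> hausdorff_pre d \<delta> (A \<union> B)"
    if "0 < \<delta>" "\<delta> < \<rho>" for \<delta>
  proof (rule hausdorff_pre_greatest)
    fix C :: "nat \<Rightarrow> 'a set"
    assume C: "A \<union> B \<subseteq> (\<Union>i. C i)" "\<And>i. bounded (C i)" "\<And>i. diameter (C i) \<le> \<delta>"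
    define CA where "CA i = (if C i \<inter> A = {} then {} else C i)" for i
    define CB where "CB i = (if C i \<inter> B = {} then {} else C i)" for i
    have disj: "C i \<inter> A = {} \<or> C i \<inter> B = {}" for i
    proof (rule ccontr)
      assume "\<not> ?thesis"
      then obtain x y where "x \<in> C i" "x \<in> A" "y \<in> C i" "y \<in> B" by blast
      then have "\<rho> \<le> dist x y" "dist x y \<le> diameter (C i)"
        using sep diameter_bounded_bound[OF C(2)] by auto
      then show False using C(3)[of i] that by linarith
    qed
    have "hausdorff_pre d \<delta> A \<le> (\<Sum>i. hausdorff_weight d (CA i))"
    proof (rule hausdorff_pre_le)
      show "A \<subseteq> (\<Union>i. CA i)" using C(1) unfolding CA_def by fastforce
    qed (use C that in \<open>auto simp: CA_def\<close>)
    moreover have "hausdorff_pre d \<delta> B \<le> (\<Sum>i. hausdorff_weight d (CB i))"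
    proof (rule hausdorff_pre_le)
      show "B \<subseteq> (\<Union>i. CB i)" using C(1) unfolding CB_def by fastforce
    qed (use C that in \<open>auto simp: CB_def\<close>)
    moreover have "(\<Sum>i. hausdorff_weight d (CA i)) + (\<Sum>i. hausdorff_weight d (CB i)) \<le> (\<Sum>i. hausdorff_weight d (C i))"
      unfolding suminf_add[OF summableI summableI]
      by (intro suminf_le) (use disj in \<open>auto simp: CA_def CB_def\<close>)
    ultimately show "hausdorff_pre d \<delta> A + hausdorff_pre d \<delta> B \<le> (\<Sum>i. hausdorff_weight d (C i))"
      by (meson add_mono order_trans)
  qed
  have "(\<lambda>k. hausdorff_pre d (1 / real (Suc k)) A + hausdorff_pre d (1 / real (Suc k)) B)
      \<longlonglongrightarrow> hausdorff_outer d A + hausdorff_outer d B"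
    by (intro tendsto_add hausdorff_outer_tendsto)
  moreover have "\<forall>\<^sub>F k in sequentially. hausdorff_pre d (1 / real (Suc k)) A + hausdorff_pre d (1 / real (Suc k)) B
      \<le> hausdorff_outer d (A \<union> B)"
  proof -
    obtain N where N: "1 / real (Suc N) < \<rho>" using nat_approx_posE[OF assms(1)] by blast
    have "hausdorff_pre d (1 / real (Suc k)) A + hausdorff_pre d (1 / real (Suc k)) B
      \<le> hausdorff_outer d (A \<union> B)" if "k \<ge> N" for k
    proof -
      have "1 / real (Suc k) \<le> 1 / real (Suc N)" using that by (simp add: frac_le)
      then have "1 / real (Suc k) < \<rho>" using N by linarith
      then show ?thesis using pre[of "1 / real (Suc k)"] hausdorff_pre_le_outer[of "1 / real (Suc k)" d "A \<union> B"]
        by auto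
    qed
    then show ?thesis using eventually_sequentially by auto
  qed
  ultimately show ?thesis using tendsto_upperbound trivial_limit_sequentially by blast
qed

text \<open>
  Caratheodory's criterion.  \<open>A - F\<close> is exhausted by the sets \<open>D n\<close> of its points at distance at least
  \<open>1 / (n + 1)\<close> from \<open>F\<close>; every second shell \<open>D (n + 1) - D n\<close> is separated from
  the others, so the shells have finite total measure.
\<close>

lemma hausdorff_outer_closed_split:
  fixes F A :: "'a::metric_space set"
  assumes "closed F"
  shows "hausdorff_outer d (A \<inter> F) + hausdorff_outer d (A - F) \<le> hausdorff_outer d A"
proof (cases "F = {} \<or> hausdorff_outer d A = top")
  case False
  then have F: "F \<noteq> {}" and fin: "hausdorff_outer d A < top" by (auto simp: less_top)
  let ?h = "hausdorff_outer d"
  define D where "D n = {x \<in> A. 1 / real (Suc n) \<le> infdist x F}" for n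
  define S where "S n = D (Suc n) - D n" for n
  have D_mono: "D m \<subseteq> D n" if "m \<le> n" for m n
  proof -
    have "1 / real (Suc n) \<le> 1 / real (Suc m)" using that by (simp add: frac_le)
    then show ?thesis unfolding D_def by auto
  qed
  have DA: "D n \<subseteq> A - F" for n unfolding D_def using F by (auto simp: divide_le_0_iff)
  have ex: "A - F = D n \<union> (\<Union>k. S (k + n))" for n
  proof -
    have "x \<in> D n \<union> (\<Union>k. S (k + n))" if x: "x \<in> A" "x \<notin> F" for x
    proof -
      have "infdist x F > 0" using assms F x infdist_pos_not_in_closed by blast
      then obtain m where "1 / real (Suc m) < infdist x F" using nat_approx_posE by blast
      then have "x \<in> D m" using x by (auto simp: D_def)
      show ?thesis
      proof (cases "x \<in> D n")
        case False
        \<comment> \<open>Since \<open>x\<close> is not in \<open>D n\<close> and the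
          \<open>D\<close> increase, the first index with \<open>x\<close> in \<open>D l\<close>
          exceeds \<open>n\<close>, and \<open>x\<close> lies in the shell just below it.\<close>
        define l where "l = (LEAST m. x \<in> D m)"
        have l: "x \<in> D l" "\<And>k. k < l \<Longrightarrow> x \<notin> D k"
          unfolding l_def using \<open>x \<in> D m\<close> by (auto intro: LeastI dest: not_less_Least)
        then have "l > n" using D_mono[of l n] False by fastforce
        then have "x \<in> S (l - 1)" using l by (auto simp: S_def)
        then have "x \<in> S ((l - 1 - n) + n)" using \<open>l > n\<close> by simp
        then show ?thesis by blast
      qed auto
    qed
    then show ?thesis using DA unfolding S_def by blast
  qed
  \<comment> \<open>The distance to \<open>F\<close> is 1-Lipschitz; it is at least
    \<open>1 / (n + 1)\<close> on \<open>D n\<close> and below \<open>1 / (m + 1)\<close> outside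
    \<open>D m\<close>.\<close>
  have sepS: "?h E + ?h (S m) \<le> ?h (E \<union> S m)" if "E \<subseteq> D n" "n < m" for E n m
  proof (rule hausdorff_outer_separated)
    show "0 < 1 / real (Suc n) - 1 / real (Suc m)" using that by (simp add: frac_less2)
    fix x y assume "x \<in> E" "y \<in> S m"
    then have "1 / real (Suc n) \<le> infdist x F" "infdist y F < 1 / real (Suc m)"
      using that by (auto simp: S_def D_def)
    then show "1 / real (Suc n) - 1 / real (Suc m) \<le> dist x y"
      using infdist_triangle[of x F y] by (simp add: dist_commute)
  qed
  \<comment> \<open>Consecutive shells may touch, so only shells of the same parity \<open>p\<close>
    are added. \<open>D (2 * N + p + 1)\<close> contains the shells counted so far, and skipping one
    index leaves a positive gap to the next shell counted.\<close>
  have shells: "(\<Sum>k<Suc N. ?h (S (2 * k + p))) \<le> ?h (D (2 * N + p + 1))" for N p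
  proof (induction N)
    case 0
    show ?case by (auto simp: S_def intro: hausdorff_outer_mono)
  next
    case (Suc N)
    have "(\<Sum>k<Suc (Suc N). ?h (S (2 * k + p))) \<le> ?h (D (2 * N + p + 1)) + ?h (S (2 * Suc N + p))"
      unfolding sum.lessThan_Suc[of _ "Suc N"] using Suc.IH by (intro add_right_mono)
    also have "\<dots> \<le> ?h (D (2 * N + p + 1) \<union> S (2 * Suc N + p))"
      by (rule sepS) auto
    also have "\<dots> \<le> ?h (D (2 * Suc N + p + 1))"
      using D_mono[of "2 * N + p + 1" "2 * Suc N + p + 1"] by (intro hausdorff_outer_mono) (auto simp: S_def)
    finally show ?case .
  qed
  have DhA: "?h (D n) \<le> ?h A" for n using DA by (intro hausdorff_outer_mono) blast
  have "(\<Sum>k<n. ?h (S k)) \<le> 2 * ?h A" for n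
  proof -
    have "(\<Sum>k<n. ?h (S k)) \<le> (\<Sum>k<2 * Suc n. ?h (S k))" by (intro sum_mono2) auto
    also have "\<dots> = (\<Sum>k<Suc n. ?h (S (2 * k + 0))) + (\<Sum>k<Suc n. ?h (S (2 * k + 1)))"
      by (induction n) (auto simp: ac_simps)
    also have "\<dots> \<le> ?h A + ?h A"
      by (intro add_mono order_trans[OF shells] DhA)
    finally show ?thesis by (simp add: mult_2)
  qed
  then have "(\<Sum>k. ?h (S k)) \<le> 2 * ?h A" by (intro suminf_le_const) auto
  also have "\<dots> < top" using fin by (simp add: ennreal_mult_less_top)
  finally have sfin: "(\<Sum>k. ?h (S k)) < top" .
  \<comment> \<open>All values are finite, so the series can be read in the reals, where the tails
    of a convergent series tend to 0.\<close>
  define a where "a k = enn2real (?h (S k))" for k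
  have ha: "?h (S k) = ennreal (a k)" for k
    unfolding a_def using sfin ennreal_suminf_lessD by (metis ennreal_enn2real)
  have a0: "0 \<le> a k" for k by (simp add: a_def)
  have suma: "summable a"
    using sfin a0 unfolding ha by (intro summable_suminf_not_top) auto
  show ?thesis
  proof (rule ennreal_le_epsilon)
    fix e :: real assume "0 < e"
    then obtain n where "norm (\<Sum>k. a (k + n)) < e"
      using suminf_exist_split[OF _ suma, of e] by blast
    then have n: "(\<Sum>k. a (k + n)) < e" by simp
    have "?h (A - F) \<le> ?h (D n) + ?h (\<Union>k. S (k + n))"
      unfolding ex[of n] by (rule hausdorff_outer_Un)
    also have "?h (\<Union>k. S (k + n)) \<le> (\<Sum>k. ?h (S (k + n)))" by (rule hausdorff_outer_UN)
    also have "\<dots> = ennreal (\<Sum>k. a (k + n))"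
      unfolding ha using a0 suma by (intro suminf_ennreal2) (auto simp: summable_iff_shift)
    also have "\<dots> \<le> ennreal e" using n by (intro ennreal_leI) auto
    finally have "?h (A \<inter> F) + ?h (A - F) \<le> ?h (A \<inter> F) + ?h (D n) + ennreal e"
      by (simp add: add.assoc add_left_mono)
    also have "?h (A \<inter> F) + ?h (D n) \<le> ?h (A \<inter> F \<union> D n)"
    proof (rule hausdorff_outer_separated)
      fix x y assume "x \<in> A \<inter> F" "y \<in> D n"
      then show "1 / real (Suc n) \<le> dist x y"
        using infdist_le[of x F y] by (auto simp: D_def dist_commute)
    qed auto
    also have "\<dots> \<le> ?h A" by (intro hausdorff_outer_mono) (auto simp: D_def)
    finally show "?h (A \<inter> F) + ?h (A - F) \<le> ?h A + ennreal e" by (simp add: add_right_mono)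
  qed
qed auto

text \<open>The Caratheodory-measurable sets form a sigma-algebra on which the outer measure is
  countably additive. It contains the closed sets, and these generate the Borel sets.\<close>

lemma measure_space_hausdorff:
  "measure_space UNIV (sets borel) (hausdorff_outer d :: 'a::metric_space set \<Rightarrow> ennreal)"
proof -
  let ?h = "hausdorff_outer d :: 'a set \<Rightarrow> ennreal"
  interpret sigma_algebra "UNIV :: 'a set" UNIV using sigma_algebra_Pow[of UNIV] by simp
  have oms: "outer_measure_space UNIV ?h"
    by (auto simp: outer_measure_space_def positive_def increasing_def countably_subadditive_def
        hausdorff_outer_mono hausdorff_outer_UN)
  have ms: "measure_space UNIV (lambda_system UNIV UNIV ?h) ?h" by (rule caratheodory_lemma[OF oms])
  have closed: "F \<in> lambda_system UNIV UNIV ?h" if "closed F" for F :: "'a set"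
    unfolding lambda_system_eq
  proof clarsimp
    fix A :: "'a set"
    have "?h A \<le> ?h (A \<inter> F) + ?h (A - F)"
      using hausdorff_outer_Un[of d "A \<inter> F" "A - F"] by (simp add: Int_Diff_Un)
    then show "?h (A \<inter> F) + ?h (A - F) = ?h A"
      using hausdorff_outer_closed_split[OF that, of d A] by simp
  qed
  have "sigma_sets UNIV (Collect closed) \<subseteq> lambda_system UNIV UNIV ?h"
    using ms closed by (intro sigma_algebra.sigma_sets_subset) (auto simp: measure_space_def)
  then have "sets borel \<subseteq> lambda_system UNIV UNIV ?h"
    by (simp add: borel_eq_closed)
  moreover have "sigma_algebra (UNIV :: 'a set) (sets borel)"
    using sets.sigma_algebra_axioms[of "borel :: 'a measure"] by simp
  ultimately show ?thesis
    using ms unfolding measure_space_def positive_def countably_additive_def by (simp add: subset_iff)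
qed

lemma sets_hausdorff_measure [simp, measurable_cong]: "sets (hausdorff_measure d) = sets borel"
  unfolding hausdorff_measure_def using sets.sigma_sets_eq[of borel] sets.space_closed[of borel]
  by (subst sets_measure_of) auto

lemma space_hausdorff_measure [simp]: "space (hausdorff_measure d) = UNIV"
  using sets_eq_imp_space_eq[OF sets_hausdorff_measure] by simp

lemma emeasure_hausdorff_measure:
  assumes "A \<in> sets borel"
  shows "emeasure (hausdorff_measure d) A = hausdorff_outer d A"
  unfolding hausdorff_measure_def using measure_space_hausdorff[of d] assms
  by (intro emeasure_measure_of_sigma) (auto simp: measure_space_def)

section \<open>Lipschitz images\<close>

lemma ennreal_divide_mult_cancel: "0 < c \<Longrightarrow> x / ennreal c * ennreal c = x"
  by (simp add: ennreal_divide_times divide_ennreal ennreal_1)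

text \<open>The images of the sets of a cover of mesh \<open>\<delta> / L\<close> form a cover of
  mesh \<delta>. The covering sets are first cut down to \<open>A\<close>, since \<open>g\<close> is
  controlled only there.\<close>

lemma hausdorff_outer_lipschitz:
  fixes g :: "'a::metric_space \<Rightarrow> 'b::metric_space"
  assumes "0 < L" and lip: "\<And>x y. x \<in> A \<Longrightarrow> y \<in> A \<Longrightarrow> dist (g x) (g y) \<le> L * dist x y"
  shows "hausdorff_outer d (g ` A) \<le> ennreal (L ^ d) * hausdorff_outer d A"
proof (rule hausdorff_outer_least)
  fix \<delta> :: real assume "0 < \<delta>"
  \<comment> \<open>The factor is divided out on the left so that the right-hand side is a bare
    infimum over covers of \<open>A\<close>.\<close>
  have "hausdorff_pre d \<delta> (g ` A) / ennreal (L ^ d) \<le> hausdorff_pre d (\<delta> / L) A"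
  proof (rule hausdorff_pre_greatest)
    fix C :: "nat \<Rightarrow> 'a set"
    assume C: "A \<subseteq> (\<Union>i. C i)" "\<And>i. bounded (C i)" "\<And>i. diameter (C i) \<le> \<delta> / L"
    have dist: "dist x y \<le> L * diameter (C i)" if xy: "x \<in> g ` (C i \<inter> A)" "y \<in> g ` (C i \<inter> A)" for x y i
    proof -
      obtain u v where uv: "x = g u" "y = g v" "u \<in> C i" "v \<in> C i" "u \<in> A" "v \<in> A" using xy by blast
      then have "dist x y \<le> L * dist u v" using lip by auto
      also have "\<dots> \<le> L * diameter (C i)"
        using uv diameter_bounded_bound[OF C(2)] assms by (intro mult_left_mono) auto
      finally show ?thesis .
    qed
    then have bdd: "bounded (g ` (C i \<inter> A))" for i
      unfolding bounded_two_points by blast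
    have dia: "diameter (g ` (C i \<inter> A)) \<le> L * diameter (C i)" for i
    proof (cases "g ` (C i \<inter> A) = {}")
      case True
      have "0 \<le> diameter (C i)" using C(2) diameter_ge_0 by blast
      then show ?thesis using True assms by simp
    next
      case False
      then show ?thesis unfolding diameter_def[of "g ` (C i \<inter> A)"]
        using dist by (auto intro!: cSUP_least)
    qed
    have "hausdorff_pre d \<delta> (g ` A) \<le> (\<Sum>i. hausdorff_weight d (g ` (C i \<inter> A)))"
    proof (rule hausdorff_pre_le)
      show "diameter (g ` (C i \<inter> A)) \<le> \<delta>" for i
        using dia[of i] C(3)[of i] \<open>0 < L\<close> by (simp add: field_simps)
    qed (use C(1) bdd in \<open>auto, blast\<close>)
    also have "\<dots> \<le> (\<Sum>i. ennreal (L ^ d) * hausdorff_weight d (C i))"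
    proof (intro suminf_le summableI)
      fix i
      show "hausdorff_weight d (g ` (C i \<inter> A)) \<le> ennreal (L ^ d) * hausdorff_weight d (C i)"
      proof (cases "C i \<inter> A = {}")
        case False
        have "(diameter (g ` (C i \<inter> A)) / 2) ^ d \<le> (L * (diameter (C i) / 2)) ^ d"
          using dia[of i] diameter_ge_0[OF bdd, of i] by (intro power_mono) auto
        then have "unit_ball_vol (real d) * (diameter (g ` (C i \<inter> A)) / 2) ^ d
            \<le> unit_ball_vol (real d) * (L * (diameter (C i) / 2)) ^ d"
          by (intro mult_left_mono) auto
        also have "\<dots> = L ^ d * (unit_ball_vol (real d) * (diameter (C i) / 2) ^ d)"
          by (simp only: power_mult_distrib mult.left_commute)
        finally have "unit_ball_vol (real d) * (diameter (g ` (C i \<inter> A)) / 2) ^ d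
            \<le> L ^ d * (unit_ball_vol (real d) * (diameter (C i) / 2) ^ d)" .
        moreover have "C i \<noteq> {}" "g ` (C i \<inter> A) \<noteq> {}" using False by auto
        ultimately show ?thesis
          using \<open>0 < L\<close> by (simp add: hausdorff_weight_def ennreal_mult'[symmetric] ennreal_leI)
      qed auto
    qed
    finally show "hausdorff_pre d \<delta> (g ` A) / ennreal (L ^ d) \<le> (\<Sum>i. hausdorff_weight d (C i))"
      using \<open>0 < L\<close> by (auto simp: ennreal_suminf_cmult intro!: divide_le_posI_ennreal)
  qed
  also have "\<dots> \<le> hausdorff_outer d A"
    using \<open>0 < L\<close> \<open>0 < \<delta>\<close> by (intro hausdorff_pre_le_outer) auto
  finally have "hausdorff_pre d \<delta> (g ` A) / ennreal (L ^ d) * ennreal (L ^ d) \<le> hausdorff_outer d A * ennreal (L ^ d)"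
    by (intro mult_right_mono) auto
  then show "hausdorff_pre d \<delta> (g ` A) \<le> ennreal (L ^ d) * hausdorff_outer d A"
    using \<open>0 < L\<close> by (simp only: ennreal_divide_mult_cancel zero_less_power mult.commute[of "ennreal (L ^ d)"])
qed

text \<open>Both \<open>g\<close> and its inverse on the image of \<open>A\<close> are Lipschitz
  with constant 1.\<close>

lemma hausdorff_outer_isometry:
  fixes g :: "'a::metric_space \<Rightarrow> 'b::metric_space"
  assumes "\<And>x y. x \<in> A \<Longrightarrow> y \<in> A \<Longrightarrow> dist (g x) (g y) = dist x y"
  shows "hausdorff_outer d (g ` A) = hausdorff_outer d A"
proof (rule antisym)
  show "hausdorff_outer d (g ` A) \<le> hausdorff_outer d A"
    using hausdorff_outer_lipschitz[of 1 A g d] assms by simp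
  have inj: "inj_on g A" by (intro inj_onI) (metis assms dist_eq_0_iff)
  have "hausdorff_outer d (inv_into A g ` (g ` A)) \<le> hausdorff_outer d (g ` A)"
  proof (rule order_trans[OF hausdorff_outer_lipschitz[of 1]])
    show "dist (inv_into A g x) (inv_into A g y) \<le> 1 * dist x y" if "x \<in> g ` A" "y \<in> g ` A" for x y
      using that inj assms by auto
  qed auto
  then show "hausdorff_outer d A \<le> hausdorff_outer d (g ` A)"
    using inj by (simp add: image_comp inv_into_f_f)
qed

section \<open>Tubes\<close>

text \<open>The Minkowski sum of \<open>S\<close> with the segment from 0 to \<delta>. A point whose
  segment to its \<delta>-translate hits \<open>S\<close> belongs to the tube of \<open>S\<close> in
  direction \<open>- \<delta>\<close>.\<close>

definition tube :: "'a::real_normed_vector set \<Rightarrow> 'a \<Rightarrow> 'a set" where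
  "tube S \<delta> = (\<lambda>(x, t). x + t *\<^sub>R \<delta>) ` (S \<times> {0..1})"

lemma mem_tube: "q \<in> tube S \<delta> \<longleftrightarrow> (\<exists>x\<in>S. \<exists>t. 0 \<le> t \<and> t \<le> 1 \<and> q = x + t *\<^sub>R \<delta>)"
  unfolding tube_def by force

lemma tube_UN_subset: "S \<subseteq> (\<Union>i. C i) \<Longrightarrow> tube S \<delta> \<subseteq> (\<Union>i. tube (C i) \<delta>)"
  by (fastforce simp: mem_tube)

lemma tube_mono: "S \<subseteq> T \<Longrightarrow> tube S \<delta> \<subseteq> tube T \<delta>"
  by (fastforce simp: mem_tube)

lemma subset_tube: "S \<subseteq> tube S \<delta>"
  by (force simp: mem_tube intro: exI[of _ 0])

lemma compact_tube: "compact S \<Longrightarrow> compact (tube S \<delta>)"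
  unfolding tube_def by (intro compact_continuous_image compact_Times continuous_intros)
     (auto simp: case_prod_beta intro!: continuous_intros)

text \<open>Balls of radius \<open>2 * \<rho>\<close> centred at steps of length \<rho> along
  \<delta> cover the tube. Their number is at most \<open>norm \<delta> / \<rho> + 1\<close>, which
  is at most twice \<open>norm \<delta> / \<rho>\<close>; this 2 and the doubled radius account for
  the power of 2.\<close>

lemma emeasure_tube_cball_le:
  fixes x \<delta> :: "'a::euclidean_space"
  assumes "0 < \<rho>" "\<rho> \<le> norm \<delta>"
  shows "emeasure lborel (tube (cball x \<rho>) \<delta>)
    \<le> ennreal (2 ^ (DIM('a) + 1) * unit_ball_vol (real DIM('a)) * norm \<delta> * \<rho> ^ (DIM('a) - 1))"
proof -
  define m where "m = nat \<lfloor>norm \<delta> / \<rho>\<rfloor>"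
  define c where "c k = x + (real k * \<rho> / norm \<delta>) *\<^sub>R \<delta>" for k
  have pos: "0 < norm \<delta>" using assms by linarith
  have m: "real m \<le> norm \<delta> / \<rho>" unfolding m_def using assms by (simp add: of_nat_floor)
  have "tube (cball x \<rho>) \<delta> \<subseteq> (\<Union>k\<in>{..m}. cball (c k) (2 * \<rho>))"
  proof
    fix q assume "q \<in> tube (cball x \<rho>) \<delta>"
    then obtain y t where q: "dist x y \<le> \<rho>" "0 \<le> t" "t \<le> 1" "q = y + t *\<^sub>R \<delta>" by (auto simp: mem_tube)
    define k where "k = nat \<lfloor>t * norm \<delta> / \<rho>\<rfloor>"
    have k1: "real k \<le> t * norm \<delta> / \<rho>" unfolding k_def using assms q by (simp add: of_nat_floor)
    have "t * norm \<delta> / \<rho> < real_of_int \<lfloor>t * norm \<delta> / \<rho>\<rfloor> + 1" by linarith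
    also have "real_of_int \<lfloor>t * norm \<delta> / \<rho>\<rfloor> = real k" unfolding k_def using assms q by simp
    finally have k2: "t * norm \<delta> / \<rho> < real k + 1" .
    have "k \<le> m" unfolding k_def m_def using assms q
      by (intro nat_mono floor_mono divide_right_mono) (auto intro: mult_left_le_one_le)
    have "q - c k = (y - x) + (t - real k * \<rho> / norm \<delta>) *\<^sub>R \<delta>"
      by (simp add: q c_def algebra_simps)
    then have "norm (q - c k) \<le> norm (y - x) + norm ((t - real k * \<rho> / norm \<delta>) *\<^sub>R \<delta>)"
      by (metis norm_triangle_ineq)
    also have "norm ((t - real k * \<rho> / norm \<delta>) *\<^sub>R \<delta>) = \<bar>t * norm \<delta> - real k * \<rho>\<bar>"
      using pos by (simp add: abs_mult[symmetric] field_simps flip: abs_mult)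
    also have "\<dots> \<le> \<rho>" using k1 k2 assms by (simp add: field_simps abs_le_iff)
    also have "norm (y - x) \<le> \<rho>" using q by (simp add: dist_norm norm_minus_commute)
    finally show "q \<in> (\<Union>k\<in>{..m}. cball (c k) (2 * \<rho>))"
      using \<open>k \<le> m\<close> by (auto simp: dist_norm norm_minus_commute intro!: bexI[of _ k])
  qed
  then have "emeasure lborel (tube (cball x \<rho>) \<delta>) \<le> emeasure lborel (\<Union>k\<in>{..m}. cball (c k) (2 * \<rho>))"
    by (intro emeasure_mono) auto
  also have "\<dots> \<le> (\<Sum>k\<in>{..m}. emeasure lborel (cball (c k) (2 * \<rho>)))"
    by (intro emeasure_subadditive_finite) auto
  also have "\<dots> = (\<Sum>k\<in>{..m}. ennreal (unit_ball_vol (real DIM('a)) * (2 * \<rho>) ^ DIM('a)))"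
    using assms by (intro sum.cong refl emeasure_cball) auto
  also have "\<dots> = ennreal (real (Suc m) * (unit_ball_vol (real DIM('a)) * (2 * \<rho>) ^ DIM('a)))"
    using assms by (subst sum_ennreal) auto
  also have "\<dots> \<le> ennreal (2 * norm \<delta> / \<rho> * (unit_ball_vol (real DIM('a)) * (2 * \<rho>) ^ DIM('a)))"
  proof (intro ennreal_leI mult_right_mono)
    have "1 \<le> norm \<delta> / \<rho>" using assms by simp
    then show "real (Suc m) \<le> 2 * norm \<delta> / \<rho>" using m by simp
  qed (use assms in auto)
  also have "2 * norm \<delta> / \<rho> * (unit_ball_vol (real DIM('a)) * (2 * \<rho>) ^ DIM('a))
    = 2 ^ (DIM('a) + 1) * unit_ball_vol (real DIM('a)) * norm \<delta> * \<rho> ^ (DIM('a) - 1)"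
    using assms by (cases "DIM('a)") (auto simp: field_simps power_mult_distrib)
  finally show ?thesis .
qed

text \<open>\<open>C\<close> lies in a ball about any of its points with radius \<rho> just above
  its diameter. Letting \<rho> decrease to the diameter also covers singletons, for which a ball of
  radius equal to the diameter is excluded by the positivity of \<rho>. The quotient in the constant
  undoes the normalisation of the weight.\<close>

lemma emeasure_tube_le_weight:
  fixes C :: "'a::euclidean_space set"
  assumes "compact C" "diameter C < norm \<delta>"
  shows "emeasure lborel (tube C \<delta>)
    \<le> ennreal (2 ^ (DIM('a) + 1) * unit_ball_vol (real DIM('a)) * 2 ^ (DIM('a) - 1) / unit_ball_vol (real (DIM('a) - 1)) * norm \<delta>)
      * hausdorff_weight (DIM('a) - 1) C"
proof (cases "C = {}")
  case False
  then obtain x where x: "x \<in> C" by blast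
  let ?d = "DIM('a) - 1"
  let ?K = "2 ^ (DIM('a) + 1) * unit_ball_vol (real DIM('a)) * norm \<delta>"
  define D where "D = diameter C"
  have "0 \<le> D" unfolding D_def using assms by (simp add: compact_imp_bounded diameter_ge_0)
  have w: "hausdorff_weight ?d C = ennreal (unit_ball_vol (real ?d) * (D / 2) ^ ?d)"
    by (simp add: hausdorff_weight_def False D_def)
  have bound: "emeasure lborel (tube C \<delta>) \<le> ennreal (?K * \<rho> ^ ?d)" if "D < \<rho>" "\<rho> \<le> norm \<delta>" for \<rho>
  proof -
    have "C \<subseteq> cball x \<rho>"
      using x that diameter_bounded_bound[OF compact_imp_bounded[OF assms(1)], of x]
      unfolding D_def by fastforce
    then have "emeasure lborel (tube C \<delta>) \<le> emeasure lborel (tube (cball x \<rho>) \<delta>)"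
      by (intro emeasure_mono tube_mono) (auto intro!: borel_compact compact_tube)
    also have "\<dots> \<le> ennreal (?K * \<rho> ^ ?d)"
      using that \<open>0 \<le> D\<close> by (intro emeasure_tube_cball_le) auto
    finally show ?thesis .
  qed
  have "((\<lambda>\<rho>. ennreal (?K * \<rho> ^ ?d)) \<longlongrightarrow> ennreal (?K * D ^ ?d)) (at_right D)"
    by (intro tendsto_intros)
  moreover have "\<forall>\<^sub>F \<rho> in at_right D. emeasure lborel (tube C \<delta>) \<le> ennreal (?K * \<rho> ^ ?d)"
    by (rule eventually_at_rightI[of _ "norm \<delta>"]) (use assms(2) bound in \<open>auto simp only: D_def greaterThanLessThan_iff less_imp_le\<close>)
  ultimately have "emeasure lborel (tube C \<delta>) \<le> ennreal (?K * D ^ ?d)"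
    by (rule tendsto_lowerbound) simp
  also have "\<dots> = ennreal (2 ^ (DIM('a) + 1) * unit_ball_vol (real DIM('a)) * 2 ^ ?d / unit_ball_vol (real ?d) * norm \<delta>
      * (unit_ball_vol (real ?d) * (D / 2) ^ ?d))"
    using unit_ball_vol_pos[of "real ?d"] by (simp add: power_divide mult.assoc del: unit_ball_vol_pos)
  also have "\<dots> = ennreal (2 ^ (DIM('a) + 1) * unit_ball_vol (real DIM('a)) * 2 ^ ?d / unit_ball_vol (real ?d) * norm \<delta>)
      * hausdorff_weight ?d C"
    unfolding w using \<open>0 \<le> D\<close>
    by (intro ennreal_mult mult_nonneg_nonneg divide_nonneg_nonneg zero_le_power unit_ball_vol_nonneg) auto
  finally show ?thesis .
qed (simp add: tube_def)

text \<open>The tubes of the sets of a cover of \<open>S\<close> cover the tube of \<open>S\<close>,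
  so the estimate for one set is summed over a cover with mesh \<open>norm \<delta> / 2\<close>. The
  constant depends on the dimension alone.\<close>

lemma emeasure_tube_le:
  obtains K :: real where "0 < K"
    "\<And>(S :: 'a::euclidean_space set) \<delta>. compact S \<Longrightarrow> \<delta> \<noteq> 0 \<Longrightarrow>
      emeasure lborel (tube S \<delta>) \<le> ennreal (K * norm \<delta>) * hausdorff_outer (DIM('a) - 1) S"
proof
  let ?d = "DIM('a) - 1"
  define K where "K = 2 ^ (DIM('a) + 1) * unit_ball_vol (real DIM('a)) * 2 ^ ?d / unit_ball_vol (real ?d)"
  show "0 < K" unfolding K_def by (intro divide_pos_pos mult_pos_pos unit_ball_vol_pos) auto
  fix S :: "'a set" and \<delta> :: 'a assume S: "compact S" and \<delta>: "\<delta> \<noteq> 0"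
  have Kd: "0 < K * norm \<delta>" using \<open>0 < K\<close> \<delta> by simp
  have "emeasure lborel (tube S \<delta>) / ennreal (K * norm \<delta>) \<le> hausdorff_pre ?d (norm \<delta> / 2) S"
  proof (rule hausdorff_pre_greatest)
    fix C :: "nat \<Rightarrow> 'a set"
    assume C: "S \<subseteq> (\<Union>i. C i)" "\<And>i. bounded (C i)" "\<And>i. diameter (C i) \<le> norm \<delta> / 2"
    \<comment> \<open>Closures keep diameters and weights, and their tubes are compact, hence
      measurable.\<close>
    have cmp: "compact (closure (C i))" for i using C by simp
    have ms: "tube (closure (C i)) \<delta> \<in> sets lborel" for i
      using borel_compact[OF compact_tube[OF cmp]] by simp
    have dia: "diameter (closure (C i)) = diameter (C i)" for i using C diameter_closure by blast
    have "emeasure lborel (tube S \<delta>) \<le> emeasure lborel (\<Union>i. tube (closure (C i)) \<delta>)"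
    proof (intro emeasure_mono tube_UN_subset)
      show "S \<subseteq> (\<Union>i. closure (C i))" by (rule order_trans[OF C(1)]) (intro UN_mono closure_subset order_refl)
    qed (intro sets.countable_UN image_subsetI ms)
    also have "\<dots> \<le> (\<Sum>i. emeasure lborel (tube (closure (C i)) \<delta>))"
      by (intro emeasure_subadditive_countably image_subsetI ms)
    also have "\<dots> \<le> (\<Sum>i. ennreal (K * norm \<delta>) * hausdorff_weight ?d (C i))"
    proof (intro suminf_le summableI)
      fix i
      have "diameter (closure (C i)) < norm \<delta>"
        unfolding dia by (rule le_less_trans[OF C(3)]) (use \<delta> in auto)
      then have "emeasure lborel (tube (closure (C i)) \<delta>) \<le> ennreal (K * norm \<delta>) * hausdorff_weight ?d (closure (C i))"
        unfolding K_def by (intro emeasure_tube_le_weight cmp)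
      then show "emeasure lborel (tube (closure (C i)) \<delta>) \<le> ennreal (K * norm \<delta>) * hausdorff_weight ?d (C i)"
        unfolding hausdorff_weight_def dia by simp
    qed
    finally show "emeasure lborel (tube S \<delta>) / ennreal (K * norm \<delta>) \<le> (\<Sum>i. hausdorff_weight ?d (C i))"
      using Kd by (auto intro!: divide_le_posI_ennreal simp: mult.commute)
  qed
  also have "\<dots> \<le> hausdorff_outer ?d S"
    using \<delta> by (intro hausdorff_pre_le_outer) auto
  finally have "emeasure lborel (tube S \<delta>) / ennreal (K * norm \<delta>) * ennreal (K * norm \<delta>)
     \<le> hausdorff_outer ?d S * ennreal (K * norm \<delta>)"
    by (intro mult_right_mono) auto
  then show "emeasure lborel (tube S \<delta>) \<le> ennreal (K * norm \<delta>) * hausdorff_outer ?d S"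
    using Kd by (simp only: ennreal_divide_mult_cancel mult.commute[of "ennreal (K * norm \<delta>)"])
qed

text \<open>\<open>S\<close> is contained in its tube along \<open>t *\<^sub>R b\<close>, whose
  volume is at most a constant times \<open>t\<close>; let \<open>t\<close> tend to 0.\<close>

lemma negligible_if_hausdorff_outer_finite:
  fixes S :: "'a::euclidean_space set"
  assumes "compact S" "hausdorff_outer (DIM('a) - 1) S < top"
  shows "emeasure lborel S = 0"
proof -
  obtain K where K: "0 < K" "\<And>(S :: 'a::euclidean_space set) \<delta>. compact S \<Longrightarrow> \<delta> \<noteq> 0 \<Longrightarrow>
      emeasure lborel (tube S \<delta>) \<le> ennreal (K * norm \<delta>) * hausdorff_outer (DIM('a) - 1) S"
    using emeasure_tube_le[where ?'a = 'a] by blast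
  obtain h where h: "0 \<le> h" "hausdorff_outer (DIM('a) - 1) S = ennreal h"
    using assms(2) by (cases "hausdorff_outer (DIM('a) - 1) S") auto
  obtain b :: 'a where b: "b \<in> Basis" using nonempty_Basis by blast
  have "emeasure lborel S \<le> ennreal (K * h * t)" if "0 < t" for t
  proof -
    have "emeasure lborel S \<le> emeasure lborel (tube S (t *\<^sub>R b))"
      by (intro emeasure_mono subset_tube) (auto intro!: borel_compact compact_tube assms)
    also have "\<dots> \<le> ennreal (K * norm (t *\<^sub>R b)) * hausdorff_outer (DIM('a) - 1) S"
      by (rule K) (use that b assms in auto)
    also have "\<dots> = ennreal (K * h * t)"
      using K h b that by (simp add: ennreal_mult[symmetric] mult.commute mult.left_commute)
    finally show ?thesis .
  qed
  then have "\<forall>\<^sub>F t in at_right 0. emeasure lborel S \<le> ennreal (K * h * t)"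
    by (intro eventually_at_rightI[of 0 1]) auto
  moreover have "((\<lambda>t. ennreal (K * h * t)) \<longlongrightarrow> ennreal (K * h * 0)) (at_right 0)"
    by (intro tendsto_intros)
  ultimately show ?thesis
    using tendsto_lowerbound[of _ "ennreal (K * h * 0)" "at_right (0::real)" "emeasure lborel S"] by auto
qed

section \<open>Invariant measures\<close>

lemma nn_integral_translation:
  fixes M :: "'a::euclidean_space measure"
  assumes "sets M = sets borel" "distr M borel (\<lambda>x. x + y) = M" "f \<in> borel_measurable borel"
  shows "(\<integral>\<^sup>+ x. f (x + y) \<partial>M) = (\<integral>\<^sup>+ x. f x \<partial>M)"
proof -
  have "(\<lambda>x. x + y) \<in> measurable M borel"
    by (subst measurable_cong_sets[OF assms(1) refl]) simp
  then have "(\<integral>\<^sup>+ x. f x \<partial>distr M borel (\<lambda>x. x + y)) = (\<integral>\<^sup>+ x. f (x + y) \<partial>M)"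
    using assms by (intro nn_integral_distr) auto
  then show ?thesis using assms(2) by simp
qed

text \<open>
  Uniqueness of Haar measure on a subspace: exchange the order of integration in
  \<open>\<integral>\<integral> 1\<^sub>A x 1\<^sub>B (y - x)\<close> and use the symmetry of the unit ball \<open>B\<close>.
\<close>

lemma invariant_measure_unique:
  fixes M N :: "'a::euclidean_space measure"
  assumes V: "subspace V"
    and M: "sigma_finite_measure M" "sets M = sets borel" "AE x in M. x \<in> V"
      "\<And>y. y \<in> V \<Longrightarrow> distr M borel (\<lambda>x. x + y) = M"
    and N: "sigma_finite_measure N" "sets N = sets borel" "AE x in N. x \<in> V"
      "\<And>y. y \<in> V \<Longrightarrow> distr N borel (\<lambda>x. x + y) = N"
    and A: "A \<in> sets borel"
  shows "emeasure M A * emeasure N (cball 0 1) = emeasure M (cball 0 1) * emeasure N A"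
proof -
  interpret M: sigma_finite_measure M by (rule M)
  interpret N: sigma_finite_measure N by (rule N)
  interpret P: pair_sigma_finite M N ..
  note [measurable_cong] = M(2) N(2)
  note [measurable] = A
  let ?B = "cball (0::'a) 1"
  have [measurable]: "?B \<in> sets borel" by simp
  have B: "indicator ?B (- z) = (indicator ?B z :: ennreal)" for z
    by (simp add: indicator_def)
  have "emeasure M A * emeasure N ?B = (\<integral>\<^sup>+ x. indicator A x * emeasure N ?B \<partial>M)"
    by (simp add: nn_integral_multc M(2))
  also have "\<dots> = (\<integral>\<^sup>+ x. \<integral>\<^sup>+ y. indicator A x * indicator ?B (y - x) \<partial>N \<partial>M)"
  proof (rule nn_integral_cong_AE, use M(3) in eventually_elim)
    fix x assume "x \<in> V"
    then have "(\<integral>\<^sup>+ y. indicator ?B (y + - x) \<partial>N) = (\<integral>\<^sup>+ y. indicator ?B y \<partial>N)"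
      by (intro nn_integral_translation[where f = "indicator ?B"] N subspace_neg V borel_measurable_indicator) auto
    moreover have "(\<integral>\<^sup>+ y. indicator A x * indicator ?B (y - x) \<partial>N)
        = indicator A x * (\<integral>\<^sup>+ y. indicator ?B (y - x) \<partial>N)"
      by (rule nn_integral_cmult) measurable
    ultimately show "indicator A x * emeasure N ?B = (\<integral>\<^sup>+ y. indicator A x * indicator ?B (y - x) \<partial>N)"
      by (simp add: N(2))
  qed
  also have "\<dots> = (\<integral>\<^sup>+ y. \<integral>\<^sup>+ x. indicator A x * indicator ?B (y - x) \<partial>M \<partial>N)"
    by (intro P.Fubini'[symmetric]) measurable
  \<comment> \<open>Translating \<open>x\<close> by \<open>y\<close> turns the argument
    \<open>y - x\<close> of the ball indicator into \<open>- x\<close>, and the symmetry of the ball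
    removes the sign. Invariance is known only for vectors of \<open>V\<close>, which suffices
    because almost every \<open>y\<close> is one.\<close>
  also have "\<dots> = (\<integral>\<^sup>+ y. \<integral>\<^sup>+ x. indicator A (x + y) * indicator ?B x \<partial>M \<partial>N)"
  proof (rule nn_integral_cong_AE, use N(3) in eventually_elim)
    fix y assume "y \<in> V"
    then have "(\<integral>\<^sup>+ x. indicator A (x + y) * indicator ?B (y - (x + y)) \<partial>M)
        = (\<integral>\<^sup>+ x. indicator A x * indicator ?B (y - x) \<partial>M)"
      by (intro nn_integral_translation[where f = "\<lambda>x. indicator A x * indicator ?B (y - x)"] M) measurable
    then show "(\<integral>\<^sup>+ x. indicator A x * indicator ?B (y - x) \<partial>M) = (\<integral>\<^sup>+ x. indicator A (x + y) * indicator ?B x \<partial>M)"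
      by (simp add: B)
  qed
  also have "\<dots> = (\<integral>\<^sup>+ x. \<integral>\<^sup>+ y. indicator A (x + y) * indicator ?B x \<partial>N \<partial>M)"
    by (intro P.Fubini') measurable
  also have "\<dots> = (\<integral>\<^sup>+ x. indicator ?B x * emeasure N A \<partial>M)"
  proof (rule nn_integral_cong_AE, use M(3) in eventually_elim)
    fix x assume "x \<in> V"
    then have "(\<integral>\<^sup>+ y. indicator A (y + x) \<partial>N) = (\<integral>\<^sup>+ y. indicator A y \<partial>N)"
      by (intro nn_integral_translation[where f = "indicator A"] N) auto
    then show "(\<integral>\<^sup>+ y. indicator A (x + y) * indicator ?B x \<partial>N) = indicator ?B x * emeasure N A"
      by (simp add: nn_integral_multc N(2) add.commute mult.commute)
  qed
  also have "\<dots> = emeasure M ?B * emeasure N A"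
    by (simp add: nn_integral_multc M(2))
  finally show ?thesis .
qed

section \<open>Orthogonal invariance of Lebesgue measure\<close>

lemma sigma_finite_measure_cball:
  fixes M :: "'a::euclidean_space measure"
  assumes "sets M = sets borel" "\<And>n. emeasure M (cball 0 (real n)) < top"
  shows "sigma_finite_measure M"
proof
  have "x \<in> (\<Union>n. cball 0 (real n))" for x :: 'a
    using real_arch_simple[of "norm x"] by auto
  then show "\<exists>A. countable A \<and> A \<subseteq> sets M \<and> \<Union> A = space M \<and> (\<forall>a\<in>A. emeasure M a \<noteq> \<infinity>)"
    using assms sets_eq_imp_space_eq[OF assms(1)]
    by (intro exI[of _ "range (\<lambda>n. cball 0 (real n))"]) (auto simp: less_top)
qed

lemma lborel_distr_translation: "distr lborel borel (\<lambda>x. x + y) = (lborel :: 'a::euclidean_space measure)"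
  using lborel_affine[of 1 y] by (simp add: density_1 add.commute)

lemma emeasure_lborel_cball_finite: "emeasure lborel (cball (c::'a::euclidean_space) r) < top"
  using emeasure_bounded_finite[of "cball c r"] by simp

text \<open>The image measure is again translation invariant, because \<open>T\<close> is onto and
  linear. It gives the unit ball its old mass, because \<open>T\<close> preserves norms, so
  uniqueness of the invariant measure yields equality.\<close>

lemma lborel_distr_orthogonal:
  fixes T :: "'a::euclidean_space \<Rightarrow> 'a"
  assumes T: "orthogonal_transformation T"
  shows "distr lborel borel T = lborel"
proof (rule measure_eqI)
  fix A :: "'a set" assume "A \<in> sets (distr lborel borel T)"
  then have A: "A \<in> sets borel" by simp
  have T_lin: "linear T" using T orthogonal_transformation_linear by blast
  then have [measurable]: "T \<in> borel_measurable borel"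
    by (simp add: borel_measurable_continuous_onI linear_continuous_on linear_linear)
  have ball: "T -` cball 0 r = cball 0 r" for r
    using T by (auto simp: orthogonal_transformation_norm)
  have pos: "emeasure lborel (cball (0::'a) 1) \<noteq> 0"
    using unit_ball_vol_pos[of "real DIM('a)"] by (subst emeasure_cball) (auto simp del: unit_ball_vol_pos)
  have fin: "emeasure lborel (cball (0::'a) 1) \<noteq> top"
    using emeasure_lborel_cball_finite[of 0 1] by (simp add: less_top)
  have dist_ball: "emeasure (distr lborel borel T) (cball 0 r) = emeasure lborel (cball (0::'a) r)" for r
    by (subst emeasure_distr) (auto simp: ball)
  have inv: "distr (distr lborel borel T) borel (\<lambda>x. x + y) = distr lborel borel T" for y
  proof -
    obtain z where z: "y = T z" using orthogonal_transformation_surj[OF T] by (metis surjD)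
    have "distr (distr lborel borel T) borel (\<lambda>x. x + y) = distr lborel borel (\<lambda>x. T x + T z)"
      by (subst distr_distr) (auto simp: o_def z)
    also have "\<dots> = distr (distr lborel borel (\<lambda>x. x + z)) borel T"
      by (subst distr_distr) (auto simp: o_def linear_add[OF T_lin])
    finally show ?thesis by (simp add: lborel_distr_translation)
  qed
  have "emeasure (distr lborel borel T) A * emeasure lborel (cball (0::'a) 1)
     = emeasure (distr lborel borel T) (cball 0 1) * emeasure lborel A"
    by (rule invariant_measure_unique[of UNIV])
       (auto simp: A inv lborel_distr_translation sigma_finite_lborel dist_ball emeasure_lborel_cball_finite
         intro!: sigma_finite_measure_cball)
  then show "emeasure (distr lborel borel T) A = emeasure lborel A"
    using pos fin by (metis dist_ball ennreal_mult_cancel_left mult.commute)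
qed simp

section \<open>Lebesgue measure on hyperplanes\<close>

definition perp_proj :: "'a::euclidean_space \<Rightarrow> 'a \<Rightarrow> 'a" where
  "perp_proj \<nu> x = x - (x \<bullet> \<nu>) *\<^sub>R \<nu>"

text \<open>For a unit vector \<nu> this is Lebesgue measure on the hyperplane orthogonal to \<nu>:
  the measure of a set is the volume of the cylinder of height 1 over it. As an image measure it
  lives on the ambient space, and no coordinates on the hyperplane have to be chosen.\<close>

definition plane_measure :: "'a::euclidean_space \<Rightarrow> 'a measure" where
  "plane_measure \<nu> = distr (density lborel (indicator {x. 0 \<le> x \<bullet> \<nu> \<and> x \<bullet> \<nu> < 1})) borel (perp_proj \<nu>)"

lemma sets_plane_measure [simp, measurable_cong]: "sets (plane_measure \<nu>) = sets borel"
  by (simp add: plane_measure_def)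

lemma space_plane_measure [simp]: "space (plane_measure \<nu>) = UNIV"
  by (simp add: plane_measure_def)

lemma continuous_perp_proj [continuous_intros]: "continuous_on S (perp_proj \<nu>)"
  unfolding perp_proj_def by (intro continuous_intros)

lemma measurable_perp_proj [measurable]: "perp_proj \<nu> \<in> borel_measurable borel"
  by (intro borel_measurable_continuous_onI continuous_intros)

lemma perp_proj_add: "perp_proj \<nu> (x + y) = perp_proj \<nu> x + perp_proj \<nu> y"
  and perp_proj_diff: "perp_proj \<nu> (x - y) = perp_proj \<nu> x - perp_proj \<nu> y"
  and perp_proj_scale: "perp_proj \<nu> (c *\<^sub>R x) = c *\<^sub>R perp_proj \<nu> x"
  by (simp_all add: perp_proj_def inner_simps algebra_simps)

lemma perp_proj_self: "norm \<nu> = 1 \<Longrightarrow> perp_proj \<nu> \<nu> = 0"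
  by (simp add: perp_proj_def norm_eq_1)

lemma perp_proj_fixed: "y \<bullet> \<nu> = 0 \<Longrightarrow> perp_proj \<nu> y = y"
  by (simp add: perp_proj_def)

lemma perp_proj_inner: "norm \<nu> = 1 \<Longrightarrow> perp_proj \<nu> x \<bullet> \<nu> = 0"
  by (simp add: perp_proj_def inner_simps norm_eq_1)

lemma perp_proj_decomp: "x = perp_proj \<nu> x + (x \<bullet> \<nu>) *\<^sub>R \<nu>"
  by (simp add: perp_proj_def)

lemma norm_perp_proj: "norm \<nu> = 1 \<Longrightarrow> (norm (perp_proj \<nu> x))\<^sup>2 = (norm x)\<^sup>2 - (x \<bullet> \<nu>)\<^sup>2"
  unfolding power2_norm_eq_inner perp_proj_def
  by (simp add: inner_diff_left inner_diff_right norm_eq_1 inner_commute power2_eq_square)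

lemma norm_perp_proj_le: "norm \<nu> = 1 \<Longrightarrow> norm (perp_proj \<nu> x) \<le> norm x"
  by (rule power2_le_imp_le) (auto simp: norm_perp_proj)

lemma nn_integral_plane_measure:
  assumes "f \<in> borel_measurable borel"
  shows "(\<integral>\<^sup>+ y. f y \<partial>plane_measure \<nu>) =
    (\<integral>\<^sup>+ x. indicator {x. 0 \<le> x \<bullet> \<nu> \<and> x \<bullet> \<nu> < 1} x * f (perp_proj \<nu> x) \<partial>lborel)"
  unfolding plane_measure_def using assms
  by (subst nn_integral_distr) (auto simp: nn_integral_density)

lemma emeasure_plane_measure:
  assumes "A \<in> sets borel"
  shows "emeasure (plane_measure \<nu>) A = emeasure lborel {x. 0 \<le> x \<bullet> \<nu> \<and> x \<bullet> \<nu> < 1 \<and> perp_proj \<nu> x \<in> A}"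
proof -
  have [measurable]: "A \<in> sets borel" by fact
  have "emeasure (plane_measure \<nu>) A = (\<integral>\<^sup>+ y. indicator A y \<partial>plane_measure \<nu>)" using assms by simp
  also have "\<dots> = (\<integral>\<^sup>+ x. indicator {x. 0 \<le> x \<bullet> \<nu> \<and> x \<bullet> \<nu> < 1 \<and> perp_proj \<nu> x \<in> A} x \<partial>lborel)"
    by (subst nn_integral_plane_measure, simp, intro nn_integral_cong) (simp add: indicator_def)
  finally show ?thesis by simp
qed

text \<open>Unfolding the slab makes the right-hand side a double integral of
  \<open>f (x + u *\<^sub>R \<nu>)\<close> over \<open>x\<close> in the slab and \<open>u\<close>
  real. After an exchange of the order and a translation of \<open>x\<close>, the slab condition
  confines \<open>u\<close> to a half-open interval of length 1, which integrates to 1.\<close>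

lemma plane_measure_Fubini:
  fixes f :: "'a::euclidean_space \<Rightarrow> ennreal"
  assumes \<nu>: "norm \<nu> = 1" and [measurable]: "f \<in> borel_measurable borel"
  shows "(\<integral>\<^sup>+ x. f x \<partial>lborel) = (\<integral>\<^sup>+ y. \<integral>\<^sup>+ u. f (y + u *\<^sub>R \<nu>) \<partial>lborel \<partial>plane_measure \<nu>)"
proof -
  have P: "pair_sigma_finite (lborel :: 'a measure) (lborel :: real measure)"
    by (simp add: pair_sigma_finite_def sigma_finite_lborel)
  let ?I = "indicator {x. 0 \<le> x \<bullet> \<nu> \<and> x \<bullet> \<nu> < 1} :: 'a \<Rightarrow> ennreal"
  have nn: "\<nu> \<bullet> \<nu> = 1" using \<nu> by (simp add: norm_eq_1)
  have "(\<integral>\<^sup>+ y. \<integral>\<^sup>+ u. f (y + u *\<^sub>R \<nu>) \<partial>lborel \<partial>plane_measure \<nu>)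
     = (\<integral>\<^sup>+ x. ?I x * (\<integral>\<^sup>+ u. f (perp_proj \<nu> x + u *\<^sub>R \<nu>) \<partial>lborel) \<partial>lborel)"
    by (rule nn_integral_plane_measure) measurable
  also have "\<dots> = (\<integral>\<^sup>+ x. \<integral>\<^sup>+ u. ?I x * f (x + u *\<^sub>R \<nu>) \<partial>lborel \<partial>lborel)"
  proof (rule nn_integral_cong)
    fix x :: 'a
    \<comment> \<open>The base point on the line through \<open>x\<close> is irrelevant: replacing
      \<open>x\<close> by its projection only shifts \<open>u\<close>.\<close>
    have "(\<integral>\<^sup>+ u. f (x + u *\<^sub>R \<nu>) \<partial>lborel) = (\<integral>\<^sup>+ u. f (x + (u + - (x \<bullet> \<nu>)) *\<^sub>R \<nu>) \<partial>lborel)"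
      by (rule nn_integral_translation[OF sets_lborel lborel_distr_translation, symmetric,
            where f = "\<lambda>u. f (x + u *\<^sub>R \<nu>)"]) measurable
    also have "\<dots> = (\<integral>\<^sup>+ u. f (perp_proj \<nu> x + u *\<^sub>R \<nu>) \<partial>lborel)"
      by (simp add: perp_proj_def algebra_simps)
    finally show "?I x * (\<integral>\<^sup>+ u. f (perp_proj \<nu> x + u *\<^sub>R \<nu>) \<partial>lborel) = (\<integral>\<^sup>+ u. ?I x * f (x + u *\<^sub>R \<nu>) \<partial>lborel)"
      by (simp add: nn_integral_cmult)
  qed
  also have "\<dots> = (\<integral>\<^sup>+ u. \<integral>\<^sup>+ x. ?I x * f (x + u *\<^sub>R \<nu>) \<partial>lborel \<partial>lborel)"
    by (intro pair_sigma_finite.Fubini'[OF P, symmetric]) measurable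
  also have "\<dots> = (\<integral>\<^sup>+ u. \<integral>\<^sup>+ x. indicator {x \<bullet> \<nu> - 1<..x \<bullet> \<nu>} u * f x \<partial>lborel \<partial>lborel)"
  proof (rule nn_integral_cong)
    fix u :: real
    have "(\<integral>\<^sup>+ x. ?I (x - u *\<^sub>R \<nu>) * f x \<partial>lborel) = (\<integral>\<^sup>+ x. ?I (x + u *\<^sub>R \<nu> - u *\<^sub>R \<nu>) * f (x + u *\<^sub>R \<nu>) \<partial>lborel)"
      by (rule nn_integral_translation[symmetric, where f = "\<lambda>x. ?I (x - u *\<^sub>R \<nu>) * f x"])
         (auto simp: lborel_distr_translation)
    moreover have "?I (x - u *\<^sub>R \<nu>) = indicator {x \<bullet> \<nu> - 1<..x \<bullet> \<nu>} u" for x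
      by (auto simp: indicator_def inner_simps nn)
    ultimately show "(\<integral>\<^sup>+ x. ?I x * f (x + u *\<^sub>R \<nu>) \<partial>lborel) = (\<integral>\<^sup>+ x. indicator {x \<bullet> \<nu> - 1<..x \<bullet> \<nu>} u * f x \<partial>lborel)"
      by simp
  qed
  also have "\<dots> = (\<integral>\<^sup>+ x. \<integral>\<^sup>+ u. indicator {x \<bullet> \<nu> - 1<..x \<bullet> \<nu>} u * f x \<partial>lborel \<partial>lborel)"
  proof (rule pair_sigma_finite.Fubini'[OF P])
    have "(\<lambda>(x, u). indicator {x \<bullet> \<nu> - 1<..x \<bullet> \<nu>} u * f x)
        = (\<lambda>(x, u). (if x \<bullet> \<nu> - 1 < u \<and> u \<le> x \<bullet> \<nu> then f x else 0))"
      by (auto simp: fun_eq_iff indicator_def)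
    also have "\<dots> \<in> borel_measurable (lborel \<Otimes>\<^sub>M lborel)" by measurable
    finally show "(\<lambda>(x, u). indicator {x \<bullet> \<nu> - 1<..x \<bullet> \<nu>} u * f x) \<in> borel_measurable (lborel \<Otimes>\<^sub>M lborel)" .
  qed
  also have "\<dots> = (\<integral>\<^sup>+ x. f x \<partial>lborel)"
    by (simp add: nn_integral_multc)
  finally show ?thesis ..
qed

lemma AE_plane_measure: "norm \<nu> = 1 \<Longrightarrow> AE x in plane_measure \<nu>. x \<in> {x. x \<bullet> \<nu> = 0}"
  unfolding plane_measure_def by (subst AE_distr_iff) (auto simp: perp_proj_inner)

text \<open>A translation inside the hyperplane maps the slab to itself and commutes with the
  projection.\<close>

lemma plane_measure_translation:
  fixes \<nu> :: "'a::euclidean_space"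
  assumes \<nu>: "norm \<nu> = 1" and y: "y \<bullet> \<nu> = 0"
  shows "distr (plane_measure \<nu>) borel (\<lambda>x. x + y) = plane_measure \<nu>"
proof (rule measure_eqI)
  fix A :: "'a set" assume "A \<in> sets (distr (plane_measure \<nu>) borel (\<lambda>x. x + y))"
  then have [measurable]: "A \<in> sets borel" by simp
  let ?S = "\<lambda>B. {x. 0 \<le> x \<bullet> \<nu> \<and> x \<bullet> \<nu> < 1 \<and> perp_proj \<nu> x \<in> B}"
  have [measurable]: "?S A \<in> sets borel" by measurable
  have "emeasure (distr (plane_measure \<nu>) borel (\<lambda>x. x + y)) A = emeasure (plane_measure \<nu>) {x. x + y \<in> A}"
    by (subst emeasure_distr) (auto simp: vimage_def)
  also have "\<dots> = emeasure lborel (?S {x. x + y \<in> A})"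
    by (rule emeasure_plane_measure) measurable
  also have "?S {x. x + y \<in> A} = (\<lambda>x. x + y) -` ?S A \<inter> space lborel"
    using y by (auto simp: perp_proj_add perp_proj_fixed inner_simps)
  also have "emeasure lborel \<dots> = emeasure (distr lborel borel (\<lambda>x. x + y)) (?S A)"
    by (subst emeasure_distr) auto
  also have "\<dots> = emeasure (plane_measure \<nu>) A"
    by (simp add: lborel_distr_translation emeasure_plane_measure)
  finally show "emeasure (distr (plane_measure \<nu>) borel (\<lambda>x. x + y)) A = emeasure (plane_measure \<nu>) A" .
qed simp

lemma emeasure_plane_measure_cball:
  assumes \<nu>: "norm \<nu> = 1"
  shows "emeasure (plane_measure \<nu>) (cball 0 r) < top"
proof -
  have "{x. 0 \<le> x \<bullet> \<nu> \<and> x \<bullet> \<nu> < 1 \<and> perp_proj \<nu> x \<in> cball 0 r} \<subseteq> cball 0 (r + 1)"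
  proof
    fix x assume x: "x \<in> {x. 0 \<le> x \<bullet> \<nu> \<and> x \<bullet> \<nu> < 1 \<and> perp_proj \<nu> x \<in> cball 0 r}"
    have "norm x \<le> norm (perp_proj \<nu> x) + norm ((x \<bullet> \<nu>) *\<^sub>R \<nu>)"
      using perp_proj_decomp[of x \<nu>] norm_triangle_ineq by metis
    also have "\<dots> \<le> r + 1" using x \<nu> by (intro add_mono) auto
    finally show "x \<in> cball 0 (r + 1)" by simp
  qed
  then have "emeasure (plane_measure \<nu>) (cball 0 r) \<le> emeasure lborel (cball (0::'a) (r + 1))"
    unfolding emeasure_plane_measure[OF borel_closed[OF closed_cball]] by (intro emeasure_mono) auto
  also have "\<dots> < top" by (rule emeasure_lborel_cball_finite)
  finally show ?thesis .
qed

lemma emeasure_plane_measure_cball_pos: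
  fixes \<nu> :: "'a::euclidean_space"
  assumes \<nu>: "norm \<nu> = 1"
  shows "0 < emeasure (plane_measure \<nu>) (cball 0 1)"
proof -
  have nn: "\<nu> \<bullet> \<nu> = 1" using \<nu> by (simp add: norm_eq_1)
  \<comment> \<open>An open ball of diameter 1 centred halfway up fits into the slab, and its
    projection stays in the unit ball.\<close>
  have "ball ((1/2) *\<^sub>R \<nu>) (1/2) \<subseteq> {x. 0 \<le> x \<bullet> \<nu> \<and> x \<bullet> \<nu> < 1 \<and> perp_proj \<nu> x \<in> cball 0 1}"
  proof
    fix x assume "x \<in> ball ((1/2) *\<^sub>R \<nu>) (1/2)"
    then have x: "norm (x - (1/2) *\<^sub>R \<nu>) < 1/2" by (simp add: dist_norm norm_minus_commute)
    have "\<bar>(x - (1/2) *\<^sub>R \<nu>) \<bullet> \<nu>\<bar> < 1/2"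
      using Cauchy_Schwarz_ineq2[of "x - (1/2) *\<^sub>R \<nu>" \<nu>] x \<nu> by simp
    then have "\<bar>x \<bullet> \<nu> - 1/2\<bar> < 1/2" by (simp add: inner_simps nn)
    moreover have "norm (perp_proj \<nu> x) \<le> 1"
      using norm_perp_proj_le[OF \<nu>, of "x - (1/2) *\<^sub>R \<nu>"] x
      by (simp add: perp_proj_diff perp_proj_scale perp_proj_self \<nu>)
    moreover have "0 \<le> x \<bullet> \<nu>" "x \<bullet> \<nu> < 1" using \<open>\<bar>x \<bullet> \<nu> - 1/2\<bar> < 1/2\<close> by linarith+
    ultimately show "x \<in> {x. 0 \<le> x \<bullet> \<nu> \<and> x \<bullet> \<nu> < 1 \<and> perp_proj \<nu> x \<in> cball 0 1}"
      by simp
  qed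
  then have "emeasure lborel (ball ((1/2) *\<^sub>R \<nu>) (1/2)) \<le> emeasure (plane_measure \<nu>) (cball 0 1)"
    unfolding emeasure_plane_measure[OF borel_closed[OF closed_cball]] by (intro emeasure_mono) auto
  moreover have "0 < emeasure lborel (ball ((1/2) *\<^sub>R \<nu>) (1/2))"
    by (subst emeasure_ball) auto
  ultimately show ?thesis by (rule order_less_le_trans[rotated])
qed

lemma sigma_finite_plane_measure: "norm \<nu> = 1 \<Longrightarrow> sigma_finite_measure (plane_measure \<nu>)"
  by (intro sigma_finite_measure_cball emeasure_plane_measure_cball) auto

section \<open>Hausdorff measure on hyperplanes\<close>

text \<open>A finite family is padded to a sequence by empty sets, which have weight 0 in every
  dimension, including 0.\<close>

lemma hausdorff_pre_le_finite:
  fixes C :: "'i \<Rightarrow> 'a::metric_space set"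
  assumes "finite I" "A \<subseteq> (\<Union>i\<in>I. C i)" "\<And>i. i \<in> I \<Longrightarrow> bounded (C i)" "\<And>i. i \<in> I \<Longrightarrow> diameter (C i) \<le> \<delta>" "0 \<le> \<delta>"
  shows "hausdorff_pre d \<delta> A \<le> (\<Sum>i\<in>I. hausdorff_weight d (C i))"
proof -
  obtain h where h: "bij_betw h {0..<card I} I" using ex_bij_betw_nat_finite[OF assms(1)] by blast
  define D where "D n = (if n < card I then C (h n) else {})" for n
  have hI: "h n \<in> I" if "n < card I" for n using h that by (auto simp: bij_betw_def)
  have "hausdorff_pre d \<delta> A \<le> (\<Sum>n. hausdorff_weight d (D n))"
  proof (rule hausdorff_pre_le)
    show "A \<subseteq> (\<Union>n. D n)"
    proof
      fix x assume "x \<in> A"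
      then obtain i where i: "i \<in> I" "x \<in> C i" using assms(2) by blast
      then have "i \<in> h ` {0..<card I}" using h by (simp add: bij_betw_def)
      then obtain n where "n < card I" "h n = i" by auto
      then have "x \<in> D n" using i by (simp add: D_def)
      then show "x \<in> (\<Union>n. D n)" by blast
    qed
  qed (use assms hI in \<open>auto simp: D_def\<close>)
  also have "\<dots> = (\<Sum>n\<in>{0..<card I}. hausdorff_weight d (D n))"
    by (rule suminf_finite) (auto simp: D_def)
  also have "\<dots> = (\<Sum>n\<in>{0..<card I}. hausdorff_weight d (C (h n)))"
    by (rule sum.cong) (auto simp: D_def)
  also have "\<dots> = (\<Sum>i\<in>I. hausdorff_weight d (C i))"
    by (rule sum.reindex_bij_betw[OF h])
  finally show ?thesis .
qed

text \<open>A grid of side \<open>1 / N\<close> in the remaining \<open>DIM('a) - 1\<close>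
  coordinates has \<open>(2 * R * N + 1) ^ (DIM('a) - 1)\<close> cells of diameter at most
  \<open>DIM('a) / N\<close>. The powers of \<open>N\<close> balance, so the total weight is bounded
  uniformly in the mesh.\<close>

lemma hausdorff_outer_hyperplane_finite:
  fixes k :: "'a::euclidean_space"
  assumes k: "k \<in> Basis"
  shows "hausdorff_outer (DIM('a) - 1) (cball 0 (real R) \<inter> {x. x \<bullet> k = 0}) < top"
proof -
  let ?d = "DIM('a) - 1" and ?A = "cball 0 (real R) \<inter> {x :: 'a. x \<bullet> k = 0}"
  let ?K = "unit_ball_vol (real ?d) * ((2 * real R + 1) * real DIM('a) / 2) ^ ?d"
  have "hausdorff_outer ?d ?A \<le> ennreal ?K"
  proof (rule hausdorff_outer_least)
    fix \<delta> :: real assume "0 < \<delta>"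
    then have "0 < \<delta> / real DIM('a)" by simp
    then obtain N0 where "1 / real (Suc N0) < \<delta> / real DIM('a)" using nat_approx_posE by blast
    then obtain N where N: "0 < N" "real DIM('a) / real N \<le> \<delta>"
      by (metis Suc_eq_plus1 divide_divide_eq_left' less_imp_le mult.commute mult.right_neutral
          of_nat_0_less_iff pos_divide_less_eq pos_less_divide_eq times_divide_eq_right zero_less_Suc DIM_positive)
    \<comment> \<open>A cell is labelled by the integer parts of \<open>N\<close> times the
      coordinates other than \<open>k\<close>. The range includes both ends because a coordinate may
      equal \<open>R\<close>; this is the origin of the \<open>+ 1\<close> in the cell
      count.\<close>
    define I where "I = (Basis - {k}) \<rightarrow>\<^sub>E {- int (R * N)..int (R * N)}"
    define C where "C f = {x :: 'a. x \<bullet> k = 0 \<and> (\<forall>b\<in>Basis - {k}. of_int (f b) \<le> N * (x \<bullet> b) \<and> N * (x \<bullet> b) \<le> of_int (f b) + 1)}" for f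
    have finI: "finite I" unfolding I_def by (intro finite_PiE) auto
    have cardI: "card I = (2 * R * N + 1) ^ ?d"
      unfolding I_def using k by (subst card_PiE) (auto simp: nat_add_distrib nat_mult_distrib mult_ac)
    have near: "norm (x - y) \<le> real DIM('a) / real N" if "x \<in> C f" "y \<in> C f" for x y f
    proof -
      have "norm (x - y) \<le> (\<Sum>b\<in>Basis. \<bar>(x - y) \<bullet> b\<bar>)" by (rule norm_le_l1)
      also have "\<dots> \<le> (\<Sum>b\<in>(Basis::'a set). 1 / real N)"
      proof (rule sum_mono)
        fix b :: 'a assume b: "b \<in> Basis"
        show "\<bar>(x - y) \<bullet> b\<bar> \<le> 1 / real N"
        proof (cases "b = k")
          case False
          then have "\<bar>N * (x \<bullet> b) - N * (y \<bullet> b)\<bar> \<le> 1"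
            using that b unfolding C_def by (simp add: abs_le_iff) (smt (verit) DiffI singletonD)
          moreover have "N * (x \<bullet> b) - N * (y \<bullet> b) = N * ((x - y) \<bullet> b)"
            by (simp add: inner_diff_left right_diff_distrib)
          ultimately have "real N * \<bar>(x - y) \<bullet> b\<bar> \<le> 1" by (simp add: abs_mult)
          then show ?thesis using N by (simp add: field_simps)
        qed (use that in \<open>auto simp: C_def inner_diff_left\<close>)
      qed
      also have "\<dots> = real DIM('a) / real N" by simp
      finally show ?thesis .
    qed
    have bdd: "bounded (C f)" for f
      using near unfolding bounded_two_points dist_norm by blast
    have dia: "diameter (C f) \<le> real DIM('a) / real N" for f
      using near by (intro diameter_le) auto
    have "hausdorff_pre ?d \<delta> ?A \<le> (\<Sum>f\<in>I. hausdorff_weight ?d (C f))"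
    proof (rule hausdorff_pre_le_finite[OF finI])
      show "?A \<subseteq> (\<Union>f\<in>I. C f)"
      proof
        fix x assume x: "x \<in> ?A"
        define f where "f = restrict (\<lambda>b. \<lfloor>N * (x \<bullet> b)\<rfloor>) (Basis - {k})"
        have "\<lfloor>N * (x \<bullet> b)\<rfloor> \<in> {- int (R * N)..int (R * N)}" if "b \<in> Basis" for b
        proof -
          have "\<bar>x \<bullet> b\<bar> \<le> real R" using Basis_le_norm[OF that, of x] x by simp
          then have "\<bar>N * (x \<bullet> b)\<bar> \<le> real (R * N)" using N
            by (simp add: abs_mult mult.commute)
          then have "- real (R * N) \<le> N * (x \<bullet> b)" "N * (x \<bullet> b) \<le> real (R * N)" by linarith+
          then show ?thesis unfolding atLeastAtMost_iff le_floor_iff floor_le_iff by simp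
        qed
        then have "f \<in> I" unfolding I_def f_def by auto
        moreover have "x \<in> C f" using x unfolding C_def f_def by (simp add: real_of_int_floor_add_one_ge)
        ultimately show "x \<in> (\<Union>f\<in>I. C f)" by blast
      qed
    qed (use bdd dia N \<open>0 < \<delta>\<close> in \<open>auto intro: order_trans\<close>)
    also have "\<dots> \<le> (\<Sum>f\<in>I. ennreal (unit_ball_vol (real ?d) * (real DIM('a) / real N / 2) ^ ?d))"
    proof (rule sum_mono)
      fix f
      have "(diameter (C f) / 2) ^ ?d \<le> (real DIM('a) / real N / 2) ^ ?d"
        using dia[of f] diameter_ge_0[OF bdd[of f]] by (intro power_mono) auto
      then show "hausdorff_weight ?d (C f) \<le> ennreal (unit_ball_vol (real ?d) * (real DIM('a) / real N / 2) ^ ?d)"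
        unfolding hausdorff_weight_def by (auto intro!: ennreal_leI mult_left_mono)
    qed
    also have "\<dots> = ennreal (real (card I) * (unit_ball_vol (real ?d) * (real DIM('a) / real N / 2) ^ ?d))"
      by (subst sum_ennreal) (auto simp del: of_nat_diff)
    also have "\<dots> \<le> ennreal ?K"
    proof (rule ennreal_leI)
      have "real (card I) * (real DIM('a) / real N / 2) ^ ?d = ((2 * R * N + 1) * (real DIM('a) / real N / 2)) ^ ?d"
        unfolding cardI power_mult_distrib by simp
      also have "\<dots> \<le> ((2 * real R + 1) * real DIM('a) / 2) ^ ?d"
      proof (rule power_mono)
        have "(2 * R * N + 1) * (real DIM('a) / real N / 2) = (2 * R + 1 / real N) * (real DIM('a) / 2)"
          using N by (simp add: field_simps)
        also have "\<dots> \<le> (2 * real R + 1) * (real DIM('a) / 2)"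
          using N by (intro mult_right_mono) auto
        finally show "(2 * R * N + 1) * (real DIM('a) / real N / 2) \<le> (2 * real R + 1) * real DIM('a) / 2" by simp
      qed auto
      finally show "real (card I) * (unit_ball_vol (real ?d) * (real DIM('a) / real N / 2) ^ ?d) \<le> ?K"
        by (subst mult.left_commute) (auto intro!: mult_left_mono)
    qed
    finally show "hausdorff_pre ?d \<delta> ?A \<le> ennreal ?K" .
  qed
  then show ?thesis using le_less_trans by fastforce
qed

section \<open>Proportionality to Lebesgue measure\<close>

lemma distr_hausdorff_translation:
  "distr (hausdorff_measure d) borel (\<lambda>x. x + y) = (hausdorff_measure d :: 'a::euclidean_space measure)"
proof (rule measure_eqI)
  fix A :: "'a set" assume "A \<in> sets (distr (hausdorff_measure d) borel (\<lambda>x. x + y))"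
  then have [measurable]: "A \<in> sets borel" by simp
  have A': "(\<lambda>x. x + y) -` A \<in> sets borel"
    using measurable_sets[of "\<lambda>x. x + y" borel borel A] by simp
  have "hausdorff_outer d ((\<lambda>x. x + y) ` ((\<lambda>x. x + y) -` A)) = hausdorff_outer d ((\<lambda>x. x + y) -` A)"
    by (rule hausdorff_outer_isometry) (simp add: dist_norm)
  moreover have "(\<lambda>x. x + y) ` ((\<lambda>x. x + y) -` A) = A"
    by (rule surj_image_vimage_eq) (metis diff_add_cancel surjI)
  ultimately show "emeasure (distr (hausdorff_measure d) borel (\<lambda>x. x + y)) A = emeasure (hausdorff_measure d) A"
    using A' by (subst emeasure_distr) (auto simp: emeasure_hausdorff_measure)
qed simp

text \<open>Hausdorff measure restricted to the hyperplane and \<open>plane_measure k\<close> are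
  both invariant under the translations of the hyperplane and finite on balls, hence proportional. A
  coordinate hyperplane comes first because the grid that proves finiteness is aligned with the
  axes.\<close>

lemma hausdorff_eq_plane_measure_Basis:
  fixes k :: "'a::euclidean_space"
  assumes k: "k \<in> Basis"
  obtains c :: real where "0 < c"
    "\<And>A. A \<in> sets borel \<Longrightarrow> A \<subseteq> {x. x \<bullet> k = 0} \<Longrightarrow>
      hausdorff_outer (DIM('a) - 1) A = ennreal c * emeasure (plane_measure k) A"
proof -
  let ?d = "DIM('a) - 1" and ?V = "{x. x \<bullet> k = 0}"
  have nk: "norm k = 1" using k by simp
  have V [measurable]: "?V \<in> sets borel" by measurable
  have subV: "subspace ?V" by (rule subspace_hyperplane2) 
  \<comment> \<open>Restriction to the hyperplane makes Hausdorff measure finite on balls, hence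
    sigma-finite as the uniqueness argument requires.\<close>
  define M where "M = density (hausdorff_measure ?d) (indicator ?V)"
  have sM [measurable_cong]: "sets M = sets borel" by (simp add: M_def)
  have eM: "emeasure M A = hausdorff_outer ?d (A \<inter> ?V)" if "A \<in> sets borel" for A
  proof -
    have "emeasure M A = (\<integral>\<^sup>+ x. indicator (A \<inter> ?V) x \<partial>hausdorff_measure ?d)"
      unfolding M_def using that V
      by (subst emeasure_density, simp_all only: measurable_cong_sets[OF sets_hausdorff_measure refl] sets_hausdorff_measure borel_measurable_indicator)
         (intro nn_integral_cong, auto simp: indicator_def)
    also have "\<dots> = hausdorff_outer ?d (A \<inter> ?V)"
      using that by (subst nn_integral_indicator) (auto simp: emeasure_hausdorff_measure)
    finally show ?thesis .
  qed
  have Mfin: "emeasure M (cball 0 (real R)) < top" for R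
    using hausdorff_outer_hyperplane_finite[OF k, of R] by (simp add: eM)
  have Minv: "distr M borel (\<lambda>x. x + y) = M" if y: "y \<in> ?V" for y
  proof (rule measure_eqI)
    fix A assume "A \<in> sets (distr M borel (\<lambda>x. x + y))"
    then have A [measurable]: "A \<in> sets borel" by simp
    have A': "(\<lambda>x. x + y) -` A \<in> sets borel"
      using measurable_sets[of "\<lambda>x. x + y" borel borel A] by simp
    have AV: "A \<inter> ?V \<in> sets borel" by measurable
    have "emeasure (distr M borel (\<lambda>x. x + y)) A = hausdorff_outer ?d ((\<lambda>x. x + y) -` A \<inter> ?V)"
      using A' by (subst emeasure_distr) (auto simp: eM measurable_cong_sets[OF sM refl] sets_eq_imp_space_eq[OF sM])
    also have "(\<lambda>x. x + y) -` A \<inter> ?V = (\<lambda>x. x + y) -` (A \<inter> ?V)"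
      using y by (auto simp: inner_add_left)
    also have "hausdorff_outer ?d \<dots> = emeasure (distr (hausdorff_measure ?d) borel (\<lambda>x. x + y)) (A \<inter> ?V)"
      using AV measurable_sets[of "\<lambda>x. x + y" borel borel "A \<inter> ?V"]
      by (subst emeasure_distr) (auto simp: emeasure_hausdorff_measure measurable_cong_sets[OF sets_hausdorff_measure refl])
    also have "\<dots> = hausdorff_outer ?d (A \<inter> ?V)"
      unfolding distr_hausdorff_translation by (rule emeasure_hausdorff_measure[OF AV])
    finally show "emeasure (distr M borel (\<lambda>x. x + y)) A = emeasure M A" by (simp add: eM)
  qed (simp add: sM)
  have eq: "emeasure M A * emeasure (plane_measure k) (cball 0 1) = emeasure M (cball 0 1) * emeasure (plane_measure k) A"
    if "A \<in> sets borel" for A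
  proof (rule invariant_measure_unique[OF subV])
    show "AE x in M. x \<in> ?V" unfolding M_def
      by (subst AE_density) (auto simp: indicator_def measurable_cong_sets[OF sets_hausdorff_measure refl])
  qed (use nk that Mfin Minv in \<open>auto simp: sM AE_plane_measure[OF nk, simplified] sigma_finite_plane_measure
      intro!: sigma_finite_measure_cball plane_measure_translation\<close>)
  obtain a where a: "emeasure M (cball 0 1) = ennreal a" "0 \<le> a"
    using Mfin[of 1] by (cases "emeasure M (cball 0 1)") auto
  obtain b where b: "emeasure (plane_measure k) (cball 0 1) = ennreal b" "0 \<le> b"
    using emeasure_plane_measure_cball[OF nk, of 1] by (cases "emeasure (plane_measure k) (cball 0 1)") auto
  have "0 < b" using emeasure_plane_measure_cball_pos[OF nk] b by simp
  \<comment> \<open>The tube of height 1 over the unit disc contains the cylinder whose volume is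
    \<open>b > 0\<close>, while its volume is at most a constant times the Hausdorff measure
    \<open>a\<close> of the disc.\<close>
  have "0 < a"
  proof -
    obtain K where K: "0 < K" "\<And>(S :: 'a set) \<delta>. compact S \<Longrightarrow> \<delta> \<noteq> 0 \<Longrightarrow>
      emeasure lborel (tube S \<delta>) \<le> ennreal (K * norm \<delta>) * hausdorff_outer (DIM('a) - 1) S"
      using emeasure_tube_le[where ?'a = 'a] by blast
    let ?S = "cball 0 1 \<inter> ?V"
    have S: "compact ?S" using closed_hyperplane[of k 0] by (intro compact_Int_closed) (auto simp: inner_commute)
    have "{x. 0 \<le> x \<bullet> k \<and> x \<bullet> k < 1 \<and> perp_proj k x \<in> cball 0 1} \<subseteq> tube ?S k"
    proof
      fix x assume x: "x \<in> {x. 0 \<le> x \<bullet> k \<and> x \<bullet> k < 1 \<and> perp_proj k x \<in> cball 0 1}"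
      show "x \<in> tube ?S k" unfolding mem_tube
        by (rule bexI[of _ "perp_proj k x"], rule exI[of _ "x \<bullet> k"])
           (use x perp_proj_decomp[of x k] perp_proj_inner[OF nk, of x] in auto)
    qed
    then have "ennreal b \<le> emeasure lborel (tube ?S k)"
      unfolding b(1)[symmetric] emeasure_plane_measure[OF borel_closed[OF closed_cball]]
      by (intro emeasure_mono) (auto intro!: borel_compact compact_tube S)
    also have "\<dots> \<le> ennreal (K * norm k) * hausdorff_outer ?d ?S"
      by (rule K) (use S nk in auto)
    also have "hausdorff_outer ?d ?S = ennreal a" using eM[of "cball 0 1"] a by simp
    finally show ?thesis using \<open>0 < b\<close> a(2) by (cases "a = 0") auto
  qed
  show thesis
  proof (rule that[of "a / b"])
    show "0 < a / b" using \<open>0 < a\<close> \<open>0 < b\<close> by simp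
    fix A assume A: "A \<in> sets borel" "A \<subseteq> ?V"
    then have "hausdorff_outer ?d A * ennreal b = ennreal a * emeasure (plane_measure k) A"
      using eq[OF A(1)] eM[OF A(1)] a b by (simp add: Int_absorb2)
    then have "hausdorff_outer ?d A * ennreal b / ennreal b = ennreal a * emeasure (plane_measure k) A / ennreal b" by simp
    also have "hausdorff_outer ?d A * ennreal b / ennreal b = hausdorff_outer ?d A"
      using \<open>0 < b\<close> by (intro ennreal_mult_divide_eq) auto
    also have "ennreal a * emeasure (plane_measure k) A / ennreal b = ennreal (a / b) * emeasure (plane_measure k) A"
      using \<open>0 < b\<close> a(2) by (metis divide_ennreal ennreal_divide_times ennreal_times_divide mult.commute)
    finally show "hausdorff_outer ?d A = ennreal (a / b) * emeasure (plane_measure k) A" .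
  qed
qed

text \<open>\<open>T\<close> carries the slab and the projection belonging to \<open>k\<close> to
  those belonging to \<open>T k\<close> and preserves volume.\<close>

lemma emeasure_plane_measure_orthogonal:
  fixes T :: "'a::euclidean_space \<Rightarrow> 'a"
  assumes T: "orthogonal_transformation T" and A: "A \<in> sets borel"
  shows "emeasure (plane_measure k) (T -` A) = emeasure (plane_measure (T k)) A"
proof -
  have T_lin: "linear T" using T orthogonal_transformation_linear by blast
  then have [measurable]: "T \<in> borel_measurable borel"
    by (simp add: borel_measurable_continuous_onI linear_continuous_on linear_linear)
  note [measurable] = A
  let ?S = "{x. 0 \<le> x \<bullet> T k \<and> x \<bullet> T k < 1 \<and> perp_proj (T k) x \<in> A}"
  have [measurable]: "?S \<in> sets borel" by measurable
  have inner: "T x \<bullet> T y = x \<bullet> y" for x y using T by (simp add: orthogonal_transformation_def)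
  have proj: "T (perp_proj k x) = perp_proj (T k) (T x)" for x
    by (simp add: perp_proj_def linear_diff[OF T_lin] linear_scale[OF T_lin] inner)
  have "emeasure (plane_measure k) (T -` A) = emeasure lborel (T -` ?S)"
    using measurable_sets[of T borel borel A] A
    by (subst emeasure_plane_measure) (auto simp: inner proj vimage_def)
  also have "\<dots> = emeasure (distr lborel borel T) ?S"
    by (subst emeasure_distr) auto
  finally show ?thesis using A by (simp add: lborel_distr_orthogonal[OF T] emeasure_plane_measure)
qed

text \<open>
  The ratio is in fact 1, but that requires the isodiametric inequality; only its positivity and its
  independence of \<open>\<nu>\<close> matter here.
\<close>

definition hausdorff_ratio :: "real \<Rightarrow> real ^ 'n \<Rightarrow> bool" where
  "hausdorff_ratio c \<nu> \<longleftrightarrow> (\<forall>A\<in>sets borel. A \<subseteq> {x. x \<bullet> \<nu> = 0} \<longrightarrow>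
     hausdorff_outer (CARD('n) - 1) A = ennreal c * emeasure (plane_measure \<nu>) A)"

text \<open>An orthogonal map that takes \<open>k\<close> to \<nu> preserves Hausdorff measure,
  being an isometry, and matches the two plane measures, so the ratio found for \<open>k\<close>
  serves every \<nu>. This uniformity is what allows boundary pieces with different normals to be
  added up.\<close>

lemma hausdorff_eq_plane_measure:
  obtains c :: real where "0 < c"
    "\<And>\<nu> :: real ^ 'n. norm \<nu> = 1 \<Longrightarrow> hausdorff_ratio c \<nu>"
proof -
  obtain k :: "real ^ 'n" where k: "k \<in> Basis" using nonempty_Basis by blast
  then obtain c where c: "0 < c" "\<And>A. A \<in> sets borel \<Longrightarrow> A \<subseteq> {x. x \<bullet> k = 0} \<Longrightarrow>
      hausdorff_outer (CARD('n) - 1) A = ennreal c * emeasure (plane_measure k) A"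
    using hausdorff_eq_plane_measure_Basis[OF k] by auto
  show thesis
  proof (rule that[OF c(1)])
    fix \<nu> :: "real ^ 'n" assume \<nu>: "norm \<nu> = 1"
    show "hausdorff_ratio c \<nu>"
      unfolding hausdorff_ratio_def
    proof (intro ballI impI)
      fix A assume A: "A \<in> sets borel" "A \<subseteq> {x. x \<bullet> \<nu> = 0}"
      have "norm k = norm \<nu>" using k \<nu> by simp
      then obtain T where T: "orthogonal_transformation T" "T k = \<nu>"
        using orthogonal_transformation_exists by blast
      have T_lin: "linear T" using T orthogonal_transformation_linear by blast
      then have "T \<in> borel_measurable borel"
        by (simp add: borel_measurable_continuous_onI linear_continuous_on linear_linear)
      then have B: "T -` A \<in> sets borel" using A measurable_sets[of T borel borel A] by simp
      have "hausdorff_outer (CARD('n) - 1) A = hausdorff_outer (CARD('n) - 1) (T ` (T -` A))"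
        using orthogonal_transformation_surj[OF T(1)] by (simp add: surj_image_vimage_eq)
      also have "\<dots> = hausdorff_outer (CARD('n) - 1) (T -` A)"
        by (rule hausdorff_outer_isometry) (metis T(1) orthogonal_transformation_isometry)
      also have "\<dots> = ennreal c * emeasure (plane_measure k) (T -` A)"
      proof (rule c(2)[OF B])
        have "T x \<bullet> T k = x \<bullet> k" for x using T(1) unfolding orthogonal_transformation_def by blast
        then show "T -` A \<subseteq> {x. x \<bullet> k = 0}" using A T by auto
      qed
      finally show "hausdorff_outer (CARD('n) - 1) A = ennreal c * emeasure (plane_measure \<nu>) A"
        using emeasure_plane_measure_orthogonal[OF T(1) A(1), of k] T by simp
    qed
  qed
qed

section \<open>Almost flat pieces of hypersurface\<close>

text \<open>\<open>Z\<close> is a Lipschitz graph of small slope over part of the hyperplane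
  orthogonal to \<nu>. Flatness is stated through differences of points, so that neither a graph
  function nor its derivative has to be produced.\<close>

locale flat_piece =
  fixes \<nu> :: "real ^ 'n" and Z :: "(real ^ 'n) set" and \<epsilon> :: real
  assumes unit: "norm \<nu> = 1" and eps: "0 < \<epsilon>" "\<epsilon> \<le> 1 / 2" and cmp: "compact Z"
    and flat: "\<And>x y. x \<in> Z \<Longrightarrow> y \<in> Z \<Longrightarrow> \<bar>(x - y) \<bullet> \<nu>\<bar> \<le> \<epsilon> * norm (x - y)"
begin

definition lift :: "real ^ 'n \<Rightarrow> real ^ 'n" where
  "lift = inv_into Z (perp_proj \<nu>)"

text \<open>By Pythagoras the projection shrinks distances by at most the factor
  \<open>sqrt (1 - \<epsilon>\<^sup>2)\<close>; the weaker \<open>1 - \<epsilon>\<close> avoids the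
  root.\<close>

lemma norm_le_perp_proj:
  assumes "x \<in> Z" "y \<in> Z"
  shows "(1 - \<epsilon>) * norm (x - y) \<le> norm (perp_proj \<nu> x - perp_proj \<nu> y)"
proof (rule power2_le_imp_le)
  have "((x - y) \<bullet> \<nu>)\<^sup>2 \<le> (\<epsilon> * norm (x - y))\<^sup>2"
    using power_mono[OF flat[OF assms], of 2] by simp
  moreover have "(norm (perp_proj \<nu> x - perp_proj \<nu> y))\<^sup>2 = (norm (x - y))\<^sup>2 - ((x - y) \<bullet> \<nu>)\<^sup>2"
    using norm_perp_proj[OF unit, of "x - y"] by (simp add: perp_proj_diff)
  moreover have "((1 - \<epsilon>) * norm (x - y))\<^sup>2 + (\<epsilon> * norm (x - y))\<^sup>2 \<le> (norm (x - y))\<^sup>2"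
  proof -
    have "(1 - \<epsilon>)\<^sup>2 + \<epsilon>\<^sup>2 \<le> 1" using eps by (simp add: power2_eq_square algebra_simps)
    then have "((1 - \<epsilon>)\<^sup>2 + \<epsilon>\<^sup>2) * (norm (x - y))\<^sup>2 \<le> 1 * (norm (x - y))\<^sup>2"
      by (intro mult_right_mono) auto
    then show ?thesis by (simp add: power_mult_distrib distrib_right)
  qed
  ultimately show "((1 - \<epsilon>) * norm (x - y))\<^sup>2 \<le> (norm (perp_proj \<nu> x - perp_proj \<nu> y))\<^sup>2" by linarith
qed simp

lemma inj_on_perp_proj: "inj_on (perp_proj \<nu>) Z"
proof (rule inj_onI)
  fix x y assume xy: "x \<in> Z" "y \<in> Z" and eq: "perp_proj \<nu> x = perp_proj \<nu> y"
  have "(1 - \<epsilon>) * norm (x - y) \<le> 0" using norm_le_perp_proj[OF xy] eq by simp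
  then show "x = y" using eps by (simp add: mult_le_0_iff)
qed

lemma lift_perp_proj: "x \<in> Z \<Longrightarrow> lift (perp_proj \<nu> x) = x"
  unfolding lift_def by (rule inv_into_f_f[OF inj_on_perp_proj])

lemma continuous_on_lift: "continuous_on (perp_proj \<nu> ` Z) lift"
  using lift_perp_proj by (intro continuous_on_inv continuous_perp_proj cmp) auto

lemma compact_perp_proj: "compact (perp_proj \<nu> ` Z)"
  by (intro compact_continuous_image continuous_perp_proj cmp)

lemma borel_Z [measurable]: "Z \<in> sets borel" "perp_proj \<nu> ` Z \<in> sets borel"
  using cmp compact_perp_proj by (auto intro: borel_compact)

text \<open>
  The projection to the hyperplane is 1-Lipschitz with a \<open>1 / (1 - \<epsilon>)\<close>-Lipschitz inverse, which
  makes the two measures comparable without an area formula.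
\<close>

lemma hausdorff_vs_plane:
  assumes "0 < c" and c: "hausdorff_ratio c \<nu>"
    and F [measurable]: "F \<in> borel_measurable borel"
  shows "ennreal c * (\<integral>\<^sup>+ y. indicator (perp_proj \<nu> ` Z) y * F y \<partial>plane_measure \<nu>)
      \<le> (\<integral>\<^sup>+ x. indicator Z x * F (perp_proj \<nu> x) \<partial>hausdorff_measure (CARD('n) - 1))" (is ?lower)
    and "(\<integral>\<^sup>+ x. indicator Z x * F (perp_proj \<nu> x) \<partial>hausdorff_measure (CARD('n) - 1))
      \<le> ennreal (c / (1 - \<epsilon>) ^ (CARD('n) - 1)) *
        (\<integral>\<^sup>+ y. indicator (perp_proj \<nu> ` Z) y * F y \<partial>plane_measure \<nu>)" (is ?upper)
proof -
  let ?d = "CARD('n) - 1" and ?p = "perp_proj \<nu>"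
  \<comment> \<open>\<open>N\<close> is the surface measure of \<open>Z\<close> pushed down to the
    hyperplane, \<open>P\<close> the plane measure of the shadow of \<open>Z\<close>. Comparing the
    measures on Borel sets gives both integral inequalities at once.\<close>
  define N where "N = distr (density (hausdorff_measure ?d) (indicator Z)) borel ?p"
  define P where "P = density (plane_measure \<nu>) (indicator (?p ` Z))"
  have sets [simp]: "sets N = sets borel" "sets P = sets borel" by (simp_all add: N_def P_def)
  have space [simp]: "space N = UNIV" "space P = UNIV" by (simp_all add: N_def P_def)
  have pm: "?p \<in> measurable (density (hausdorff_measure ?d) (indicator Z)) borel"
    by (subst measurable_cong_sets[of _ borel borel borel]) simp_all
  have eN: "emeasure N B = hausdorff_outer ?d (Z \<inter> ?p -` B)" if [measurable]: "B \<in> sets borel" for B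
  proof -
    have [measurable]: "?p -` B \<in> sets borel" using measurable_sets[OF measurable_perp_proj that, of \<nu>] by (simp only: space_borel Int_UNIV_right)
    have "emeasure N B = emeasure (density (hausdorff_measure ?d) (indicator Z)) (?p -` B)"
      unfolding N_def by (subst emeasure_distr[OF pm]) (auto simp: that)
    also have "\<dots> = (\<integral>\<^sup>+ x. indicator Z x * indicator (?p -` B) x \<partial>hausdorff_measure ?d)"
      by (rule emeasure_density) (auto simp: measurable_cong_sets[OF sets_hausdorff_measure refl])
    also have "\<dots> = (\<integral>\<^sup>+ x. indicator (Z \<inter> ?p -` B) x \<partial>hausdorff_measure ?d)"
      by (intro nn_integral_cong) (auto simp: indicator_def)
    also have "\<dots> = hausdorff_outer ?d (Z \<inter> ?p -` B)"
      by (subst nn_integral_indicator) (auto intro!: emeasure_hausdorff_measure)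
    finally show ?thesis .
  qed
  have eP: "ennreal c * emeasure P B = hausdorff_outer ?d (?p ` Z \<inter> B)" if [measurable]: "B \<in> sets borel" for B
  proof -
    have "emeasure P B = (\<integral>\<^sup>+ x. indicator (?p ` Z) x * indicator B x \<partial>plane_measure \<nu>)"
      unfolding P_def by (rule emeasure_density) (auto simp: measurable_cong_sets[OF sets_plane_measure refl])
    also have "\<dots> = (\<integral>\<^sup>+ x. indicator (?p ` Z \<inter> B) x \<partial>plane_measure \<nu>)"
      by (intro nn_integral_cong) (auto simp: indicator_def)
    also have "\<dots> = emeasure (plane_measure \<nu>) (?p ` Z \<inter> B)"
      by (subst nn_integral_indicator) auto
    also have "ennreal c * emeasure (plane_measure \<nu>) (?p ` Z \<inter> B) = hausdorff_outer ?d (?p ` Z \<inter> B)"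
      by (subst c[unfolded hausdorff_ratio_def, rule_format]) (auto simp: perp_proj_inner[OF unit])
    finally show ?thesis .
  qed
  have NF: "(\<integral>\<^sup>+ y. F y \<partial>N) = (\<integral>\<^sup>+ x. indicator Z x * F (?p x) \<partial>hausdorff_measure ?d)"
  proof -
    have "(\<integral>\<^sup>+ y. F y \<partial>N) = (\<integral>\<^sup>+ x. F (?p x) \<partial>density (hausdorff_measure ?d) (indicator Z))"
      unfolding N_def by (rule nn_integral_distr[OF pm]) simp
    also have "\<dots> = (\<integral>\<^sup>+ x. indicator Z x * F (?p x) \<partial>hausdorff_measure ?d)"
      by (rule nn_integral_density) (auto simp: measurable_cong_sets[OF sets_hausdorff_measure refl])
    finally show ?thesis .
  qed
  have PF: "(\<integral>\<^sup>+ y. F y \<partial>P) = (\<integral>\<^sup>+ y. indicator (?p ` Z) y * F y \<partial>plane_measure \<nu>)"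
    unfolding P_def by (rule nn_integral_density) (auto simp: measurable_cong_sets[OF sets_plane_measure refl])
  have FN: "F \<in> borel_measurable N" and FP: "F \<in> borel_measurable P"
    by (auto simp: measurable_cong_sets[OF sets(1) refl] measurable_cong_sets[OF sets(2) refl])
  have "scale_measure (ennreal c) P \<le> N"
  proof (subst le_measure, simp, intro ballI)
    fix B assume "B \<in> sets (scale_measure (ennreal c) P)"
    then have B: "B \<in> sets borel" by simp
    \<comment> \<open>The part of the shadow in \<open>B\<close> is the projection of the part of
      \<open>Z\<close> above \<open>B\<close>, and the projection is 1-Lipschitz.\<close>
    have "hausdorff_outer ?d (?p ` Z \<inter> B) = hausdorff_outer ?d (?p ` (Z \<inter> ?p -` B))"
      by (rule arg_cong[where f = "hausdorff_outer ?d"]) auto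
    also have "\<dots> \<le> ennreal (1 ^ ?d) * hausdorff_outer ?d (Z \<inter> ?p -` B)"
      using norm_perp_proj_le[OF unit]
      by (intro hausdorff_outer_lipschitz) (auto simp: dist_norm perp_proj_diff[symmetric])
    finally show "emeasure (scale_measure (ennreal c) P) B \<le> emeasure N B"
      by (simp add: eN[OF B] eP[OF B])
  qed
  then have "(\<integral>\<^sup>+ y. F y \<partial>scale_measure (ennreal c) P) \<le> (\<integral>\<^sup>+ y. F y \<partial>N)"
    by (intro nn_integral_mono_measure) simp_all
  then show ?lower
    by (simp add: nn_integral_scale_measure[OF FP] NF PF)
  have "N \<le> scale_measure (ennreal (c / (1 - \<epsilon>) ^ ?d)) P"
  proof (subst le_measure, simp, intro ballI)
    fix B assume "B \<in> sets N"
    then have B: "B \<in> sets borel" by simp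
    \<comment> \<open>In the other direction the part of \<open>Z\<close> above \<open>B\<close> is
      the lift of the part of the shadow in \<open>B\<close>.\<close>
    have "hausdorff_outer ?d (Z \<inter> ?p -` B) = hausdorff_outer ?d (lift ` (?p ` Z \<inter> B))"
      by (rule arg_cong[where f = "hausdorff_outer ?d"]) (force simp: lift_perp_proj)
    also have "\<dots> \<le> ennreal ((1 / (1 - \<epsilon>)) ^ ?d) * hausdorff_outer ?d (?p ` Z \<inter> B)"
    proof (intro hausdorff_outer_lipschitz)
      fix x y assume "x \<in> ?p ` Z \<inter> B" "y \<in> ?p ` Z \<inter> B"
      then obtain u v where uv: "u \<in> Z" "v \<in> Z" "x = ?p u" "y = ?p v" by blast
      then show "dist (lift x) (lift y) \<le> 1 / (1 - \<epsilon>) * dist x y"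
        using norm_le_perp_proj[OF uv(1,2)] eps by (simp add: lift_perp_proj dist_norm field_simps)
    qed (use eps in auto)
    also have "\<dots> = ennreal (c / (1 - \<epsilon>) ^ ?d) * emeasure P B"
      unfolding eP[OF B, symmetric] mult.assoc[symmetric] using \<open>0 < c\<close> eps
      by (subst ennreal_mult[symmetric]) (auto simp: power_divide mult.commute)
    finally show "emeasure N B \<le> emeasure (scale_measure (ennreal (c / (1 - \<epsilon>) ^ ?d)) P) B"
      by (simp add: eN[OF B])
  qed
  then have "(\<integral>\<^sup>+ y. F y \<partial>N) \<le> (\<integral>\<^sup>+ y. F y \<partial>scale_measure (ennreal (c / (1 - \<epsilon>) ^ ?d)) P)"
    by (intro nn_integral_mono_measure) simp_all
  then show ?upper
    by (simp add: nn_integral_scale_measure[OF FP] NF PF)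
qed

lemma borel_tube: "tube Z \<delta> \<in> sets borel"
  by (intro borel_compact compact_tube cmp)

text \<open>By injectivity of the projection on \<open>Z\<close>, a line parallel to \<nu> meets
  \<open>Z\<close> at most once, so it meets the tube in an interval of length
  \<open>\<bar>s\<bar>\<close> or not at all. The integrand is constant along each such
  line.\<close>

lemma nn_integral_tube:
  assumes F [measurable]: "F \<in> borel_measurable borel"
  shows "(\<integral>\<^sup>+ x. indicator (tube Z (s *\<^sub>R \<nu>)) x * F (perp_proj \<nu> x) \<partial>lborel)
    = ennreal \<bar>s\<bar> * (\<integral>\<^sup>+ y. indicator (perp_proj \<nu> ` Z) y * F y \<partial>plane_measure \<nu>)"
proof -
  let ?T = "tube Z (s *\<^sub>R \<nu>)" and ?p = "perp_proj \<nu>"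
  have [measurable]: "?T \<in> sets borel" by (rule borel_tube)
  have nn: "\<nu> \<bullet> \<nu> = 1" using unit by (simp add: norm_eq_1)
  have "(\<integral>\<^sup>+ x. indicator ?T x * F (?p x) \<partial>lborel)
      = (\<integral>\<^sup>+ y. \<integral>\<^sup>+ u. indicator ?T (y + u *\<^sub>R \<nu>) * F (?p (y + u *\<^sub>R \<nu>)) \<partial>lborel \<partial>plane_measure \<nu>)"
    by (rule plane_measure_Fubini[OF unit]) measurable
  also have "\<dots> = (\<integral>\<^sup>+ y. ennreal \<bar>s\<bar> * (indicator (?p ` Z) y * F y) \<partial>plane_measure \<nu>)"
  proof (rule nn_integral_cong_AE, use AE_plane_measure[OF unit] in eventually_elim)
    fix y assume y: "y \<in> {x. x \<bullet> \<nu> = 0}"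
    have proj: "?p (y + u *\<^sub>R \<nu>) = y" for u
      using y by (simp add: perp_proj_add perp_proj_scale perp_proj_self unit perp_proj_fixed)
    have "(\<integral>\<^sup>+ u. indicator ?T (y + u *\<^sub>R \<nu>) \<partial>lborel) = ennreal \<bar>s\<bar> * indicator (?p ` Z) y"
    proof (cases "y \<in> ?p ` Z")
      case True
      then obtain z where z: "z \<in> Z" "y = ?p z" by blast
      define h where "h = z \<bullet> \<nu>"
      have zy: "z = y + h *\<^sub>R \<nu>" using perp_proj_decomp[of z \<nu>] z by (simp add: h_def)
      have "y + u *\<^sub>R \<nu> \<in> ?T \<longleftrightarrow> u \<in> {min h (h + s)..max h (h + s)}" for u
      proof
        assume "y + u *\<^sub>R \<nu> \<in> ?T"
        then obtain z' t where z': "z' \<in> Z" "0 \<le> t" "t \<le> 1" "y + u *\<^sub>R \<nu> = z' + (t * s) *\<^sub>R \<nu>"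
          by (auto simp: mem_tube)
        then have "?p z' = y" using proj[of u]
          by (simp add: perp_proj_add perp_proj_scale perp_proj_self unit)
        then have "z' = z" using z z' inj_on_perp_proj by (auto dest: inj_onD)
        then have "(u - (h + t * s)) *\<^sub>R \<nu> = 0" using z'(4) zy by (simp add: algebra_simps)
        then have "u = h + t * s" using unit by auto
        then show "u \<in> {min h (h + s)..max h (h + s)}" using z'(2,3)
          by (cases "0 \<le> s") (auto simp: min_def max_def mult_left_le_one_le mult_nonneg_nonpos2 mult_le_cancel_right1
             mult_nonneg_nonpos)
      next
        assume u: "u \<in> {min h (h + s)..max h (h + s)}"
        \<comment> \<open>For \<open>s = 0\<close> the interval degenerates to the single point
          \<open>h\<close>, and \<open>t = 0\<close> is a valid parameter.\<close>
        define t where "t = (if s = 0 then 0 else (u - h) / s)"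
        have t: "0 \<le> t" "t \<le> 1" "t * s = u - h"
          using u by (auto simp: t_def min_def max_def divide_simps split: if_splits)
        have "y + u *\<^sub>R \<nu> = z + t *\<^sub>R s *\<^sub>R \<nu>" 
          using t(3) zy by (simp add: scaleR_add_left[symmetric] add.assoc)
        then show "y + u *\<^sub>R \<nu> \<in> ?T" unfolding mem_tube using z t by blast
      qed
      then have "(\<integral>\<^sup>+ u. indicator ?T (y + u *\<^sub>R \<nu>) \<partial>lborel) = (\<integral>\<^sup>+ u. indicator {min h (h + s)..max h (h + s)} u \<partial>lborel)"
        by (intro nn_integral_cong) (simp add: indicator_def)
      also have "\<dots> = ennreal \<bar>s\<bar>" by (simp add: min_def max_def)
      finally show ?thesis using True by simp
    next
      case False
      have "y + u *\<^sub>R \<nu> \<notin> ?T" for u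
      proof
        assume "y + u *\<^sub>R \<nu> \<in> ?T"
        then obtain z' t where z': "z' \<in> Z" "y + u *\<^sub>R \<nu> = z' + (t * s) *\<^sub>R \<nu>"
          by (auto simp: mem_tube)
        then have "?p z' = y" using proj[of u]
          by (simp add: perp_proj_add perp_proj_scale perp_proj_self unit)
        then show False using False z' by blast
      qed
      then show ?thesis using False by simp
    qed
    then show "(\<integral>\<^sup>+ u. indicator ?T (y + u *\<^sub>R \<nu>) * F (?p (y + u *\<^sub>R \<nu>)) \<partial>lborel)
        = ennreal \<bar>s\<bar> * (indicator (?p ` Z) y * F y)"
      by (simp add: proj nn_integral_multc mult.assoc)
  qed
  also have "\<dots> = ennreal \<bar>s\<bar> * (\<integral>\<^sup>+ y. indicator (?p ` Z) y * F y \<partial>plane_measure \<nu>)"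
    by (rule nn_integral_cmult) measurable
  finally show ?thesis .
qed

end

section \<open>The flux through the boundary\<close>

locale thin_boundary =
  fixes \<Omega> :: "(real ^ 'n) set"
  assumes bdd: "bounded \<Omega>" and fin: "hausdorff_outer (CARD('n) - 1) (frontier \<Omega>) < top"
begin

text \<open>Applied to the function \<open>P \<mapsto> f (P - m)\<close>, this is the increment of
  \<open>Sigma_fun f \<Omega>\<close> from \<open>m\<close> to \<open>m + \<delta>\<close>. The
  interior is used because it is Borel; it differs from \<Omega> only within the frontier, a null
  set.\<close>

definition shift_diff :: "(real ^ 'n \<Rightarrow> real) \<Rightarrow> real ^ 'n \<Rightarrow> real" where
  "shift_diff f \<delta> = (LINT x|lborel. f x * (indicator (interior \<Omega>) (x + \<delta>) - indicator (interior \<Omega>) x))"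

lemma compact_frontier: "compact (frontier \<Omega>)"
  using bdd by (rule compact_frontier_bounded)

lemma null_frontier: "emeasure lborel (frontier \<Omega>) = 0"
  using negligible_if_hausdorff_outer_finite[OF compact_frontier] fin by simp

lemma AE_notin_frontier: "AE x in lborel. x + \<delta> \<notin> frontier \<Omega>"
proof -
  have "emeasure lborel ((\<lambda>x. x + \<delta>) -` frontier \<Omega>) = emeasure (distr lborel borel (\<lambda>x. x + \<delta>)) (frontier \<Omega>)"
    by (subst emeasure_distr) auto
  then have "(\<lambda>x. x + \<delta>) -` frontier \<Omega> \<in> null_sets lborel"
    using measurable_sets[of "\<lambda>x. x + \<delta>" borel borel "frontier \<Omega>"]
    by (intro null_setsI) (auto simp: lborel_distr_translation null_frontier)
  then have "AE x in lborel. x \<notin> (\<lambda>x. x + \<delta>) -` frontier \<Omega>" by (rule AE_not_in)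
  then show ?thesis by simp
qed

lemma borel_interior [measurable]: "interior \<Omega> \<in> sets borel"
  by simp

lemma integrable_shift:
  assumes "continuous_on UNIV f"
  shows "integrable lborel (\<lambda>x. f x * indicator (interior \<Omega>) (x + \<delta>) :: real)"
proof -
  have "bounded ((\<lambda>x. x - \<delta>) ` interior \<Omega>)"
    using bounded_translation[of "interior \<Omega>" "- \<delta>"] bounded_interior[OF bdd] by simp
  then obtain B where B: "(\<lambda>x. x - \<delta>) ` interior \<Omega> \<subseteq> cball 0 B"
    by (metis bounded_subset_ballD ball_subset_cball order_trans)
  have [measurable]: "f \<in> borel_measurable borel" by (rule borel_measurable_continuous_onI[OF assms])
  have "integrable lborel (\<lambda>x. indicator (cball 0 B) x *\<^sub>R f x)"
    by (rule borel_integrable_compact) (auto intro: continuous_on_subset[OF assms])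
  then show ?thesis
  proof (rule Bochner_Integration.integrable_bound)
    have "x \<in> cball 0 B" if "x + \<delta> \<in> interior \<Omega>" for x
      using that B by force
    then show "AE x in lborel. norm (f x * indicator (interior \<Omega>) (x + \<delta>)) \<le> norm (indicator (cball 0 B) x *\<^sub>R f x)"
      by (intro AE_I2) (auto simp: indicator_def)
  qed measurable
qed

lemma integrable_shift_diff:
  assumes "continuous_on UNIV f"
  shows "integrable lborel (\<lambda>x. f x * (indicator (interior \<Omega>) (x + \<delta>) - indicator (interior \<Omega>) x) :: real)"
  using Bochner_Integration.integrable_diff[OF integrable_shift[OF assms, of \<delta>] integrable_shift[OF assms, of 0]]
  by (simp add: right_diff_distrib)

text \<open>A connected set that meets the interior and its complement meets the frontier of the
  interior, which is part of the frontier of \<Omega>.\<close>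

lemma crossing:
  assumes "(x \<in> interior \<Omega>) \<noteq> (x + \<delta> \<in> interior \<Omega>)"
  obtains t where "0 \<le> t" "t \<le> 1" "x + t *\<^sub>R \<delta> \<in> frontier \<Omega>"
proof -
  have "closed_segment x (x + \<delta>) \<inter> frontier (interior \<Omega>) \<noteq> {}"
    using assms by (intro connected_Int_frontier) auto
  then obtain y where y: "y \<in> closed_segment x (x + \<delta>)" "y \<in> frontier (interior \<Omega>)" by blast
  have "y \<in> frontier \<Omega>" using y(2) closure_mono[OF interior_subset[of \<Omega>]] by (auto simp: frontier_def)
  moreover obtain t where "0 \<le> t" "t \<le> 1" "y = (1 - t) *\<^sub>R x + t *\<^sub>R (x + \<delta>)"
    using y(1) by (auto simp: closed_segment_def)
  moreover have "(1 - t) *\<^sub>R x + t *\<^sub>R (x + \<delta>) = x + t *\<^sub>R \<delta>" by (simp add: algebra_simps)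
  ultimately show thesis using that by auto
qed

text \<open>The integrand is nonzero only where the segment from \<open>x\<close> to
  \<open>x + \<delta>\<close> crosses the frontier, so \<open>x\<close> lies in the tube of
  \<open>S\<close> along \<open>- \<delta>\<close>. Both \<open>S\<close> and \<open>M\<close>
  concern only crossings from points with \<open>f x \<noteq> 0\<close>. The bound can thus be made
  small either through the area of \<open>S\<close> (edges and corners) or through \<open>M\<close>
  (functions vanishing on the frontier).\<close>

lemma shift_diff_bound:
  assumes K: "\<And>(S :: (real ^ 'n) set) \<delta>. compact S \<Longrightarrow> \<delta> \<noteq> 0 \<Longrightarrow>
      emeasure lborel (tube S \<delta>) \<le> ennreal (K * norm \<delta>) * hausdorff_outer (CARD('n) - 1) S"
    and "0 < K" and f: "continuous_on UNIV f" and S: "compact S" "hausdorff_outer (CARD('n) - 1) S \<le> ennreal h" "0 \<le> h"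
    and "0 \<le> M" and \<delta>: "\<delta> \<noteq> 0"
    and cross: "\<And>x t. 0 \<le> t \<Longrightarrow> t \<le> 1 \<Longrightarrow> x + t *\<^sub>R \<delta> \<in> frontier \<Omega> \<Longrightarrow> f x \<noteq> 0 \<Longrightarrow> x + t *\<^sub>R \<delta> \<in> S \<and> \<bar>f x\<bar> \<le> M"
  shows "\<bar>shift_diff f \<delta>\<bar> \<le> M * K * h * norm \<delta>"
proof -
  let ?O = "interior \<Omega>" and ?T = "tube S (- \<delta>)"
  have T: "?T \<in> sets lborel" using borel_compact[OF compact_tube[OF S(1)]] by simp
  have eT: "emeasure lborel ?T \<le> ennreal (K * norm \<delta> * h)"
  proof -
    have "emeasure lborel ?T \<le> ennreal (K * norm (- \<delta>)) * hausdorff_outer (CARD('n) - 1) S"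
      using \<delta> by (intro K S) simp
    also have "\<dots> \<le> ennreal (K * norm \<delta>) * ennreal h"
      using S by (intro mult_mono) auto
    finally show ?thesis using \<open>0 < K\<close> S(3) by (simp add: ennreal_mult)
  qed
  then have Tfin: "emeasure lborel ?T < top" using le_less_trans ennreal_less_top by blast
  have "\<bar>shift_diff f \<delta>\<bar> \<le> (LINT x|lborel. \<bar>f x * (indicator ?O (x + \<delta>) - indicator ?O x)\<bar>)"
    unfolding shift_diff_def by (rule integral_abs_bound)
  also have "\<dots> \<le> (LINT x|lborel. M * indicator ?T x)"
  proof (rule integral_mono)
    show "integrable lborel (\<lambda>x. \<bar>f x * (indicator ?O (x + \<delta>) - indicator ?O x)\<bar>)"
      using integrable_shift_diff[OF f] by (rule integrable_abs)
    show "integrable lborel (\<lambda>x. M * indicator ?T x)" using T Tfin by simp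
    fix x
    show "\<bar>f x * (indicator ?O (x + \<delta>) - indicator ?O x)\<bar> \<le> M * indicator ?T x"
    proof (cases "f x \<noteq> 0 \<and> (x \<in> ?O) \<noteq> (x + \<delta> \<in> ?O)")
      case True
      then obtain t where t: "0 \<le> t" "t \<le> 1" "x + t *\<^sub>R \<delta> \<in> frontier \<Omega>" using crossing by blast
      then have "x + t *\<^sub>R \<delta> \<in> S" "\<bar>f x\<bar> \<le> M" using cross True by auto
      moreover have "x = (x + t *\<^sub>R \<delta>) + t *\<^sub>R (- \<delta>)" by simp
      ultimately have "x \<in> ?T" using t unfolding mem_tube by blast
      then show ?thesis using True \<open>\<bar>f x\<bar> \<le> M\<close> by (auto simp: indicator_def)
    next
      case False
      then show ?thesis using \<open>0 \<le> M\<close> by (auto simp: indicator_def)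
    qed
  qed
  also have "\<dots> = M * measure lborel ?T" using T Tfin by simp
  also have "\<dots> \<le> M * (K * norm \<delta> * h)"
    using eT \<open>0 < K\<close> S \<open>0 \<le> M\<close> by (intro mult_left_mono) (auto simp: measure_def enn2real_leI)
  finally show ?thesis by (simp add: mult_ac)
qed

section \<open>The increment at one nearly flat piece\<close>

definition flux :: "(real ^ 'n \<Rightarrow> real) \<Rightarrow> real" where
  "flux f = (LINT x:frontier \<Omega>|hausdorff_measure (CARD('n) - 1). f x)"

text \<open>\<open>J\<close> is the integral of \<open>f\<close> over the shadow of the boundary
  piece, with \<open>f\<close> transported along \<nu>. It links the two sides: the shift increment
  is computed in terms of \<open>J\<close> by Fubini, while comparing \<open>J\<close> with the
  surface integral costs at most a power of \<open>1 - \<epsilon>\<close>. The hypothesis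
  \<open>cone\<close> says that stepping back from a point of the closure along the cone about \<nu>
  leads into the interior; the radius \<open>4 * r\<close> leaves room for the auxiliary
  shifts.\<close>

lemma local_flux:
  assumes \<nu>: "norm \<nu> = 1" and \<epsilon>: "0 < \<epsilon>" "\<epsilon> \<le> 1 / 2" and r: "0 < r"
    and cone: "\<And>x y. x \<in> ball p (4 * r) \<Longrightarrow> y \<in> ball p (4 * r) \<Longrightarrow> x \<noteq> y \<Longrightarrow>
      \<epsilon> * norm (y - x) \<le> (y - x) \<bullet> \<nu> \<Longrightarrow> y \<in> closure \<Omega> \<Longrightarrow> x \<in> interior \<Omega>"
    and f: "continuous_on UNIV f" "\<And>x. 0 \<le> f x" "\<And>x. x \<notin> ball p r \<Longrightarrow> f x = 0"
    and c: "0 < c" "hausdorff_ratio c \<nu>"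
  obtains J where "0 \<le> J" "c * J \<le> flux f" "(1 - \<epsilon>) ^ (CARD('n) - 1) * flux f \<le> c * J"
    "\<And>\<eta>. 0 < \<eta> \<Longrightarrow> \<exists>\<rho>>0. \<forall>\<delta>. norm \<delta> < \<rho> \<longrightarrow> \<bar>shift_diff f \<delta> + (\<delta> \<bullet> \<nu>) * J\<bar> \<le> (2 * \<epsilon> * J + \<eta>) * norm \<delta>"
proof -
  let ?O = "interior \<Omega>" and ?d = "CARD('n) - 1" and ?p = "perp_proj \<nu>"
  \<comment> \<open>Points of \<open>ball p r\<close> moved by less than \<open>r\<close> stay
    inside radius \<open>2 * r\<close>, so every frontier crossing that matters for a normal shift
    lies in \<open>Z\<close>.\<close>
  define Z where "Z = frontier \<Omega> \<inter> cball p (2 * r)"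
  have nn: "\<nu> \<bullet> \<nu> = 1" using \<nu> by (simp add: norm_eq_1)
  have frO: "x \<notin> ?O" and frC: "x \<in> closure \<Omega>" if "x \<in> frontier \<Omega>" for x
    using that by (auto simp: frontier_def)
  \<comment> \<open>Two frontier points in cone position would force the first into the interior.
    Excluding this in both orders is exactly the flatness of \<open>Z\<close>.\<close>
  have cone_frontier: "\<not> \<epsilon> * norm (y - x) \<le> (y - x) \<bullet> \<nu>"
    if "x \<in> frontier \<Omega>" "y \<in> frontier \<Omega>" "x \<in> ball p (4 * r)" "y \<in> ball p (4 * r)" "x \<noteq> y" for x y
    using cone[OF that(3,4,5)] frO[OF that(1)] frC[OF that(2)] by blast
  interpret flat_piece \<nu> Z \<epsilon>
  proof
    show "compact Z" unfolding Z_def by (intro compact_Int_closed compact_frontier) auto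
    fix x y assume "x \<in> Z" "y \<in> Z"
    then have xy: "x \<in> frontier \<Omega>" "y \<in> frontier \<Omega>" "x \<in> ball p (4 * r)" "y \<in> ball p (4 * r)"
      using r by (auto simp: Z_def)
    show "\<bar>(x - y) \<bullet> \<nu>\<bar> \<le> \<epsilon> * norm (x - y)"
    proof (cases "x = y")
      case False
      have "(x - y) \<bullet> \<nu> < \<epsilon> * norm (x - y)" using cone_frontier[of y x] xy False by force
      moreover have "(y - x) \<bullet> \<nu> < \<epsilon> * norm (y - x)" using cone_frontier[of x y] xy False by force
      ultimately show ?thesis by (simp add: abs_le_iff norm_minus_commute inner_diff_left)
    qed simp
  qed (use \<nu> \<epsilon> in auto)
  have f_borel [measurable]: "f \<in> borel_measurable borel" by (rule borel_measurable_continuous_onI[OF f(1)])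
  \<comment> \<open>\<open>f\<close> on the boundary piece, read off on the hyperplane and extended
    by 0 outside the shadow of \<open>Z\<close>.\<close>
  define h where "h y = indicator (?p ` Z) y *\<^sub>R f (lift y)" for y
  have h_borel [measurable]: "h \<in> borel_measurable borel"
    unfolding h_def
    by (intro borel_measurable_continuous_on_indicator borel_Z continuous_on_compose2[OF f(1) continuous_on_lift]) auto
  have h0: "0 \<le> h y" for y by (simp add: h_def f)
  have hZ: "h (?p z) = f z" if "z \<in> Z" for z using that by (simp add: h_def lift_perp_proj)
  have ind_h: "indicator (?p ` Z) y * ennreal (h y) = ennreal (h y)" for y
    by (simp add: h_def indicator_def)
  obtain m where "\<And>x. x \<in> cball p r \<Longrightarrow> f x \<le> m"
    using compact_continuous_image[OF continuous_on_subset[OF f(1)] compact_cball, of p r]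
    by (metis bounded_real compact_imp_bounded image_eqI order_trans abs_ge_self subset_UNIV)
  then have m: "f x \<le> max m 0" for x
    using f(3)[of x] by (cases "x \<in> ball p r") (auto simp: le_max_iff_disj)
  obtain a where a: "emeasure (plane_measure \<nu>) (?p ` Z) = ennreal a" "0 \<le> a"
  proof -
    obtain B where "?p ` Z \<subseteq> cball 0 B" 
      using compact_imp_bounded[OF compact_perp_proj] by (metis bounded_subset_ballD ball_subset_cball order_trans)
    then have "emeasure (plane_measure \<nu>) (?p ` Z) \<le> emeasure (plane_measure \<nu>) (cball 0 B)"
      by (intro emeasure_mono) auto
    also have "\<dots> < top" by (rule emeasure_plane_measure_cball[OF \<nu>])
    finally show thesis using that by (cases "emeasure (plane_measure \<nu>) (?p ` Z)") auto
  qed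
  define Jn where "Jn = (\<integral>\<^sup>+ y. ennreal (h y) \<partial>plane_measure \<nu>)"
  have "Jn \<le> (\<integral>\<^sup>+ y. ennreal (max m 0) * indicator (?p ` Z) y \<partial>plane_measure \<nu>)"
    unfolding Jn_def h_def by (intro nn_integral_mono) (auto simp: indicator_def m intro!: ennreal_leI)
  also have "\<dots> = ennreal (max m 0) * ennreal a" by (subst nn_integral_cmult_indicator) (auto simp: a)
  also have "\<dots> < top" by (simp add: ennreal_mult_less_top)
  finally obtain J where J: "Jn = ennreal J" "0 \<le> J" by (cases Jn) auto
  define In where "In = (\<integral>\<^sup>+ x. indicator Z x * ennreal (h (?p x)) \<partial>hausdorff_measure ?d)"
  have low: "ennreal c * Jn \<le> In"
    using hausdorff_vs_plane(1)[OF c, where F = "\<lambda>y. ennreal (h y)"] by (simp add: In_def Jn_def ind_h)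
  have up: "In \<le> ennreal (c / (1 - \<epsilon>) ^ ?d) * Jn"
    using hausdorff_vs_plane(2)[OF c, where F = "\<lambda>y. ennreal (h y)"] by (simp add: In_def Jn_def ind_h)
  also have "\<dots> < top" using J by (simp add: ennreal_mult_less_top)
  finally have Infin: "In < top" .
  have "In = (\<integral>\<^sup>+ x. ennreal (indicator (frontier \<Omega>) x *\<^sub>R f x) \<partial>hausdorff_measure ?d)"
    unfolding In_def
  proof (rule nn_integral_cong)
    fix x
    have "x \<notin> ball p r" if "x \<in> frontier \<Omega>" "x \<notin> Z" using that r by (auto simp: Z_def)
    then show "indicator Z x * ennreal (h (?p x)) = ennreal (indicator (frontier \<Omega>) x *\<^sub>R f x)"
      using hZ[of x] f(3)[of x] by (auto simp: indicator_def Z_def)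
  qed
  then have In: "In = ennreal (flux f)" "0 \<le> flux f"
  proof -
    assume eq: "In = (\<integral>\<^sup>+ x. ennreal (indicator (frontier \<Omega>) x *\<^sub>R f x) \<partial>hausdorff_measure ?d)"
    have meas: "(\<lambda>x. indicator (frontier \<Omega>) x *\<^sub>R f x) \<in> borel_measurable (hausdorff_measure ?d)"
      by (subst measurable_cong_sets[OF sets_hausdorff_measure refl]) measurable
    have nonneg: "AE x in hausdorff_measure ?d. 0 \<le> indicator (frontier \<Omega>) x *\<^sub>R f x"
      using f(2) by simp
    have "flux f = enn2real In"
      unfolding flux_def set_lebesgue_integral_def eq by (rule integral_eq_nn_integral[OF meas nonneg])
    then show "In = ennreal (flux f)" "0 \<le> flux f" using Infin by auto
  qed
  have 1: "c * J \<le> flux f"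
    using low J In c(1) by (simp add: ennreal_mult[symmetric])
  have 2: "(1 - \<epsilon>) ^ ?d * flux f \<le> c * J"
  proof -
    have pos: "0 < (1 - \<epsilon>) ^ ?d" using \<epsilon> by simp
    have "flux f \<le> c / (1 - \<epsilon>) ^ ?d * J"
      using up J In c(1) pos by (simp add: ennreal_mult[symmetric] del: zero_less_power)
    then show ?thesis using pos by (simp add: field_simps del: zero_less_power)
  qed
  \<comment> \<open>On the tube, \<open>f x\<close> is compared with the value of \<open>f\<close>
    at the point of \<open>Z\<close> on the same normal line, at distance at most
    \<open>\<bar>s\<bar>\<close>. The error is the oscillation \<omega> times the volume
    \<open>\<bar>s\<bar> * a\<close> of the tube.\<close>
  have normal: "\<bar>shift_diff f (s *\<^sub>R \<nu>) + s * J\<bar> \<le> \<bar>s\<bar> * (\<omega> * a)"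
    if s: "\<bar>s\<bar> < r" and \<omega>: "\<And>x y. x \<in> cball p (4 * r) \<Longrightarrow> y \<in> cball p (4 * r) \<Longrightarrow> norm (x - y) \<le> \<bar>s\<bar> \<Longrightarrow> \<bar>f x - f y\<bar> \<le> \<omega>"
    for s \<omega>
  proof (cases "s = 0")
    case False
    define T where "T = tube Z ((- s) *\<^sub>R \<nu>)"
    have T_borel [measurable]: "T \<in> sets borel" unfolding T_def by (rule borel_tube)
    have Tex: "\<exists>z\<in>Z. \<exists>t. 0 \<le> t \<and> t \<le> 1 \<and> x + (t * s) *\<^sub>R \<nu> = z" if "x \<in> T" for x
      using that unfolding T_def mem_tube by force
    have Tin: "x \<in> T" if "0 \<le> t" "t \<le> 1" "x + (t * s) *\<^sub>R \<nu> \<in> Z" for x t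
    proof -
      have "x = (x + (t * s) *\<^sub>R \<nu>) + t *\<^sub>R ((- s) *\<^sub>R \<nu>)" by simp
      then show ?thesis unfolding T_def mem_tube using that by blast
    qed
    have small: "norm ((t * s) *\<^sub>R \<nu>) \<le> \<bar>s\<bar>" if "0 \<le> t" "t \<le> 1" for t
      using that \<nu> by (simp add: abs_mult mult_left_le_one_le)
    \<comment> \<open>For \<open>s > 0\<close> the shift carries points of the tube from inside to
      outside, so the difference of indicators is -1; for \<open>s < 0\<close> it is +1. Within the
      support of \<open>f\<close>, points off the tube do not cross the frontier.\<close>
    have ae: "AE x in lborel. f x * (indicator ?O (x + s *\<^sub>R \<nu>) - indicator ?O x) = - sgn s * (indicator T x * f x)"
      using AE_notin_frontier[of 0] AE_notin_frontier[of "s *\<^sub>R \<nu>"]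
    proof eventually_elim
      fix x assume x: "x + 0 \<notin> frontier \<Omega>" "x + s *\<^sub>R \<nu> \<notin> frontier \<Omega>"
      show "f x * (indicator ?O (x + s *\<^sub>R \<nu>) - indicator ?O x) = - sgn s * (indicator T x * f x)"
      proof (cases "x \<in> ball p r")
        case inball: True
        have near: "x + (t * s) *\<^sub>R \<nu> \<in> ball p (2 * r)" if "0 \<le> t" "t \<le> 1" for t
        proof -
          have "dist p (x + (t * s) *\<^sub>R \<nu>) \<le> dist p x + dist x (x + (t * s) *\<^sub>R \<nu>)" by (rule dist_triangle)
          also have "dist x (x + (t * s) *\<^sub>R \<nu>) \<le> \<bar>s\<bar>" using small[OF that] by (simp add: dist_norm)
          finally show ?thesis using inball s by simp
        qed
        show ?thesis
        proof (cases "x \<in> T")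
          case True
          then obtain z t where z: "z \<in> Z" "0 \<le> t" "t \<le> 1" "x + (t * s) *\<^sub>R \<nu> = z" using Tex by blast
          have zf: "z \<in> frontier \<Omega>" using z by (simp add: Z_def)
          \<comment> \<open>Both endpoints avoid the frontier almost everywhere, so the crossing is
            strictly inside the segment and the cone condition applies to both halves.\<close>
          have t: "0 < t" "t < 1"
            using x z zf by (auto simp: less_le)
          define y where "y = x + s *\<^sub>R \<nu>"
          have y2: "y \<in> ball p (4 * r)" and x2: "x \<in> ball p (4 * r)" and z2: "z \<in> ball p (4 * r)"
            using near[of 1] near[of 0] near[of t] z r by (auto simp: y_def)
          have zx: "z - x = (t * s) *\<^sub>R \<nu>" and yz: "y - z = ((1 - t) * s) *\<^sub>R \<nu>"
            using z(4) by (auto simp: y_def algebra_simps)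
          have c1: "\<epsilon> * norm (u *\<^sub>R \<nu>) \<le> (u *\<^sub>R \<nu>) \<bullet> \<nu>" if "0 \<le> u" for u
            using that \<epsilon> \<nu> nn by (simp add: mult_left_le_one_le)
          show ?thesis
          proof (cases "0 < s")
            case True
            have "x \<in> ?O"
            proof (rule cone[OF x2 z2 _ _ frC[OF zf]])
              show "x \<noteq> z" using zx t True \<nu> by auto
            qed (use c1[of "t * s"] zx t True in simp)
            moreover have "y \<notin> ?O"
            proof
              assume "y \<in> ?O"
              then have "y \<in> closure \<Omega>" using interior_subset closure_subset by blast
              have "z \<in> ?O"
              proof (rule cone[OF z2 y2 _ _ \<open>y \<in> closure \<Omega>\<close>])
                show "z \<noteq> y" using yz t True \<nu> by auto
              qed (use c1[of "(1 - t) * s"] yz t True in simp)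
              then show False using frO[OF zf] by blast
            qed
            ultimately show ?thesis using True \<open>x \<in> T\<close> by (simp add: y_def)
          next
            case s_neg: False
            then have s0: "s < 0" using \<open>s \<noteq> 0\<close> by simp
            have xz: "x - z = (t * (- s)) *\<^sub>R \<nu>" and zy: "z - y = ((1 - t) * (- s)) *\<^sub>R \<nu>"
              using zx yz by (metis minus_diff_eq mult_minus_right scaleR_minus_left)+
            have "y \<in> ?O"
            proof (rule cone[OF y2 z2 _ _ frC[OF zf]])
              show "y \<noteq> z" using yz t s0 \<nu> by auto
            qed (use c1[of "(1 - t) * (- s)"] zy t s0 in \<open>simp add: mult_nonneg_nonpos\<close>)
            moreover have "x \<notin> ?O"
            proof
              assume "x \<in> ?O"
              then have "x \<in> closure \<Omega>" using interior_subset closure_subset by blast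
              have "z \<in> ?O"
              proof (rule cone[OF z2 x2 _ _ \<open>x \<in> closure \<Omega>\<close>])
                show "z \<noteq> x" using zx t s0 \<nu> by auto
              qed (use c1[of "t * (- s)"] xz t s0 in \<open>simp add: mult_nonneg_nonpos\<close>)
              then show False using frO[OF zf] by blast
            qed
            ultimately show ?thesis using s0 \<open>x \<in> T\<close> by (simp add: y_def)
          qed
        next
          case False
          have "(x \<in> ?O) = (x + s *\<^sub>R \<nu> \<in> ?O)"
          proof (rule ccontr)
            assume "(x \<in> ?O) \<noteq> (x + s *\<^sub>R \<nu> \<in> ?O)"
            then obtain t where t: "0 \<le> t" "t \<le> 1" "x + t *\<^sub>R s *\<^sub>R \<nu> \<in> frontier \<Omega>" using crossing by blast
            then have "x + (t * s) *\<^sub>R \<nu> \<in> Z" using near[of t] by (simp add: Z_def)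
            then show False using Tin t False by blast
          qed
          then show ?thesis using False by (simp add: indicator_def)
        qed
      qed (simp add: f)
    qed
    have "shift_diff f (s *\<^sub>R \<nu>) = (LINT x|lborel. - sgn s * (indicator T x * f x))"
      unfolding shift_diff_def by (rule integral_cong_AE[OF _ _ ae]) measurable
    then have sd: "shift_diff f (s *\<^sub>R \<nu>) = - sgn s * (LINT x|lborel. indicator T x * f x)"
      by simp
    have "compact T" unfolding T_def by (intro compact_tube cmp)
    have int1: "integrable lborel (\<lambda>x. indicator T x * f x)"
      using borel_integrable_compact[OF \<open>compact T\<close> continuous_on_subset[OF f(1)]] by simp
    have nnT: "(\<integral>\<^sup>+ x. indicator T x * ennreal (h (?p x)) \<partial>lborel) = ennreal (\<bar>s\<bar> * J)"
      using nn_integral_tube[of "\<lambda>y. ennreal (h y)" "- s"] J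
      by (simp only: T_def[symmetric]) (simp add: ind_h Jn_def[symmetric] ennreal_mult)
    have eT: "emeasure lborel T = ennreal (\<bar>s\<bar> * a)"
    proof -
      have "emeasure lborel T = (\<integral>\<^sup>+ x. indicator T x * 1 \<partial>lborel)"
        unfolding mult_1_right by (rule nn_integral_indicator[symmetric]) simp
      also have "\<dots> = ennreal \<bar>- s\<bar> * (\<integral>\<^sup>+ y. indicator (?p ` Z) y * 1 \<partial>plane_measure \<nu>)"
        unfolding T_def by (rule nn_integral_tube) simp
      finally show ?thesis using a by (simp add: ennreal_mult)
    qed
    have nn2: "(\<integral>\<^sup>+ x. ennreal (indicator T x * h (?p x)) \<partial>lborel) = ennreal (\<bar>s\<bar> * J)"
      unfolding nnT[symmetric] by (intro nn_integral_cong) (simp add: indicator_def)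
    have int2: "integrable lborel (\<lambda>x. indicator T x * h (?p x))"
      by (rule integrableI_nonneg) (auto simp: nn2 h0)
    have val2: "(LINT x|lborel. indicator T x * h (?p x)) = \<bar>s\<bar> * J"
      using J by (subst integral_eq_nn_integral) (auto simp: nn2 h0)
    have int3: "integrable lborel (\<lambda>x. \<omega> * indicator T x)" using eT by simp
    have "\<bar>(LINT x|lborel. indicator T x * f x) - \<bar>s\<bar> * J\<bar>
      = \<bar>LINT x|lborel. indicator T x * f x - indicator T x * h (?p x)\<bar>"
      using int1 int2 val2 by simp
    also have "\<dots> \<le> (LINT x|lborel. \<bar>indicator T x * f x - indicator T x * h (?p x)\<bar>)"
      by (rule integral_abs_bound)
    also have "\<dots> \<le> (LINT x|lborel. \<omega> * indicator T x)"
    proof (rule integral_mono)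
      fix x
      show "\<bar>indicator T x * f x - indicator T x * h (?p x)\<bar> \<le> \<omega> * indicator T x"
      proof (cases "x \<in> T")
        case True
        then obtain z t where z: "z \<in> Z" "0 \<le> t" "t \<le> 1" "x + (t * s) *\<^sub>R \<nu> = z" using Tex by blast
        have "?p z = ?p x" using z(4) by (auto simp: perp_proj_add perp_proj_scale perp_proj_self \<nu>)
        then have "h (?p x) = f z" using hZ[OF z(1)] by simp
        moreover have "norm (x - z) \<le> \<bar>s\<bar>" using small[OF z(2,3)] z(4) by (metis add_diff_cancel_left' norm_minus_commute)
        moreover have "z \<in> cball p (4 * r)" using z(1) r by (auto simp: Z_def)
        moreover have "x \<in> cball p (4 * r)"
          using z(1) r s dist_triangle[of p x z] \<open>norm (x - z) \<le> \<bar>s\<bar>\<close>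
          by (auto simp: Z_def dist_norm norm_minus_commute)
        ultimately show ?thesis using \<omega>[of x z] True by simp
      qed simp
    qed (use int1 int2 int3 in auto)
    also have "\<dots> = \<bar>s\<bar> * (\<omega> * a)" using eT a by (simp add: measure_def)
    finally have "\<bar>(LINT x|lborel. indicator T x * f x) - \<bar>s\<bar> * J\<bar> \<le> \<bar>s\<bar> * (\<omega> * a)" .
    moreover have "shift_diff f (s *\<^sub>R \<nu>) + s * J = - sgn s * ((LINT x|lborel. indicator T x * f x) - \<bar>s\<bar> * J)"
      unfolding sd by (auto simp: sgn_if algebra_simps)
    ultimately show ?thesis using False by (simp add: abs_mult abs_sgn_eq)
  qed (simp add: shift_diff_def)
  have 3: "\<exists>\<rho>>0. \<forall>\<delta>. norm \<delta> < \<rho> \<longrightarrow> \<bar>shift_diff f \<delta> + (\<delta> \<bullet> \<nu>) * J\<bar> \<le> (2 * \<epsilon> * J + \<eta>) * norm \<delta>" if "0 < \<eta>" for \<eta>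
  proof -
    \<comment> \<open>Chosen so that the oscillation error for shifts of length at most
      \<open>2 * norm \<delta>\<close> stays below \<open>\<eta> * norm \<delta>\<close>; the added
      1 covers \<open>a = 0\<close>.\<close>
    define \<omega> where "\<omega> = \<eta> / (2 * (a + 1))"
    have "0 < \<omega>" using that a by (simp add: \<omega>_def)
    have "uniformly_continuous_on (cball p (4 * r)) f"
      by (intro compact_uniformly_continuous continuous_on_subset[OF f(1)]) auto
    then obtain \<rho>0 where \<rho>0: "0 < \<rho>0" "\<And>x y. x \<in> cball p (4 * r) \<Longrightarrow> y \<in> cball p (4 * r) \<Longrightarrow> dist x y < \<rho>0 \<Longrightarrow> dist (f x) (f y) < \<omega>"
      using \<open>0 < \<omega>\<close> unfolding uniformly_continuous_on_def by metis
    define \<rho> where "\<rho> = min (\<rho>0 / 2) (r / 2)"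
    show ?thesis
    proof (intro exI[of _ \<rho>] conjI allI impI)
      show "0 < \<rho>" using \<rho>0 r by (simp add: \<rho>_def)
      fix \<delta> :: "real ^ 'n" assume \<delta>: "norm \<delta> < \<rho>"
      define \<sigma> where "\<sigma> = \<delta> \<bullet> \<nu>"
      define y where "y = ?p \<delta>"
      have dec: "\<delta> = y + \<sigma> *\<^sub>R \<nu>" unfolding y_def \<sigma>_def by (rule perp_proj_decomp)
      have ynu: "y \<bullet> \<nu> = 0" unfolding y_def by (rule perp_proj_inner[OF \<nu>])
      have ny: "norm y \<le> norm \<delta>" unfolding y_def by (rule norm_perp_proj_le[OF \<nu>])
      have n\<sigma>: "\<bar>\<sigma>\<bar> \<le> norm \<delta>" using Cauchy_Schwarz_ineq2[of \<delta> \<nu>] \<nu> by (simp add: \<sigma>_def)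
      have ey: "0 \<le> 2 * \<epsilon> * norm y" "2 * \<epsilon> * norm y \<le> norm \<delta>"
        using \<epsilon> ny mult_mono[of "2 * \<epsilon>" 1 "norm y" "norm \<delta>"] by auto
      \<comment> \<open>The vectors \<open>s1 *\<^sub>R \<nu> - \<delta>\<close> and
        \<open>\<delta> - s2 *\<^sub>R \<nu>\<close> have normal component
        \<open>2 * \<epsilon> * norm y\<close> and tangential part of length \<open>norm y\<close>.
        As \<open>2 * \<epsilon> \<le> 1\<close>, their norm is at most \<open>2 * norm y\<close>,
        so both lie in the cone, and the shift by \<delta> is squeezed between two normal
        shifts.\<close>
      define s1 where "s1 = \<sigma> + 2 * \<epsilon> * norm y"
      define s2 where "s2 = \<sigma> - 2 * \<epsilon> * norm y"
      have s12: "\<bar>s1\<bar> \<le> 2 * norm \<delta>" "\<bar>s2\<bar> \<le> 2 * norm \<delta>" using n\<sigma> ey by (auto simp: s1_def s2_def)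
      have N: "\<bar>shift_diff f (s *\<^sub>R \<nu>) + s * J\<bar> \<le> 2 * norm \<delta> * (\<omega> * a)" if "\<bar>s\<bar> \<le> 2 * norm \<delta>" for s
      proof -
        have "\<bar>shift_diff f (s *\<^sub>R \<nu>) + s * J\<bar> \<le> \<bar>s\<bar> * (\<omega> * a)"
        proof (rule normal)
          show "\<bar>s\<bar> < r" using that \<delta> by (simp add: \<rho>_def)
          fix x y assume "x \<in> cball p (4 * r)" "y \<in> cball p (4 * r)" "norm (x - y) \<le> \<bar>s\<bar>"
          then show "\<bar>f x - f y\<bar> \<le> \<omega>"
            using \<rho>0(2)[of x y] that \<delta> by (simp add: \<rho>_def dist_norm)
        qed
        also have "\<dots> \<le> 2 * norm \<delta> * (\<omega> * a)"
          using that \<open>0 < \<omega>\<close> a by (intro mult_right_mono) auto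
        finally show ?thesis .
      qed
      have near: "x + v \<in> ball p (4 * r)" if "x \<in> ball p r" "norm v \<le> 2 * norm \<delta>" for x v
      proof -
        have "dist p (x + v) \<le> dist p x + norm v" by (metis add_diff_cancel_left' dist_norm dist_commute dist_triangle2)
        then show ?thesis using that \<delta> r by (simp add: \<rho>_def)
      qed
      have step: "indicator ?O (x + u) \<le> (indicator ?O (x + v) :: real)"
        if "x \<in> ball p r" "norm u \<le> 2 * norm \<delta>" "norm v \<le> 2 * norm \<delta>" "\<epsilon> * norm (u - v) \<le> (u - v) \<bullet> \<nu>" for x u v
      proof -
        have "x + v \<in> ?O" if "x + u \<in> ?O"
        proof (cases "u = v")
          case False
          show ?thesis
          proof (rule cone)
            show "x + u \<in> closure \<Omega>" using that interior_subset closure_subset by blast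
          qed (use near \<open>x \<in> ball p r\<close> \<open>norm u \<le> 2 * norm \<delta>\<close> \<open>norm v \<le> 2 * norm \<delta>\<close> False
            \<open>\<epsilon> * norm (u - v) \<le> (u - v) \<bullet> \<nu>\<close> in auto)
        qed (use that in simp)
        then show ?thesis by (auto simp: indicator_def)
      qed
      have cone1: "\<epsilon> * norm ((2 * \<epsilon> * norm y) *\<^sub>R \<nu> + w) \<le> 2 * \<epsilon> * norm y" if "norm w = norm y" for w
      proof -
        have "norm ((2 * \<epsilon> * norm y) *\<^sub>R \<nu> + w) \<le> norm ((2 * \<epsilon> * norm y) *\<^sub>R \<nu>) + norm w" by (rule norm_triangle_ineq)
        also have "\<dots> = 2 * \<epsilon> * norm y + norm y" using \<nu> ey that by simp
        also have "\<dots> \<le> 2 * norm y" using \<epsilon> mult_right_mono[of "2 * \<epsilon>" 1 "norm y"] by simp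
        finally show ?thesis using \<epsilon> by (simp add: mult.assoc mult_left_mono mult.left_commute)
      qed
      have "shift_diff f (s1 *\<^sub>R \<nu>) \<le> shift_diff f \<delta>"
        unfolding shift_diff_def
      proof (rule integral_mono)
        fix x
        show "f x * (indicator ?O (x + s1 *\<^sub>R \<nu>) - indicator ?O x) \<le> f x * (indicator ?O (x + \<delta>) - indicator ?O x)"
        proof (cases "x \<in> ball p r")
          case True
          have "s1 *\<^sub>R \<nu> - \<delta> = (2 * \<epsilon> * norm y) *\<^sub>R \<nu> + (- y)" by (simp add: s1_def dec algebra_simps)
          then have "\<epsilon> * norm (s1 *\<^sub>R \<nu> - \<delta>) \<le> (s1 *\<^sub>R \<nu> - \<delta>) \<bullet> \<nu>"
            using cone1[of "- y"] by (simp add: inner_diff_left nn ynu)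
          then have "indicator ?O (x + s1 *\<^sub>R \<nu>) \<le> (indicator ?O (x + \<delta>) :: real)"
            using True s12 \<nu> by (intro step) auto
          then show ?thesis by (intro mult_left_mono f) auto
        qed (simp add: f)
      qed (intro integrable_shift_diff f)+
      moreover have "shift_diff f \<delta> \<le> shift_diff f (s2 *\<^sub>R \<nu>)"
        unfolding shift_diff_def
      proof (rule integral_mono)
        fix x
        show "f x * (indicator ?O (x + \<delta>) - indicator ?O x) \<le> f x * (indicator ?O (x + s2 *\<^sub>R \<nu>) - indicator ?O x)"
        proof (cases "x \<in> ball p r")
          case True
          have "\<delta> - s2 *\<^sub>R \<nu> = (2 * \<epsilon> * norm y) *\<^sub>R \<nu> + y" by (simp add: s2_def dec algebra_simps)
          then have "\<epsilon> * norm (\<delta> - s2 *\<^sub>R \<nu>) \<le> (\<delta> - s2 *\<^sub>R \<nu>) \<bullet> \<nu>"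
            using cone1[of y] by (simp add: inner_add_left nn ynu)
          then have "indicator ?O (x + \<delta>) \<le> (indicator ?O (x + s2 *\<^sub>R \<nu>) :: real)"
            using True s12 \<nu> by (intro step) auto
          then show ?thesis by (intro mult_left_mono f) auto
        qed (simp add: f)
      qed (intro integrable_shift_diff f)+
      moreover have "2 * norm \<delta> * (\<omega> * a) \<le> \<eta> * norm \<delta>"
      proof -
        have "2 * (\<omega> * a) \<le> \<eta>" using a that by (simp add: \<omega>_def field_simps)
        then show ?thesis using mult_right_mono[of "2 * (\<omega> * a)" \<eta> "norm \<delta>"] by (simp add: mult_ac)
      qed
      moreover have "2 * \<epsilon> * norm y * J \<le> 2 * \<epsilon> * J * norm \<delta>"
        using mult_left_mono[OF ny, of "2 * \<epsilon> * J"] \<epsilon> J by (simp add: mult_ac)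
      ultimately show "\<bar>shift_diff f \<delta> + (\<delta> \<bullet> \<nu>) * J\<bar> \<le> (2 * \<epsilon> * J + \<eta>) * norm \<delta>"
        using N[OF s12(1)] N[OF s12(2)]
        unfolding \<sigma>_def[symmetric] s1_def s2_def by (simp add: abs_le_iff algebra_simps)
    qed
  qed
  show thesis by (rule that[OF J(2) 1 2 3])
qed

end

section \<open>The geometry near a smooth boundary point\<close>

text \<open>Continuity of \<open>r\<close> makes the sets where \<open>r\<close> is negative or
  positive open, which upgrades membership in \<Omega> to the interior and non-membership to the
  exterior. The same pair serves at every point of \<open>U\<close>.\<close>

lemma local_defining_functionE:
  assumes "local_defining_function \<Omega> p r G"
  obtains U where "open U" "p \<in> U" "continuous_on U G"
    "\<And>x. x \<in> U \<Longrightarrow> (r has_derivative (\<lambda>h. G x \<bullet> h)) (at x)" "\<And>x. x \<in> U \<Longrightarrow> G x \<noteq> 0"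
    "\<And>x. x \<in> U \<Longrightarrow> r x < 0 \<Longrightarrow> x \<in> interior \<Omega>" "\<And>x. x \<in> U \<Longrightarrow> r x > 0 \<Longrightarrow> x \<notin> closure \<Omega>"
    "\<And>x. x \<in> U \<Longrightarrow> local_defining_function \<Omega> x r G"
proof -
  obtain U where U: "open U" "p \<in> U" "continuous_on U G"
    and P: "\<And>x. x \<in> U \<Longrightarrow> (r has_derivative (\<lambda>h. G x \<bullet> h)) (at x) \<and> G x \<noteq> 0 \<and>
              (r x < 0 \<longrightarrow> x \<in> \<Omega>) \<and> (r x > 0 \<longrightarrow> x \<notin> \<Omega>)"
    using assms unfolding local_defining_function_def by blast
  have cont: "continuous_on U r"
    using P by (meson continuous_at_imp_continuous_on has_derivative_continuous)
  have neg: "x \<in> interior \<Omega>" if "x \<in> U" "r x < 0" for x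
  proof (rule interiorI)
    show "open (U \<inter> r -` {..<0})" using continuous_open_preimage[OF cont U(1)] by simp
  qed (use that P in auto)
  have pos: "x \<notin> closure \<Omega>" if "x \<in> U" "r x > 0" for x
  proof -
    have "open (U \<inter> r -` {0<..})" using continuous_open_preimage[OF cont U(1)] by simp
    moreover have "U \<inter> r -` {0<..} \<inter> \<Omega> = {}" using P by auto
    ultimately have "U \<inter> r -` {0<..} \<inter> closure \<Omega> = {}" by (simp add: open_Int_closure_eq_empty)
    then show ?thesis using that by auto
  qed
  have ldf: "local_defining_function \<Omega> x r G" if "x \<in> U" for x
    unfolding local_defining_function_def using U P that by blast
  show thesis using that[OF U _ _ neg pos ldf] P by blast
qed

text \<open>If \<open>a\<close> and \<open>b\<close> differ, then \<open>a \<bullet> b < 1\<close>,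
  and \<open>b - a\<close> has negative product with \<open>a\<close> and positive product with
  \<open>b\<close>.\<close>

lemma unit_eq_if_no_separating_direction:
  fixes a b :: "'a::real_inner"
  assumes "norm a = 1" "norm b = 1" and "\<And>v. \<not> (v \<bullet> a < 0 \<and> 0 < v \<bullet> b)"
  shows "a = b"
proof (rule ccontr)
  assume "a \<noteq> b"
  have "0 < (norm (b - a))\<^sup>2" using \<open>a \<noteq> b\<close> by simp
  also have "(norm (b - a))\<^sup>2 = 2 - 2 * (a \<bullet> b)"
    using assms(1,2) unfolding power2_norm_eq_inner norm_eq_1
    by (simp add: inner_diff_left inner_diff_right inner_commute)
  finally have "a \<bullet> b < 1" by simp
  then have "(b - a) \<bullet> a < 0 \<and> 0 < (b - a) \<bullet> b"
    using assms(1,2) unfolding norm_eq_1 by (simp add: inner_diff_left inner_diff_right inner_commute)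
  then show False using assms(3) by blast
qed

lemma has_derivative_along_line:
  fixes r :: "'a::real_inner \<Rightarrow> real"
  assumes "(r has_derivative (\<lambda>h. g \<bullet> h)) (at (x + t *\<^sub>R v))"
  shows "((\<lambda>t. r (x + t *\<^sub>R v)) has_real_derivative (g \<bullet> v)) (at t)"
proof -
  have "((\<lambda>t. x + t *\<^sub>R v) has_derivative (\<lambda>h. h *\<^sub>R v)) (at t)"
    by (auto intro!: derivative_eq_intros)
  from has_derivative_compose[OF this assms]
  have "((\<lambda>t. r (x + t *\<^sub>R v)) has_derivative (\<lambda>h. h * (g \<bullet> v))) (at t)" by simp
  moreover have "(\<lambda>h. h * (g \<bullet> v)) = (*) (g \<bullet> v)" by (simp add: fun_eq_iff mult.commute)
  ultimately show ?thesis by (simp add: has_field_derivative_def)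
qed

text \<open>A frontier point has \<open>r p = 0\<close>, so the sign of the directional derivative
  decides on which side a short ray from \<open>p\<close> runs. This describes the direction of
  \<open>G p\<close> by \<Omega> alone.\<close>

lemma local_defining_function_ray:
  assumes "p \<in> frontier \<Omega>" "local_defining_function \<Omega> p r G"
  shows "G p \<noteq> 0"
    and "v \<bullet> G p < 0 \<Longrightarrow> \<forall>\<^sub>F t in at_right 0. p + t *\<^sub>R v \<in> interior \<Omega>"
    and "0 < v \<bullet> G p \<Longrightarrow> \<forall>\<^sub>F t in at_right 0. p + t *\<^sub>R v \<notin> closure \<Omega>"
proof -
  obtain U where U: "open U" "p \<in> U"
    "\<And>x. x \<in> U \<Longrightarrow> (r has_derivative (\<lambda>h. G x \<bullet> h)) (at x)" "\<And>x. x \<in> U \<Longrightarrow> G x \<noteq> 0"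
    "\<And>x. x \<in> U \<Longrightarrow> r x < 0 \<Longrightarrow> x \<in> interior \<Omega>" "\<And>x. x \<in> U \<Longrightarrow> r x > 0 \<Longrightarrow> x \<notin> closure \<Omega>"
    using local_defining_functionE[OF assms(2)] by metis
  show "G p \<noteq> 0" using U by blast
  have "p \<notin> interior \<Omega>" "p \<in> closure \<Omega>" using assms(1) by (auto simp: frontier_def)
  then have r0: "r p = 0" using U(2,5,6) by (metis linorder_neqE_linordered_idom)
  have der: "((\<lambda>t. r (p + t *\<^sub>R v)) has_real_derivative (G p \<bullet> v)) (at 0)"
    by (rule has_derivative_along_line) (use U in simp)
  have "((\<lambda>t. p + t *\<^sub>R v) \<longlongrightarrow> p + 0 *\<^sub>R v) (at_right 0)" by (intro tendsto_intros)
  then have inU: "\<forall>\<^sub>F t in at_right 0. p + t *\<^sub>R v \<in> U"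
    using U(1,2) by (intro topological_tendstoD) auto
  {
    assume "v \<bullet> G p < 0"
    then obtain d where d: "0 < d" "\<And>t. 0 < t \<Longrightarrow> t < d \<Longrightarrow> r (p + t *\<^sub>R v) < 0"
      using DERIV_neg_dec_right[OF der] r0 by (auto simp: inner_commute)
    then have "\<forall>\<^sub>F t in at_right 0. r (p + t *\<^sub>R v) < 0" by (intro eventually_at_rightI[of 0 d]) auto
    with inU show "\<forall>\<^sub>F t in at_right 0. p + t *\<^sub>R v \<in> interior \<Omega>" by eventually_elim (rule U)
  next
    assume "0 < v \<bullet> G p"
    then obtain d where d: "0 < d" "\<And>t. 0 < t \<Longrightarrow> t < d \<Longrightarrow> 0 < r (p + t *\<^sub>R v)"
      using DERIV_pos_inc_right[OF der] r0 by (auto simp: inner_commute)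
    then have "\<forall>\<^sub>F t in at_right 0. 0 < r (p + t *\<^sub>R v)" by (intro eventually_at_rightI[of 0 d]) auto
    with inU show "\<forall>\<^sub>F t in at_right 0. p + t *\<^sub>R v \<notin> closure \<Omega>" by eventually_elim (rule U)
  }
qed

text \<open>If the two unit normals differed, some direction would point inward for one defining
  function and outward for the other; a short ray in it would lie in the interior and outside the
  closure at once.\<close>

lemma normal_unique:
  assumes p: "p \<in> frontier \<Omega>" and ldf: "local_defining_function \<Omega> p r G" "local_defining_function \<Omega> p r' G'"
  shows "G p /\<^sub>R norm (G p) = G' p /\<^sub>R norm (G' p)"
proof (rule unit_eq_if_no_separating_direction)
  note ray = local_defining_function_ray[OF p ldf(1)] and ray' = local_defining_function_ray[OF p ldf(2)]
  show "norm (G p /\<^sub>R norm (G p)) = 1" "norm (G' p /\<^sub>R norm (G' p)) = 1" using ray(1) ray'(1) by auto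
  fix v
  show "\<not> (v \<bullet> (G p /\<^sub>R norm (G p)) < 0 \<and> 0 < v \<bullet> (G' p /\<^sub>R norm (G' p)))"
  proof
    assume v: "v \<bullet> (G p /\<^sub>R norm (G p)) < 0 \<and> 0 < v \<bullet> (G' p /\<^sub>R norm (G' p))"
    have "v \<bullet> G p < 0" "0 < v \<bullet> G' p"
      using v ray(1) ray'(1) by (auto simp: inverse_eq_divide divide_less_0_iff zero_less_divide_iff)
    then have "\<forall>\<^sub>F t in at_right (0::real). p + t *\<^sub>R v \<in> interior \<Omega> \<and> p + t *\<^sub>R v \<notin> closure \<Omega>"
      using ray(2) ray'(3) by (intro eventually_conj) auto
    then have "\<forall>\<^sub>F t in at_right (0::real). False"
      by eventually_elim (use interior_subset closure_subset in blast)
    then show False by simp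
  qed
qed

lemma outward_normal_eq:
  assumes "p \<in> frontier \<Omega>" "local_defining_function \<Omega> p r G"
  shows "outward_normal \<Omega> p = G p /\<^sub>R norm (G p)"
proof -
  have "p \<in> smooth_boundary_points \<Omega>" using assms by (auto simp: smooth_boundary_points_def)
  moreover have "(THE v. \<exists>r G. local_defining_function \<Omega> p r G \<and> v = G p /\<^sub>R norm (G p)) = G p /\<^sub>R norm (G p)"
    using assms normal_unique[OF assms(1)] by (intro the_equality) blast+
  ultimately show ?thesis by (simp add: outward_normal_def)
qed

section \<open>The smooth part of the frontier and its normal field\<close>

lemma smooth_boundary_pointsE:
  assumes "p \<in> smooth_boundary_points \<Omega>"
  obtains U r G where "open U" "p \<in> U" "continuous_on U G"
    "\<And>x. x \<in> U \<Longrightarrow> (r has_derivative (\<lambda>h. G x \<bullet> h)) (at x)" "\<And>x. x \<in> U \<Longrightarrow> G x \<noteq> 0"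
    "\<And>x. x \<in> U \<Longrightarrow> r x < 0 \<Longrightarrow> x \<in> interior \<Omega>" "\<And>x. x \<in> U \<Longrightarrow> r x > 0 \<Longrightarrow> x \<notin> closure \<Omega>"
    "\<And>x. x \<in> U \<Longrightarrow> x \<in> frontier \<Omega> \<Longrightarrow> x \<in> smooth_boundary_points \<Omega> \<and> outward_normal \<Omega> x = G x /\<^sub>R norm (G x)"
proof -
  obtain r G where rG: "local_defining_function \<Omega> p r G"
    using assms by (auto simp: smooth_boundary_points_def)
  obtain U where U: "open U" "p \<in> U" "continuous_on U G"
    "\<And>x. x \<in> U \<Longrightarrow> (r has_derivative (\<lambda>h. G x \<bullet> h)) (at x)" "\<And>x. x \<in> U \<Longrightarrow> G x \<noteq> 0"
    "\<And>x. x \<in> U \<Longrightarrow> r x < 0 \<Longrightarrow> x \<in> interior \<Omega>" "\<And>x. x \<in> U \<Longrightarrow> r x > 0 \<Longrightarrow> x \<notin> closure \<Omega>"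
    and ldf: "\<And>x. x \<in> U \<Longrightarrow> local_defining_function \<Omega> x r G"
    using local_defining_functionE[OF rG] by blast
  show thesis
  proof (rule that[OF U])
    fix x assume "x \<in> U" "x \<in> frontier \<Omega>"
    then show "x \<in> smooth_boundary_points \<Omega> \<and> outward_normal \<Omega> x = G x /\<^sub>R norm (G x)"
      using ldf[of x] outward_normal_eq[of x \<Omega> r G] by (auto simp: smooth_boundary_points_def)
  qed
qed

text \<open>A defining function at \<open>p\<close> works at all nearby frontier points, so the
  smooth part is relatively open. Hence it is Borel, and the edges and corners form a closed
  set.\<close>

lemma smooth_boundary_points_open:
  obtains W where "open W" "smooth_boundary_points \<Omega> = frontier \<Omega> \<inter> W"
proof
  let ?W = "\<Union>{U. open U \<and> frontier \<Omega> \<inter> U \<subseteq> smooth_boundary_points \<Omega>}"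
  show "open ?W" by auto
  show "smooth_boundary_points \<Omega> = frontier \<Omega> \<inter> ?W"
  proof
    show "smooth_boundary_points \<Omega> \<subseteq> frontier \<Omega> \<inter> ?W"
    proof
      fix p assume p: "p \<in> smooth_boundary_points \<Omega>"
      then obtain U where "open U" "p \<in> U" "\<And>x. x \<in> U \<Longrightarrow> x \<in> frontier \<Omega> \<Longrightarrow> x \<in> smooth_boundary_points \<Omega>"
        by (rule smooth_boundary_pointsE) blast
      then show "p \<in> frontier \<Omega> \<inter> ?W" using p by (auto simp: smooth_boundary_points_def)
    qed
  qed blast
qed

lemma borel_smooth_boundary_points: "smooth_boundary_points \<Omega> \<in> sets borel"
proof -
  obtain W where "open W" "smooth_boundary_points \<Omega> = frontier \<Omega> \<inter> W" by (rule smooth_boundary_points_open)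
  then show ?thesis by auto
qed

lemma closed_nonsmooth: "closed (frontier \<Omega> - smooth_boundary_points \<Omega>)"
proof -
  obtain W where W: "open W" "smooth_boundary_points \<Omega> = frontier \<Omega> \<inter> W" by (rule smooth_boundary_points_open)
  have "frontier \<Omega> - smooth_boundary_points \<Omega> = frontier \<Omega> \<inter> - W" using W by blast
  then show ?thesis using W by (auto intro: closed_Int)
qed

lemma norm_outward_normal_le: "norm (outward_normal \<Omega> p) \<le> 1"
proof (cases "p \<in> smooth_boundary_points \<Omega>")
  case True
  then obtain U G where "p \<in> U" "G p \<noteq> 0"
    "outward_normal \<Omega> p = G p /\<^sub>R norm (G p)"
    by (rule smooth_boundary_pointsE) (use True in \<open>auto simp: smooth_boundary_points_def\<close>)
  then show ?thesis by simp
qed (simp add: outward_normal_def)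

text \<open>On the smooth part the normal is locally the normalised gradient of a single defining
  function, hence continuous there; on the Borel complement it takes the default value 0.\<close>

lemma measurable_outward_normal [measurable]: "outward_normal \<Omega> \<in> borel_measurable borel"
proof -
  let ?S = "smooth_boundary_points \<Omega>"
  have "continuous_on ?S (outward_normal \<Omega>)"
    unfolding continuous_on_eq_continuous_within
  proof
    fix p assume p: "p \<in> ?S"
    then obtain U G where U: "open U" "p \<in> U" "continuous_on U G" "\<And>x. x \<in> U \<Longrightarrow> G x \<noteq> 0"
      "\<And>x. x \<in> U \<Longrightarrow> x \<in> frontier \<Omega> \<Longrightarrow> outward_normal \<Omega> x = G x /\<^sub>R norm (G x)"
      by (rule smooth_boundary_pointsE) blast
    have "continuous_on U (\<lambda>x. G x /\<^sub>R norm (G x))"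
      using U by (intro continuous_intros) auto
    then have "continuous (at p within ?S) (\<lambda>x. G x /\<^sub>R norm (G x))"
      using U continuous_on_eq_continuous_at continuous_at_imp_continuous_within by blast
    moreover have "\<forall>\<^sub>F x in at p within ?S. outward_normal \<Omega> x = G x /\<^sub>R norm (G x)"
      unfolding eventually_at_topological using U by (intro exI[of _ U]) (auto simp: smooth_boundary_points_def)
    moreover have "outward_normal \<Omega> p = G p /\<^sub>R norm (G p)" using U p by (auto simp: smooth_boundary_points_def)
    ultimately show "continuous (at p within ?S) (outward_normal \<Omega>)"
      unfolding continuous_within by (simp add: tendsto_cong)
  qed
  then have "(\<lambda>x. indicator ?S x *\<^sub>R outward_normal \<Omega> x) \<in> borel_measurable borel"
    by (intro borel_measurable_continuous_on_indicator borel_smooth_boundary_points)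
  moreover have "(\<lambda>x. indicator ?S x *\<^sub>R outward_normal \<Omega> x) = outward_normal \<Omega>"
    by (auto simp: fun_eq_iff indicator_def outward_normal_def)
  ultimately show ?thesis by simp
qed

section \<open>Monotonicity along a cone at smooth points\<close>

lemma normalize_diff_le:
  fixes a b :: "'a::real_normed_vector"
  assumes "a \<noteq> 0" "b \<noteq> 0"
  shows "norm (a /\<^sub>R norm a - b /\<^sub>R norm b) \<le> 2 * norm (a - b) / norm b"
proof -
  \<comment> \<open>After multiplication by \<open>norm b\<close>, only \<open>a\<close> is
    rescaled, to the length of \<open>b\<close>. That moves it by the difference of the two lengths,
    and another \<open>norm (a - b)\<close> comes from the triangle inequality.\<close>
  have "norm b * norm (a /\<^sub>R norm a - b /\<^sub>R norm b) = norm ((norm b / norm a) *\<^sub>R a - b)"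
  proof -
    have "norm b *\<^sub>R (a /\<^sub>R norm a - b /\<^sub>R norm b) = (norm b / norm a) *\<^sub>R a - b"
      using assms by (simp add: scaleR_diff_right divide_inverse)
    then show ?thesis by (metis abs_norm_cancel norm_scaleR)
  qed
  also have "\<dots> \<le> norm ((norm b / norm a) *\<^sub>R a - a) + norm (a - b)"
    using norm_triangle_ineq[of "(norm b / norm a) *\<^sub>R a - a" "a - b"] by simp
  also have "(norm b / norm a) *\<^sub>R a - a = ((norm b - norm a) / norm a) *\<^sub>R a"
    using assms by (simp add: diff_divide_distrib scaleR_diff_left)
  also have "norm \<dots> = \<bar>norm b - norm a\<bar>" using assms by simp
  also have "\<dots> \<le> norm (a - b)" by (metis norm_minus_commute norm_triangle_ineq3)
  finally show ?thesis using assms by (simp add: field_simps)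
qed

text \<open>With \<nu> the normal at \<open>p\<close>, the mean value theorem shows that
  \<open>r\<close> increases strictly from \<open>x\<close> to \<open>y\<close> whenever
  \<open>y - x\<close> lies in the cone. As \<open>r y \<le> 0\<close> on the closure,
  \<open>r x\<close> is negative.\<close>

lemma smooth_point_cone:
  fixes \<Omega> :: "'a::euclidean_space set"
  assumes p: "p \<in> smooth_boundary_points \<Omega>" and \<epsilon>: "0 < \<epsilon>"
  obtains \<nu> R where "norm \<nu> = 1" "0 < R"
    "\<And>x y. x \<in> ball p R \<Longrightarrow> y \<in> ball p R \<Longrightarrow> x \<noteq> y \<Longrightarrow>
      \<epsilon> * norm (y - x) \<le> (y - x) \<bullet> \<nu> \<Longrightarrow> y \<in> closure \<Omega> \<Longrightarrow> x \<in> interior \<Omega>"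
    "\<And>x. x \<in> frontier \<Omega> \<Longrightarrow> x \<in> ball p R \<Longrightarrow> norm (outward_normal \<Omega> x - \<nu>) \<le> \<epsilon>"
proof -
  obtain U r G where U: "open U" "p \<in> U" and contG: "continuous_on U G"
    and der: "\<And>x. x \<in> U \<Longrightarrow> (r has_derivative (\<lambda>h. G x \<bullet> h)) (at x)" and G0: "\<And>x. x \<in> U \<Longrightarrow> G x \<noteq> 0"
    and neg: "\<And>x. x \<in> U \<Longrightarrow> r x < 0 \<Longrightarrow> x \<in> interior \<Omega>" and pos: "\<And>x. x \<in> U \<Longrightarrow> r x > 0 \<Longrightarrow> x \<notin> closure \<Omega>"
    and nor: "\<And>x. x \<in> U \<Longrightarrow> x \<in> frontier \<Omega> \<Longrightarrow> outward_normal \<Omega> x = G x /\<^sub>R norm (G x)"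
    using p by (rule smooth_boundary_pointsE) blast
  define \<gamma> where "\<gamma> = norm (G p)"
  have \<gamma>: "0 < \<gamma>" using G0[OF U(2)] by (simp add: \<gamma>_def)
  define \<nu> where "\<nu> = G p /\<^sub>R \<gamma>"
  have nu: "norm \<nu> = 1" using \<gamma> by (simp add: \<nu>_def \<gamma>_def)
  obtain R0 where R0: "0 < R0" "ball p R0 \<subseteq> U" using U openE by blast
  have "continuous (at p) G" using contG U continuous_on_eq_continuous_at by blast
  moreover have "0 < \<epsilon> * \<gamma> / 2" using \<epsilon> \<gamma> by simp
  \<comment> \<open>Half of \<open>\<epsilon> * \<gamma>\<close> serves both conclusions: it leaves
    half of the growth \<open>\<gamma> * \<epsilon> * norm (y - x)\<close> guaranteed by the
    gradient at \<open>p\<close>, and it cancels the factor 2 in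
    \<open>normalize_diff_le\<close>.\<close>
  ultimately obtain R1 where R1: "0 < R1" "\<And>x. dist x p < R1 \<Longrightarrow> dist (G x) (G p) < \<epsilon> * \<gamma> / 2"
    unfolding continuous_at_eps_delta by metis
  define R where "R = min R0 R1"
  have RU: "x \<in> U" and RG: "norm (G x - G p) \<le> \<epsilon> * \<gamma> / 2" if "x \<in> ball p R" for x
    using that R0(2) R1(2)[of x] by (auto simp: R_def dist_norm norm_minus_commute less_imp_le)
  show thesis
  proof (rule that[OF nu])
    show "0 < R" using R0 R1 by (simp add: R_def)
    fix x assume x: "x \<in> ball p R"
    {
      assume "x \<in> frontier \<Omega>"
      then have "norm (outward_normal \<Omega> x - \<nu>) \<le> 2 * norm (G x - G p) / \<gamma>"
        using normalize_diff_le[OF G0[OF RU[OF x]] G0[OF U(2)]] nor[OF RU[OF x]] by (simp add: \<nu>_def \<gamma>_def)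
      also have "\<dots> \<le> \<epsilon>" using RG[OF x] \<gamma> by (simp add: field_simps)
      finally show "norm (outward_normal \<Omega> x - \<nu>) \<le> \<epsilon>" .
    next
      fix y assume y: "y \<in> ball p R" "x \<noteq> y" and cone: "\<epsilon> * norm (y - x) \<le> (y - x) \<bullet> \<nu>" and cl: "y \<in> closure \<Omega>"
      have seg: "x + t *\<^sub>R (y - x) \<in> ball p R" if "0 \<le> t" "t \<le> 1" for t
      proof -
        have "(1 - t) *\<^sub>R x + t *\<^sub>R y \<in> ball p R" using x y that by (intro convexD[OF convex_ball]) auto
        then show ?thesis by (simp add: algebra_simps)
      qed
      have "\<exists>t>0. t < 1 \<and> r (x + 1 *\<^sub>R (y - x)) - r (x + 0 *\<^sub>R (y - x)) = (1 - 0) * (G (x + t *\<^sub>R (y - x)) \<bullet> (y - x))"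
        by (rule MVT2) (use seg RU der in \<open>auto intro!: has_derivative_along_line\<close>)
      then obtain t where t: "0 < t" "t < 1" "r y - r x = G (x + t *\<^sub>R (y - x)) \<bullet> (y - x)" by auto
      let ?z = "x + t *\<^sub>R (y - x)"
      have "\<bar>(G ?z - G p) \<bullet> (y - x)\<bar> \<le> norm (G ?z - G p) * norm (y - x)" by (rule Cauchy_Schwarz_ineq2)
      also have "\<dots> \<le> \<epsilon> * \<gamma> / 2 * norm (y - x)" using RG[OF seg, of t] t by (intro mult_right_mono) auto
      finally have 1: "- (\<epsilon> * \<gamma> / 2 * norm (y - x)) \<le> (G ?z - G p) \<bullet> (y - x)" by (simp add: abs_le_iff)
      have "G p \<bullet> (y - x) = \<gamma> * ((y - x) \<bullet> \<nu>)" using \<gamma> by (simp add: \<nu>_def inner_commute)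
      also have "\<gamma> * (\<epsilon> * norm (y - x)) \<le> \<dots>" using cone \<gamma> by (intro mult_left_mono) auto
      finally have "\<gamma> * (\<epsilon> * norm (y - x)) \<le> G p \<bullet> (y - x)" .
      moreover have "0 < \<gamma> * (\<epsilon> * norm (y - x))" using \<gamma> \<epsilon> y by simp
      ultimately have "0 < r y - r x" using 1 unfolding t(3) by (simp add: inner_diff_left algebra_simps)
      moreover have "r y \<le> 0" using pos[OF RU[OF y(1)]] cl by force
      ultimately show "x \<in> interior \<Omega>" using neg[OF RU[OF x]] by linarith
    }
  qed
qed

section \<open>The first-order expansion\<close>

locale smooth_region = thin_boundary \<Omega> for \<Omega> :: "(real ^ 'n) set" +
  assumes nonsmooth: "hausdorff_outer (CARD('n) - 1) (frontier \<Omega> - smooth_boundary_points \<Omega>) = 0"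
begin

abbreviation area :: "(real ^ 'n) measure" where
  "area \<equiv> hausdorff_measure (CARD('n) - 1)"

definition vflux :: "(real ^ 'n \<Rightarrow> real) \<Rightarrow> real ^ 'n" where
  "vflux f = (LINT x:frontier \<Omega>|area. f x *\<^sub>R outward_normal \<Omega> x)"

section \<open>Surface integrals of continuous functions\<close>

lemma area_frontier: "emeasure area (frontier \<Omega>) < top"
  using fin by (subst emeasure_hausdorff_measure) auto

lemma area_subset:
  assumes "S \<subseteq> frontier \<Omega>" "S \<in> sets borel"
  shows "emeasure area S = ennreal (measure area S)"
proof -
  have "emeasure area S \<le> emeasure area (frontier \<Omega>)" using assms by (intro emeasure_mono) auto
  also have "\<dots> < top" by (rule area_frontier)
  finally show ?thesis by (simp add: emeasure_eq_ennreal_measure)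
qed

lemma borel_area: "g \<in> borel_measurable borel \<Longrightarrow> g \<in> borel_measurable area"
  by (subst measurable_cong_sets[OF sets_hausdorff_measure refl])

lemma integrable_area:
  fixes g :: "real ^ 'n \<Rightarrow> 'b::{banach, second_countable_topology}"
  assumes "g \<in> borel_measurable borel" "\<And>x. x \<in> frontier \<Omega> \<Longrightarrow> norm (g x) \<le> B"
  shows "integrable area (\<lambda>x. indicator (frontier \<Omega>) x *\<^sub>R g x)"
  using assms area_frontier
  by (intro integrableI_bounded_set_indicator[of _ _ _ B]) (auto intro: borel_area)

lemma continuous_bounded_frontier:
  assumes "continuous_on UNIV f"
  obtains B :: real where "\<And>x. x \<in> frontier \<Omega> \<Longrightarrow> \<bar>f x\<bar> \<le> B"
proof -
  have "compact (f ` frontier \<Omega>)"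
    by (intro compact_continuous_image compact_frontier continuous_on_subset[OF assms]) auto
  then have "bounded (f ` frontier \<Omega>)" by (rule compact_imp_bounded)
  then show thesis using that unfolding bounded_real by blast
qed

lemma integrable_flux:
  fixes f :: "real ^ 'n \<Rightarrow> real"
  assumes "continuous_on UNIV f"
  shows "integrable area (\<lambda>x. indicator (frontier \<Omega>) x *\<^sub>R f x)"
    and "integrable area (\<lambda>x. indicator (frontier \<Omega>) x *\<^sub>R (f x *\<^sub>R outward_normal \<Omega> x))"
proof -
  obtain B where B: "\<And>x. x \<in> frontier \<Omega> \<Longrightarrow> \<bar>f x\<bar> \<le> B" using continuous_bounded_frontier[OF assms] by blast
  have [measurable]: "f \<in> borel_measurable borel" by (rule borel_measurable_continuous_onI[OF assms])
  show "integrable area (\<lambda>x. indicator (frontier \<Omega>) x *\<^sub>R f x)"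
    by (rule integrable_area[of _ B]) (use B in auto)
  show "integrable area (\<lambda>x. indicator (frontier \<Omega>) x *\<^sub>R (f x *\<^sub>R outward_normal \<Omega> x))"
  proof (rule integrable_area[of _ B])
    fix x assume "x \<in> frontier \<Omega>"
    then have "norm (f x *\<^sub>R outward_normal \<Omega> x) \<le> B * 1"
      unfolding norm_scaleR real_norm_def
      by (intro mult_mono B norm_outward_normal_le order_trans[OF abs_ge_zero B]) auto
    then show "norm (f x *\<^sub>R outward_normal \<Omega> x) \<le> B" by simp
  qed measurable
qed

lemma flux_le:
  assumes f: "continuous_on UNIV f" and S: "S \<subseteq> frontier \<Omega>" "S \<in> sets borel"
    and M: "\<And>x. x \<in> S \<Longrightarrow> f x \<le> M" "\<And>x. x \<in> frontier \<Omega> \<Longrightarrow> x \<notin> S \<Longrightarrow> f x = 0"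
  shows "flux f \<le> M * measure area S"
proof -
  have "flux f \<le> (LINT x|area. M * indicator S x)"
    unfolding flux_def set_lebesgue_integral_def
  proof (rule integral_mono)
    show "integrable area (\<lambda>x. M * indicator S x)"
      using S area_subset[OF S] by (intro integrable_mult_right integrable_real_indicator) auto
    fix x show "indicator (frontier \<Omega>) x *\<^sub>R f x \<le> M * indicator S x"
      using M(1)[of x] M(2)[of x] S by (auto simp: indicator_def)
  qed (rule integrable_flux[OF f])
  then show ?thesis using S by simp
qed

text \<open>If the normals on the support of \<open>f\<close> are within \<epsilon> of \<nu>, the
  vector integral may be replaced by the scalar one times \<nu>, with an error proportional to the
  scalar integral.\<close>

lemma norm_vflux_diff_le:
  assumes f: "continuous_on UNIV f" "\<And>x. 0 \<le> f x"
    and n: "\<And>x. x \<in> frontier \<Omega> \<Longrightarrow> f x \<noteq> 0 \<Longrightarrow> norm (outward_normal \<Omega> x - \<nu>) \<le> \<epsilon>"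
  shows "norm (vflux f - flux f *\<^sub>R \<nu>) \<le> \<epsilon> * flux f"
proof -
  let ?i = "\<lambda>x. indicator (frontier \<Omega>) x *\<^sub>R f x"
  let ?j = "\<lambda>x. indicator (frontier \<Omega>) x *\<^sub>R (f x *\<^sub>R outward_normal \<Omega> x)"
  have "flux f *\<^sub>R \<nu> = (LINT x|area. ?i x *\<^sub>R \<nu>)"
    unfolding flux_def set_lebesgue_integral_def by (rule integral_scaleR_left[symmetric]) (rule integrable_flux[OF f(1)])
  then have "vflux f - flux f *\<^sub>R \<nu> = (LINT x|area. ?j x - ?i x *\<^sub>R \<nu>)"
    unfolding vflux_def set_lebesgue_integral_def using integrable_flux[OF f(1)]
    by (subst Bochner_Integration.integral_diff) auto
  also have "norm \<dots> \<le> (LINT x|area. norm (?j x - ?i x *\<^sub>R \<nu>))" by (rule integral_norm_bound)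
  also have "\<dots> \<le> (LINT x|area. \<epsilon> * ?i x)"
  proof (rule integral_mono)
    show "integrable area (\<lambda>x. norm (?j x - ?i x *\<^sub>R \<nu>))" "integrable area (\<lambda>x. \<epsilon> * ?i x)"
      using integrable_flux[OF f(1)] by (auto intro!: integrable_norm Bochner_Integration.integrable_diff integrable_scaleR_left)
    fix x
    show "norm (?j x - ?i x *\<^sub>R \<nu>) \<le> \<epsilon> * ?i x"
    proof (cases "x \<in> frontier \<Omega> \<and> f x \<noteq> 0")
      case True
      have "norm (f x *\<^sub>R (outward_normal \<Omega> x - \<nu>)) \<le> f x * \<epsilon>"
        unfolding norm_scaleR using True n[of x] f(2)[of x] by (simp add: mult_left_mono)
      then show ?thesis using True by (simp add: scaleR_diff_right mult.commute)
    qed (auto simp: indicator_def)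
  qed
  also have "\<dots> = \<epsilon> * flux f" unfolding flux_def set_lebesgue_integral_def by simp
  finally show ?thesis .
qed

lemma norm_vflux_le:
  assumes f: "continuous_on UNIV f" "\<And>x. 0 \<le> f x"
  shows "norm (vflux f) \<le> flux f"
  \<comment> \<open>Comparing with the zero vector and \<epsilon> equal to 1 turns the estimate into
    the triangle inequality for integrals.\<close>
  using norm_vflux_diff_le[OF f, where \<nu> = 0 and \<epsilon> = 1, simplified, OF norm_outward_normal_le] by simp

lemma flux_nonneg: "continuous_on UNIV f \<Longrightarrow> (\<And>x. 0 \<le> f x) \<Longrightarrow> 0 \<le> flux f"
  by (meson norm_ge_zero norm_vflux_le order_trans)

text \<open>The main error is a multiple of \<open>flux f\<close> rather than of a bound on
  \<open>f\<close>, so it adds up over a partition. The radius is fixed before \<open>f\<close>,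
  because the partition functions are constructed from the radii. The factor
  \<open>CARD('n) + 2\<close> collects 2 from oblique shifts, \<open>CARD('n) - 1\<close> from the
  projection and 1 from the variation of the normal.\<close>

definition local_bound :: "real \<Rightarrow> real \<Rightarrow> real ^ 'n \<Rightarrow> real \<Rightarrow> bool" where
  "local_bound c \<epsilon> p r \<longleftrightarrow> 0 < r \<and>
    (\<forall>f. continuous_on UNIV f \<longrightarrow> (\<forall>x. 0 \<le> f x) \<longrightarrow> (\<forall>x. x \<notin> ball p r \<longrightarrow> f x = 0) \<longrightarrow>
      (\<forall>\<eta>>0. \<forall>\<^sub>F \<delta> in nhds 0. \<bar>shift_diff f \<delta> + (vflux f \<bullet> \<delta>) / c\<bar>
        \<le> (real (CARD('n) + 2) * \<epsilon> * flux f / c + \<eta>) * norm \<delta>))"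

lemma local_expansion:
  assumes c: "0 < c" "\<And>\<nu> :: real ^ 'n. norm \<nu> = 1 \<Longrightarrow> hausdorff_ratio c \<nu>"
    and p: "p \<in> smooth_boundary_points \<Omega>" and \<epsilon>: "0 < \<epsilon>" "\<epsilon> \<le> 1 / 2"
  shows "\<exists>r. local_bound c \<epsilon> p r"
proof -
  obtain \<nu> R where \<nu>: "norm \<nu> = 1" and R: "0 < R"
    and cone: "\<And>x y. x \<in> ball p R \<Longrightarrow> y \<in> ball p R \<Longrightarrow> x \<noteq> y \<Longrightarrow>
      \<epsilon> * norm (y - x) \<le> (y - x) \<bullet> \<nu> \<Longrightarrow> y \<in> closure \<Omega> \<Longrightarrow> x \<in> interior \<Omega>"
    and nor: "\<And>x. x \<in> frontier \<Omega> \<Longrightarrow> x \<in> ball p R \<Longrightarrow> norm (outward_normal \<Omega> x - \<nu>) \<le> \<epsilon>"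
    by (rule smooth_point_cone[OF p \<epsilon>(1)]) blast
  define r where "r = R / 4"
  have r: "0 < r" "R = 4 * r" using R by (auto simp: r_def)
  show ?thesis
    unfolding local_bound_def
  proof (intro exI[of _ r] conjI allI impI r(1))
    fix f :: "real ^ 'n \<Rightarrow> real" and \<eta> :: real
    assume f: "continuous_on UNIV f" "\<forall>x. 0 \<le> f x" "\<forall>x. x \<notin> ball p r \<longrightarrow> f x = 0" and \<eta>: "0 < \<eta>"
    let ?I = "flux f" and ?d = "CARD('n) - 1"
    obtain J where J: "0 \<le> J" "c * J \<le> ?I" "(1 - \<epsilon>) ^ ?d * ?I \<le> c * J"
      and lim: "\<And>\<eta>. 0 < \<eta> \<Longrightarrow> \<exists>\<rho>>0. \<forall>\<delta>. norm \<delta> < \<rho> \<longrightarrow> \<bar>shift_diff f \<delta> + (\<delta> \<bullet> \<nu>) * J\<bar> \<le> (2 * \<epsilon> * J + \<eta>) * norm \<delta>"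
    proof (rule local_flux[OF \<nu> \<epsilon> r(1) _ f(1) _ _ c(1) c(2)[OF \<nu>]])
      show "x \<in> interior \<Omega>" if "x \<in> ball p (4 * r)" "y \<in> ball p (4 * r)" "x \<noteq> y"
        "\<epsilon> * norm (y - x) \<le> (y - x) \<bullet> \<nu>" "y \<in> closure \<Omega>" for x y
        using cone[of x y] that r by simp
    qed (use f in auto)
    have I0: "0 \<le> ?I" using f by (intro flux_nonneg) auto
    \<comment> \<open>Bernoulli's inequality turns the power of \<open>1 - \<epsilon>\<close> into
      an error linear in \<epsilon>.\<close>
    have "1 + real ?d * (- \<epsilon>) \<le> (1 + (- \<epsilon>)) ^ ?d" by (rule Bernoulli_inequality) (use \<epsilon> in auto)
    then have "(1 - real ?d * \<epsilon>) * ?I \<le> (1 - \<epsilon>) ^ ?d * ?I" using I0 by (intro mult_right_mono) auto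
    then have "?I - c * J \<le> real ?d * \<epsilon> * ?I" using J by (simp add: algebra_simps)
    then have "(?I - c * J) / c \<le> real ?d * \<epsilon> * ?I / c" using c(1) by (simp add: divide_right_mono)
    then have dev: "?I / c - J \<le> real ?d * \<epsilon> * ?I / c" using c(1) by (simp add: diff_divide_distrib)
    have dev0: "J \<le> ?I / c" using J(2) c(1) by (simp add: field_simps)
    have nv: "norm (vflux f - ?I *\<^sub>R \<nu>) \<le> \<epsilon> * ?I"
    proof (rule norm_vflux_diff_le)
      fix x assume "x \<in> frontier \<Omega>" "f x \<noteq> 0"
      moreover have "x \<in> ball p r" using f(3) \<open>f x \<noteq> 0\<close> by blast
      ultimately show "norm (outward_normal \<Omega> x - \<nu>) \<le> \<epsilon>" using nor[of x] r by simp
    qed (use f in auto)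
    obtain \<rho> where \<rho>: "0 < \<rho>" "\<And>\<delta>. norm \<delta> < \<rho> \<Longrightarrow> \<bar>shift_diff f \<delta> + (\<delta> \<bullet> \<nu>) * J\<bar> \<le> (2 * \<epsilon> * J + \<eta>) * norm \<delta>"
      using lim[OF \<eta>] by blast
    have "\<bar>shift_diff f \<delta> + (vflux f \<bullet> \<delta>) / c\<bar> \<le> (real (CARD('n) + 2) * \<epsilon> * ?I / c + \<eta>) * norm \<delta>" if "norm \<delta> < \<rho>" for \<delta>
    proof -
      have "\<bar>(\<delta> \<bullet> \<nu>) * (?I / c - J)\<bar> \<le> norm \<delta> * (real ?d * \<epsilon> * ?I / c)"
        unfolding abs_mult using Cauchy_Schwarz_ineq2[of \<delta> \<nu>] \<nu> dev dev0 by (intro mult_mono) auto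
      moreover have "\<bar>((vflux f - ?I *\<^sub>R \<nu>) \<bullet> \<delta>) / c\<bar> \<le> (\<epsilon> * ?I) * norm \<delta> / c"
      proof -
        have "\<bar>(vflux f - ?I *\<^sub>R \<nu>) \<bullet> \<delta>\<bar> \<le> norm (vflux f - ?I *\<^sub>R \<nu>) * norm \<delta>" by (rule Cauchy_Schwarz_ineq2)
        also have "\<dots> \<le> (\<epsilon> * ?I) * norm \<delta>" using nv by (intro mult_right_mono) auto
        finally show ?thesis using c(1) by (simp add: divide_right_mono)
      qed
      moreover have "(2 * \<epsilon> * J + \<eta>) * norm \<delta> \<le> (2 * \<epsilon> * (?I / c) + \<eta>) * norm \<delta>"
        using dev0 \<epsilon> by (intro mult_right_mono add_right_mono mult_left_mono) auto
      \<comment> \<open>The three summands are the local shift error, the gap between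
        \<open>J\<close> and the surface integral divided by \<open>c\<close>, and the deviation of
        the normals from \<nu>.\<close>
      moreover have "shift_diff f \<delta> + (vflux f \<bullet> \<delta>) / c
        = (shift_diff f \<delta> + (\<delta> \<bullet> \<nu>) * J) + (\<delta> \<bullet> \<nu>) * (?I / c - J) + ((vflux f - ?I *\<^sub>R \<nu>) \<bullet> \<delta>) / c"
        using c(1) by (simp add: inner_diff_left inner_commute algebra_simps diff_divide_distrib)
      ultimately have "\<bar>shift_diff f \<delta> + (vflux f \<bullet> \<delta>) / c\<bar>
        \<le> (2 * \<epsilon> * (?I / c) + \<eta>) * norm \<delta> + norm \<delta> * (real ?d * \<epsilon> * ?I / c) + (\<epsilon> * ?I) * norm \<delta> / c"
        using \<rho>(2)[OF that] by linarith
      also have "\<dots> = ((real ?d + 3) * \<epsilon> * ?I / c + \<eta>) * norm \<delta>"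
        using c(1) by (simp add: field_simps)
      also have "real ?d + 3 = real (CARD('n) + 2)" by (simp add: Suc_leI)
      finally show ?thesis .
    qed
    then show "\<forall>\<^sub>F \<delta> in nhds 0. \<bar>shift_diff f \<delta> + (vflux f \<bullet> \<delta>) / c\<bar>
      \<le> (real (CARD('n) + 2) * \<epsilon> * flux f / c + \<eta>) * norm \<delta>"
      unfolding eventually_nhds_metric using \<rho>(1) by (auto intro!: exI[of _ \<rho>])
  qed
qed

text \<open>The closed neighbourhoods of the edges and corners within the frontier decrease to a
  compact null set. Since the frontier has finite area, continuity from above makes their areas tend
  to 0.\<close>

lemma nonsmooth_neighbourhood:
  assumes "0 < \<tau>"
  obtains e S where "0 < e" "compact S" "S \<subseteq> frontier \<Omega>" "measure area S \<le> \<tau>"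
    "\<And>x y. x \<in> frontier \<Omega> - smooth_boundary_points \<Omega> \<Longrightarrow> y \<in> frontier \<Omega> \<Longrightarrow> dist x y \<le> e \<Longrightarrow> y \<in> S"
proof -
  let ?N = "frontier \<Omega> - smooth_boundary_points \<Omega>"
  have N: "compact ?N"
  proof -
    have "frontier \<Omega> \<inter> ?N = ?N" by blast
    then show ?thesis using compact_Int_closed[OF compact_frontier closed_nonsmooth[of \<Omega>]] by simp
  qed
  \<comment> \<open>The neighbourhood is written as a sum with a closed ball because sums of compact
    sets are compact.\<close>
  define S where "S k = frontier \<Omega> \<inter> (\<Union>x\<in>?N. \<Union>y\<in>cball 0 (1 / real (Suc k)). {x + y})" for k
  have S_iff: "y \<in> S k \<longleftrightarrow> y \<in> frontier \<Omega> \<and> (\<exists>x\<in>?N. dist x y \<le> 1 / real (Suc k))" for y k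
  proof -
    have "(\<exists>x\<in>?N. dist x y \<le> 1 / real (Suc k)) \<longleftrightarrow> (\<exists>x\<in>?N. \<exists>z\<in>cball 0 (1 / real (Suc k)). y = x + z)"
    proof
      assume "\<exists>x\<in>?N. dist x y \<le> 1 / real (Suc k)"
      then obtain x where x: "x \<in> ?N" "dist x y \<le> 1 / real (Suc k)" by blast
      then have "y - x \<in> cball 0 (1 / real (Suc k))" by (simp add: dist_norm norm_minus_commute)
      moreover have "y = x + (y - x)" by simp
      ultimately show "\<exists>x\<in>?N. \<exists>z\<in>cball 0 (1 / real (Suc k)). y = x + z" using x(1) by blast
    next
      assume "\<exists>x\<in>?N. \<exists>z\<in>cball 0 (1 / real (Suc k)). y = x + z"
      then obtain x z where "x \<in> ?N" "norm z \<le> 1 / real (Suc k)" "y = x + z" by auto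
      then show "\<exists>x\<in>?N. dist x y \<le> 1 / real (Suc k)" by (intro bexI[of _ x]) (auto simp: dist_norm)
    qed
    then show ?thesis unfolding S_def by auto
  qed
  have Sc: "compact (S k)" for k
    unfolding S_def using N by (intro closed_Int_compact compact_sums') auto
  have dec: "decseq S"
  proof (rule decseq_SucI)
    fix k
    have le: "1 / real (Suc (Suc k)) \<le> 1 / real (Suc k)" by (simp add: frac_le)
    show "S (Suc k) \<subseteq> S k"
    proof
      fix y assume "y \<in> S (Suc k)"
      then obtain x where "y \<in> frontier \<Omega>" "x \<in> ?N" "dist x y \<le> 1 / real (Suc (Suc k))"
        unfolding S_iff by blast
      moreover have "dist x y \<le> 1 / real (Suc k)" using le calculation(3) by linarith
      ultimately show "y \<in> S k" unfolding S_iff by blast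
    qed
  qed
  have inter: "(\<Inter>k. S k) = ?N"
  proof
    show "?N \<subseteq> (\<Inter>k. S k)"
    proof
      fix y assume y: "y \<in> ?N"
      have "dist y y \<le> 1 / real (Suc k)" for k by simp
      then show "y \<in> (\<Inter>k. S k)" using y S_iff by blast
    qed
    show "(\<Inter>k. S k) \<subseteq> ?N"
    proof
      fix y assume y: "y \<in> (\<Inter>k. S k)"
      have "\<exists>x\<in>?N. dist x y < e" if "e > 0" for e
      proof -
        obtain k where "1 / real (Suc k) < e" using nat_approx_posE[OF \<open>e > 0\<close>] by blast
        moreover obtain x where "x \<in> ?N" "dist x y \<le> 1 / real (Suc k)" using y S_iff by blast
        ultimately show ?thesis by force
      qed
      then have "y \<in> closure ?N" unfolding closure_approachable by blast
      then show "y \<in> ?N" by (simp only: closure_closed[OF closed_nonsmooth])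
    qed
  qed
  have Ssub: "S k \<subseteq> frontier \<Omega>" for k by (auto simp: S_def)
  have Sb: "S k \<in> sets borel" for k using Sc borel_compact by blast
  have "(\<lambda>k. emeasure area (S k)) \<longlonglongrightarrow> emeasure area (\<Inter>k. S k)"
    using dec Sb area_subset[OF Ssub Sb] by (intro Lim_emeasure_decseq) auto
  also have "emeasure area (\<Inter>k. S k) = 0"
    unfolding inter using nonsmooth borel_compact[OF N] by (simp add: emeasure_hausdorff_measure)
  finally have "(\<lambda>k. ennreal (measure area (S k))) \<longlonglongrightarrow> ennreal 0"
    unfolding area_subset[OF Ssub Sb] by (simp only: ennreal_0)
  then have "(\<lambda>k. measure area (S k)) \<longlonglongrightarrow> 0" by (rule tendsto_ennrealD) auto
  then have "\<forall>\<^sub>F k in sequentially. measure area (S k) < \<tau>" using assms by (rule order_tendstoD)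
  then obtain k where k: "measure area (S k) < \<tau>" using eventually_happens' trivial_limit_sequentially by blast
  show thesis
    by (rule that[of "1 / real (Suc k)" "S k"]) (use Sc Ssub k S_iff in auto)
qed

section \<open>Patching the local estimates\<close>

lemma shift_diff_sum:
  assumes "finite C" "\<And>U. U \<in> C \<Longrightarrow> continuous_on UNIV (g U)"
  shows "shift_diff (\<lambda>x. \<Sum>U\<in>C. g U x) \<delta> = (\<Sum>U\<in>C. shift_diff (g U) \<delta>)"
    and "flux (\<lambda>x. \<Sum>U\<in>C. g U x) = (\<Sum>U\<in>C. flux (g U))"
    and "vflux (\<lambda>x. \<Sum>U\<in>C. g U x) = (\<Sum>U\<in>C. vflux (g U))"
proof -
  show "shift_diff (\<lambda>x. \<Sum>U\<in>C. g U x) \<delta> = (\<Sum>U\<in>C. shift_diff (g U) \<delta>)"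
    unfolding shift_diff_def sum_distrib_right
    by (rule Bochner_Integration.integral_sum) (intro integrable_shift_diff assms)
  show "flux (\<lambda>x. \<Sum>U\<in>C. g U x) = (\<Sum>U\<in>C. flux (g U))"
    unfolding flux_def set_lebesgue_integral_def scaleR_sum_right
    by (rule Bochner_Integration.integral_sum) (intro integrable_flux assms)
  show "vflux (\<lambda>x. \<Sum>U\<in>C. g U x) = (\<Sum>U\<in>C. vflux (g U))"
    unfolding vflux_def set_lebesgue_integral_def scaleR_sum_left scaleR_sum_right
    by (rule Bochner_Integration.integral_sum) (intro integrable_flux assms)
qed

lemma shift_diff_minus:
  assumes f: "continuous_on UNIV f" and g: "continuous_on UNIV g"
  shows "shift_diff (\<lambda>x. f x - g x) \<delta> = shift_diff f \<delta> - shift_diff g \<delta>"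
    and "vflux (\<lambda>x. f x - g x) = vflux f - vflux g"
proof -
  show "shift_diff (\<lambda>x. f x - g x) \<delta> = shift_diff f \<delta> - shift_diff g \<delta>"
    unfolding shift_diff_def left_diff_distrib[of "f _" "g _"]
    by (rule Bochner_Integration.integral_diff) (intro integrable_shift_diff f g)+
  show "vflux (\<lambda>x. f x - g x) = vflux f - vflux g"
    unfolding vflux_def set_lebesgue_integral_def scaleR_diff_left scaleR_diff_right
    by (rule Bochner_Integration.integral_diff) (intro integrable_flux f g)+
qed

text \<open>Compactness leaves finitely many balls to cover the frontier outside \<open>W0\<close>.
  With the complement of the frontier as a further member the whole space is covered, so the
  functions sum to 1 everywhere and split \<open>f\<close> exactly.\<close>

lemma boundary_partition:
  assumes "open W0" and "\<And>p. p \<in> frontier \<Omega> \<Longrightarrow> p \<notin> W0 \<Longrightarrow> 0 < r p"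
  obtains C \<phi> where "finite C" "W0 \<in> C" "- frontier \<Omega> \<in> C"
    "\<And>U. U \<in> C \<Longrightarrow> U = W0 \<or> U = - frontier \<Omega> \<or> (\<exists>p\<in>frontier \<Omega> - W0. U = ball p (r p))"
    "\<And>U. U \<in> C \<Longrightarrow> continuous_on UNIV (\<phi> U)" "\<And>U x. U \<in> C \<Longrightarrow> 0 \<le> \<phi> U x"
    "\<And>U x. U \<in> C \<Longrightarrow> x \<notin> U \<Longrightarrow> \<phi> U x = (0 :: real)" "\<And>x. (\<Sum>U\<in>C. \<phi> U x) = 1"
proof -
  let ?B = "\<lambda>p. ball p (r p)"
  have "compact (frontier \<Omega> - W0)" using compact_frontier assms(1) by (rule compact_diff)
  moreover have "frontier \<Omega> - W0 \<subseteq> (\<Union>p\<in>frontier \<Omega> - W0. ?B p)" using assms(2) by force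
  ultimately obtain D where D: "D \<subseteq> frontier \<Omega> - W0" "finite D" "frontier \<Omega> - W0 \<subseteq> (\<Union>p\<in>D. ?B p)"
    by (metis (no_types, lifting) compactE_image open_ball)
  define C where "C = insert W0 (insert (- frontier \<Omega>) (?B ` D))"
  have C: "finite C" "\<And>U. U \<in> C \<Longrightarrow> open U" "UNIV \<subseteq> \<Union>C"
    using D assms(1) unfolding C_def by (auto simp: open_Compl)
  obtain \<phi> :: "(real ^ 'n) set \<Rightarrow> real ^ 'n \<Rightarrow> real" where
    \<phi>: "\<And>U. U \<in> C \<Longrightarrow> continuous_on UNIV (\<phi> U) \<and> (\<forall>x\<in>UNIV. 0 \<le> \<phi> U x)"
      "\<And>x U. \<lbrakk>U \<in> C; x \<in> UNIV; x \<notin> U\<rbrakk> \<Longrightarrow> \<phi> U x = 0"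
      "\<And>x. x \<in> UNIV \<Longrightarrow> supp_sum (\<lambda>W. \<phi> W x) C = 1"
    by (rule subordinate_partition_of_unity[OF C(3) C(2)]) (use C(1) in \<open>auto intro!: exI[of _ UNIV]\<close>)
  have "(\<Sum>U\<in>C. \<phi> U x) = 1" for x
  proof -
    have "supp_sum (\<lambda>W. \<phi> W x) C = (\<Sum>U\<in>C. \<phi> U x)"
      unfolding supp_sum_def support_on_def using C(1) by (intro sum.mono_neutral_left) auto
    then show ?thesis using \<phi>(3)[of x] by simp
  qed
  then show thesis
    using \<phi>(1,2) D(1) by (intro that[of C \<phi>] C(1)) (auto simp: C_def)
qed

text \<open>Shares of \<open>f\<close> near edges and corners are small through area, shares
  vanishing on the frontier through their values, and the rest obey \<open>local_bound\<close>. Both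
  \<epsilon> and \<tau> depend only on \<eta>, \<open>c\<close>, the dimension, the size of
  \<open>f\<close> near the boundary and its area, so they are fixed before the partition; only
  \<eta>' depends on the number of pieces.\<close>

lemma expansion_nonneg:
  assumes c: "0 < c" "\<And>\<nu> :: real ^ 'n. norm \<nu> = 1 \<Longrightarrow> hausdorff_ratio c \<nu>"
    and f: "continuous_on UNIV f" "\<And>x. 0 \<le> f x" and \<eta>: "0 < \<eta>"
  shows "\<forall>\<^sub>F \<delta> in nhds 0. \<bar>shift_diff f \<delta> + (vflux f \<bullet> \<delta>) / c\<bar> \<le> \<eta> * norm \<delta>"
proof -
  let ?N = "frontier \<Omega> - smooth_boundary_points \<Omega>"
  obtain K where K: "0 < K" "\<And>(S :: (real ^ 'n) set) \<delta>. compact S \<Longrightarrow> \<delta> \<noteq> 0 \<Longrightarrow>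
      emeasure lborel (tube S \<delta>) \<le> ennreal (K * norm \<delta>) * hausdorff_outer (CARD('n) - 1) S"
    using emeasure_tube_le[where ?'a = "real ^ 'n"] by auto
  define h where "h = measure area (frontier \<Omega>)"
  have h0: "0 \<le> h" by (simp add: h_def)
  have out: "hausdorff_outer (CARD('n) - 1) S \<le> ennreal t"
    if "compact S" "S \<subseteq> frontier \<Omega>" "measure area S \<le> t" for S t
    using area_subset[OF that(2) borel_compact[OF that(1)]] borel_compact[OF that(1)] that(3)
    by (simp add: emeasure_hausdorff_measure ennreal_leI)
  obtain B where B: "frontier \<Omega> \<subseteq> ball 0 B"
    using compact_imp_bounded[OF compact_frontier] bounded_subset_ballD by blast
  obtain M0 where M0: "\<And>x. x \<in> cball 0 (B + 1) \<Longrightarrow> f x \<le> M0"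
    using compact_continuous_image[OF continuous_on_subset[OF f(1)] compact_cball, of 0 "B + 1"]
    by (metis bounded_real compact_imp_bounded image_eqI order_trans abs_ge_self subset_UNIV)
  define M where "M = max M0 1"
  have M: "0 < M" "\<And>x. x \<in> cball 0 (B + 1) \<Longrightarrow> f x \<le> M" using M0 by (auto simp: M_def le_max_iff_disj)
  have nearF: "x \<in> cball 0 (B + 1)" if "x + t *\<^sub>R \<delta> \<in> frontier \<Omega>" "0 \<le> t" "t \<le> 1" "norm \<delta> \<le> 1" for x \<delta> t
  proof -
    have "norm x \<le> norm (x + t *\<^sub>R \<delta>) + norm (t *\<^sub>R \<delta>)" by (metis add_diff_cancel_right' norm_triangle_ineq4)
    also have "norm (t *\<^sub>R \<delta>) \<le> 1" using that by (simp add: mult_le_one)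
    also have "norm (x + t *\<^sub>R \<delta>) \<le> B" using that(1) B by (auto simp: subset_iff less_imp_le)
    finally show ?thesis by simp
  qed
  \<comment> \<open>\<open>M * h\<close> bounds the surface integral of \<open>f\<close>, so the
    \<epsilon>-errors of all pieces together stay below \<open>\<eta> / 4\<close>; the added 1 keeps
    the denominator positive.\<close>
  define \<epsilon> where "\<epsilon> = min (1 / 2) (\<eta> * c / (4 * real (CARD('n) + 2) * (M * h + 1)))"
  have Mh: "0 \<le> M * h" using M(1) h0 by simp
  have "0 < \<eta> * c / (4 * real (CARD('n) + 2) * (M * h + 1))"
    using \<eta> c(1) Mh by (intro divide_pos_pos mult_pos_pos add_nonneg_pos) auto
  then have \<epsilon>: "0 < \<epsilon>" "\<epsilon> \<le> 1 / 2" unfolding \<epsilon>_def by (simp_all only: min_less_iff_conj min.cobounded1) simp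
  have \<epsilon>_small: "real (CARD('n) + 2) * \<epsilon> * (M * h) / c \<le> \<eta> / 4"
  proof -
    have "\<epsilon> \<le> \<eta> * c / (4 * real (CARD('n) + 2) * (M * h + 1))" by (simp add: \<epsilon>_def)
    then have "\<epsilon> * (4 * real (CARD('n) + 2) * (M * h + 1)) \<le> \<eta> * c"
      using Mh by (subst (asm) pos_le_divide_eq) (auto simp: add_nonneg_pos)
    moreover have "\<epsilon> * (4 * real (CARD('n) + 2) * (M * h)) \<le> \<epsilon> * (4 * real (CARD('n) + 2) * (M * h + 1))"
      using \<epsilon>(1) by (intro mult_left_mono) auto
    ultimately have "4 * (real (CARD('n) + 2) * \<epsilon> * (M * h)) \<le> \<eta> * c" by (simp add: mult_ac)
    then show ?thesis using c(1) by (simp add: field_simps)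
  qed
  \<comment> \<open>Near edges and corners the shift term costs \<open>M * K * \<tau>\<close> and
    the boundary integral \<open>M * \<tau> / c\<close> per unit of shift; \<tau> makes their sum
    \<open>\<eta> / 4\<close>.\<close>
  define q where "q = M * (K + 1 / c)"
  have q: "0 < q" unfolding q_def using M(1) K(1) c(1) by (simp add: add_pos_pos)
  define \<tau> where "\<tau> = \<eta> / (4 * q)"
  have \<tau>: "0 < \<tau>" "q * \<tau> = \<eta> / 4" using \<eta> q by (auto simp: \<tau>_def)
  obtain e S where e: "0 < e" and S: "compact S" "S \<subseteq> frontier \<Omega>" "measure area S \<le> \<tau>"
    and eS: "\<And>x y. x \<in> ?N \<Longrightarrow> y \<in> frontier \<Omega> \<Longrightarrow> dist x y \<le> e \<Longrightarrow> y \<in> S"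
    using nonsmooth_neighbourhood[OF \<tau>(1)] by metis
  \<comment> \<open>Half the radius \<open>e\<close> is kept in reserve: a point of
    \<open>W0\<close> moved by at most \<open>e / 2\<close> onto the frontier still lands in
    \<open>S\<close>.\<close>
  define W0 where "W0 = (\<Union>x\<in>?N. ball x (e / 2))"
  have "\<exists>r. local_bound c \<epsilon> p r" if "p \<in> frontier \<Omega>" "p \<notin> W0" for p
  proof -
    have "p \<in> smooth_boundary_points \<Omega>" using that e by (force simp: W0_def)
    then show ?thesis using local_expansion[OF c _ \<epsilon>, of p] by blast
  qed
  then obtain r where r: "\<And>p. p \<in> frontier \<Omega> \<Longrightarrow> p \<notin> W0 \<Longrightarrow> local_bound c \<epsilon> p (r p)" by metis
  obtain C \<phi> where C: "finite C" "W0 \<in> C" "- frontier \<Omega> \<in> C"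
    and Ccases: "\<And>U. U \<in> C \<Longrightarrow> U = W0 \<or> U = - frontier \<Omega> \<or> (\<exists>p\<in>frontier \<Omega> - W0. U = ball p (r p))"
    and \<phi>: "\<And>U. U \<in> C \<Longrightarrow> continuous_on UNIV (\<phi> U)" "\<And>U x. U \<in> C \<Longrightarrow> 0 \<le> \<phi> U x"
    "\<And>U x. U \<in> C \<Longrightarrow> x \<notin> U \<Longrightarrow> \<phi> U x = (0 :: real)" "\<And>x. (\<Sum>U\<in>C. \<phi> U x) = 1"
    by (rule boundary_partition[of W0 r]) (use r in \<open>auto simp: local_bound_def W0_def\<close>)
  define g where "g U x = f x * \<phi> U x" for U x
  have g: "continuous_on UNIV (g U)" "\<And>x. 0 \<le> g U x" "\<And>x. g U x \<le> f x" "\<And>x. x \<notin> U \<Longrightarrow> g U x = 0"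
    if "U \<in> C" for U
  proof -
    show "continuous_on UNIV (g U)" unfolding g_def using that by (intro continuous_intros f \<phi>)
    show "0 \<le> g U x" for x unfolding g_def using that f \<phi> by simp
    show "g U x = 0" if "x \<notin> U" for x unfolding g_def using \<phi>(3)[OF \<open>U \<in> C\<close> that] by simp
    fix x
    have "\<phi> U x \<le> (\<Sum>U\<in>C. \<phi> U x)" using that C(1) \<phi>(2) by (intro member_le_sum) auto
    then show "g U x \<le> f x" unfolding g_def \<phi>(4) using f(2)[of x] by (simp add: mult_left_le)
  qed
  have f_eq: "f = (\<lambda>x. \<Sum>U\<in>C. g U x)"
    unfolding g_def sum_distrib_left[symmetric] \<phi>(4) by simp
  define \<eta>' where "\<eta>' = \<eta> / (4 * real (card C))"
  have cardC: "0 < card C" using C by (simp add: card_gt_0_iff) blast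
  have \<eta>': "0 < \<eta>'" "real (card C) * \<eta>' = \<eta> / 4" using \<eta> cardC by (auto simp: \<eta>'_def)
  \<comment> \<open>The error allowed to each piece. Over \<open>C\<close> the first summands add up
    to a multiple of \<open>\<epsilon> * flux f\<close>, the second to \<open>\<eta> / 4\<close>,
    and the last occurs for \<open>W0\<close> alone, so the total is at most three quarters of
    \<eta>.\<close>
  let ?A = "\<lambda>U. real (CARD('n) + 2) * \<epsilon> * flux (g U) / c + \<eta>' + (if U = W0 then \<eta> / 4 else 0)"
  have flux0: "0 \<le> flux (g U)" if "U \<in> C" for U using g[OF that] by (intro flux_nonneg)
  have small: "\<forall>\<^sub>F \<delta> in nhds 0. \<delta> \<in> ball 0 s" if "0 < s" for s and \<delta> :: "real ^ 'n"
    using that by (intro eventually_nhds_in_open) auto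
  have each: "\<forall>\<^sub>F \<delta> in nhds 0. \<bar>shift_diff (g U) \<delta> + (vflux (g U) \<bullet> \<delta>) / c\<bar> \<le> ?A U * norm \<delta>" if U: "U \<in> C" for U
  proof -
    note gU = g[OF U]
    have A0: "0 \<le> real (CARD('n) + 2) * \<epsilon> * flux (g U) / c" using flux0[OF U] \<epsilon> c(1) by simp
    have vterm: "\<bar>(vflux (g U) \<bullet> \<delta>) / c\<bar> \<le> flux (g U) / c * norm \<delta>" for \<delta>
    proof -
      have "\<bar>vflux (g U) \<bullet> \<delta>\<bar> \<le> norm (vflux (g U)) * norm \<delta>" by (rule Cauchy_Schwarz_ineq2)
      also have "\<dots> \<le> flux (g U) * norm \<delta>" by (intro mult_right_mono norm_vflux_le gU) auto
      finally show ?thesis using c(1) by (simp add: divide_right_mono)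
    qed
    \<comment> \<open>The members of \<open>C\<close> are bare sets, and \<open>W0\<close> might
      coincide with another of them; the inequality keeps its extra allowance in one case.\<close>
    consider "U = W0" | "U = - frontier \<Omega>" "U \<noteq> W0" | p where "p \<in> frontier \<Omega>" "p \<notin> W0" "U = ball p (r p)" "U \<noteq> W0"
      using Ccases[OF U] by blast
    then show ?thesis
    proof cases
      case 1
      define s where "s = min 1 (e / 2)"
      have s: "0 < s" using e by (simp add: s_def)
      have "\<bar>shift_diff (g U) \<delta> + (vflux (g U) \<bullet> \<delta>) / c\<bar> \<le> ?A U * norm \<delta>" if "\<delta> \<in> ball 0 s" for \<delta>
      proof (cases "\<delta> = 0")
        case False
        have inS: "x + t *\<^sub>R \<delta> \<in> S" if x: "x \<in> W0" "x + t *\<^sub>R \<delta> \<in> frontier \<Omega>" "0 \<le> t" "t \<le> 1" for x t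
        proof -
          obtain n where n: "n \<in> ?N" "dist n x < e / 2" using x(1) by (auto simp: W0_def)
          have "norm (t *\<^sub>R \<delta>) \<le> norm \<delta>" using x by (simp add: mult_left_le_one_le)
          then have "dist x (x + t *\<^sub>R \<delta>) \<le> e / 2" using \<open>\<delta> \<in> ball 0 s\<close> by (simp add: s_def dist_norm)
          then have "dist n (x + t *\<^sub>R \<delta>) \<le> e" using n(2) dist_triangle[of n "x + t *\<^sub>R \<delta>" x] by linarith
          then show ?thesis using eS[OF n(1) x(2)] by blast
        qed
        have "\<bar>shift_diff (g U) \<delta>\<bar> \<le> M * K * \<tau> * norm \<delta>"
        proof (rule shift_diff_bound[OF K(2) K(1) gU(1) S(1) out[OF S]])
          fix x t assume t: "0 \<le> t" "t \<le> 1" "x + t *\<^sub>R \<delta> \<in> frontier \<Omega>" "g U x \<noteq> 0"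
          have "x \<in> W0" using t(4) gU(4) 1 by blast
          moreover have "x \<in> cball 0 (B + 1)" using nearF[OF t(3,1,2)] that by (simp add: s_def)
          ultimately show "x + t *\<^sub>R \<delta> \<in> S \<and> \<bar>g U x\<bar> \<le> M"
            using inS[of x t] t M(2)[of x] gU(2,3)[of x] by auto
        qed (use \<tau> M False in auto)
        moreover have "flux (g U) \<le> M * \<tau>"
        proof -
          have "flux (g U) \<le> M * measure area S"
          proof (rule flux_le[OF gU(1) S(2) borel_compact[OF S(1)]])
            fix x
            show "g U x \<le> M" if "x \<in> S" for x
              using gU(3)[of x] M(2)[of x] nearF[of x 0 0] that S(2) by auto
            assume "x \<in> frontier \<Omega>" "x \<notin> S"
            then have "x \<notin> W0" using inS[of x 0] by auto
            then show "g U x = 0" using gU(4) 1 by blast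
          qed
          also have "\<dots> \<le> M * \<tau>" using S(3) M(1) by simp
          finally show ?thesis .
        qed
        then have "flux (g U) / c * norm \<delta> \<le> M * \<tau> / c * norm \<delta>"
          using c(1) by (intro mult_right_mono divide_right_mono) auto
        ultimately have "\<bar>shift_diff (g U) \<delta> + (vflux (g U) \<bullet> \<delta>) / c\<bar> \<le> M * K * \<tau> * norm \<delta> + M * \<tau> / c * norm \<delta>"
          using vterm[of \<delta>] by linarith
        also have "\<dots> = q * \<tau> * norm \<delta>" by (simp add: q_def algebra_simps)
        also have "\<dots> \<le> ?A U * norm \<delta>" unfolding \<tau>(2) using A0 \<eta>' 1 by (intro mult_right_mono) auto
        finally show ?thesis .
      qed (simp add: shift_diff_def)
      then show ?thesis using small[OF s] by (rule eventually_mono[rotated])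
    next
      \<comment> \<open>This share vanishes on the frontier, so it has no boundary integral. By
        uniform continuity it is at most \<omega> at every point that a small shift carries across,
        which makes its increment of smaller order.\<close>
      case 2
      have z: "g U x = 0" if "x \<in> frontier \<Omega>" for x using gU(4)[of x] that 2 by blast
      have "vflux (g U) = (LINT x:frontier \<Omega>|area. 0)"
        unfolding vflux_def by (rule set_lebesgue_integral_cong) (auto simp: z)
      then have v0: "vflux (g U) = 0" by simp
      define \<omega> where "\<omega> = \<eta>' / (K * h + 1)"
      have Kh: "0 < K * h + 1" using K(1) h0 by (simp add: add_nonneg_pos)
      have \<omega>: "0 < \<omega>" "\<omega> * K * h \<le> \<eta>'"
        using \<eta>'(1) Kh by (auto simp: \<omega>_def field_simps)
      have "uniformly_continuous_on (cball 0 (B + 1)) (g U)"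
        by (intro compact_uniformly_continuous continuous_on_subset[OF gU(1)]) auto
      then obtain s0 where s0: "0 < s0" "\<And>x y. x \<in> cball 0 (B + 1) \<Longrightarrow> y \<in> cball 0 (B + 1) \<Longrightarrow> dist x y < s0 \<Longrightarrow> dist (g U x) (g U y) < \<omega>"
        using \<omega>(1) unfolding uniformly_continuous_on_def by metis
      define s where "s = min 1 s0"
      have s: "0 < s" using s0 by (simp add: s_def)
      have "\<bar>shift_diff (g U) \<delta> + (vflux (g U) \<bullet> \<delta>) / c\<bar> \<le> ?A U * norm \<delta>" if "\<delta> \<in> ball 0 s" for \<delta>
      proof (cases "\<delta> = 0")
        case False
        have "\<bar>shift_diff (g U) \<delta>\<bar> \<le> \<omega> * K * h * norm \<delta>"
        proof (rule shift_diff_bound[OF K(2) K(1) gU(1) compact_frontier out[OF compact_frontier order_refl]])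
          fix x t assume t: "0 \<le> t" "t \<le> 1" "x + t *\<^sub>R \<delta> \<in> frontier \<Omega>"
          have x: "x \<in> cball 0 (B + 1)" using nearF[OF t(3,1,2)] that by (simp add: s_def)
          have y: "x + t *\<^sub>R \<delta> \<in> cball 0 (B + 1)" using t(3) B by (auto simp: subset_iff)
          have "norm (t *\<^sub>R \<delta>) \<le> norm \<delta>" using t by (simp add: mult_left_le_one_le)
          then have "dist x (x + t *\<^sub>R \<delta>) < s0" using that by (simp add: s_def dist_norm)
          then have "\<bar>g U x\<bar> \<le> \<omega>" using s0(2)[OF x y] z[OF t(3)] by (simp add: dist_real_def)
          then show "x + t *\<^sub>R \<delta> \<in> frontier \<Omega> \<and> \<bar>g U x\<bar> \<le> \<omega>" using t by blast
        qed (use \<omega> False h0 in \<open>auto simp: h_def\<close>)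
        also have "\<dots> \<le> ?A U * norm \<delta>" using \<omega>(2) A0 \<eta> by (intro mult_right_mono) auto
        finally show ?thesis by (simp add: v0)
      qed (simp add: shift_diff_def)
      then show ?thesis using small[OF s] by (rule eventually_mono[rotated])
    next
      case 3
      have "\<forall>\<^sub>F \<delta> in nhds 0. \<bar>shift_diff (g U) \<delta> + (vflux (g U) \<bullet> \<delta>) / c\<bar>
          \<le> (real (CARD('n) + 2) * \<epsilon> * flux (g U) / c + \<eta>') * norm \<delta>"
        using r[OF 3(1,2)] gU \<eta>'(1) 3(3) unfolding local_bound_def by blast
      then show ?thesis using 3(4) by simp
    qed
  qed
  have "\<forall>\<^sub>F \<delta> in nhds 0. \<forall>U\<in>C. \<bar>shift_diff (g U) \<delta> + (vflux (g U) \<bullet> \<delta>) / c\<bar> \<le> ?A U * norm \<delta>"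
    using each by (intro eventually_ball_finite C) auto
  then show ?thesis
  proof eventually_elim
    fix \<delta> assume D: "\<forall>U\<in>C. \<bar>shift_diff (g U) \<delta> + (vflux (g U) \<bullet> \<delta>) / c\<bar> \<le> ?A U * norm \<delta>"
    have sums: "shift_diff f \<delta> = (\<Sum>U\<in>C. shift_diff (g U) \<delta>)" "flux f = (\<Sum>U\<in>C. flux (g U))"
      "vflux f = (\<Sum>U\<in>C. vflux (g U))"
      using shift_diff_sum[OF C(1), of g, OF g(1)] by (simp_all only: f_eq[symmetric])
    have "\<bar>shift_diff f \<delta> + (vflux f \<bullet> \<delta>) / c\<bar> = \<bar>\<Sum>U\<in>C. shift_diff (g U) \<delta> + (vflux (g U) \<bullet> \<delta>) / c\<bar>"
      unfolding sums by (simp add: sum.distrib inner_sum_left sum_divide_distrib)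
    also have "\<dots> \<le> (\<Sum>U\<in>C. \<bar>shift_diff (g U) \<delta> + (vflux (g U) \<bullet> \<delta>) / c\<bar>)" by (rule sum_abs)
    also have "\<dots> \<le> (\<Sum>U\<in>C. ?A U * norm \<delta>)" using D by (intro sum_mono) auto
    also have "\<dots> = (\<Sum>U\<in>C. ?A U) * norm \<delta>" by (rule sum_distrib_right[symmetric])
    also have "\<dots> \<le> \<eta> * norm \<delta>"
    proof (rule mult_right_mono)
      have "(\<Sum>U\<in>C. ?A U) = real (CARD('n) + 2) * \<epsilon> * flux f / c + real (card C) * \<eta>' + \<eta> / 4"
        using C by (simp add: sum.distrib sums(2) sum_distrib_left sum_divide_distrib sum.delta)
      also have "flux f \<le> M * h" unfolding h_def
      proof (rule flux_le[OF f(1)])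
        show "f x \<le> M" if "x \<in> frontier \<Omega>" for x using M(2)[of x] nearF[of x 0 0] that by auto
      qed auto
      then have "real (CARD('n) + 2) * \<epsilon> * flux f / c \<le> real (CARD('n) + 2) * \<epsilon> * (M * h) / c"
        using \<epsilon>(1) c(1) by (intro divide_right_mono mult_left_mono) auto
      finally show "(\<Sum>U\<in>C. ?A U) \<le> \<eta>" using \<epsilon>_small \<eta>'(2) \<eta> by linarith
    qed simp
    finally show "\<bar>shift_diff f \<delta> + (vflux f \<bullet> \<delta>) / c\<bar> \<le> \<eta> * norm \<delta>" .
  qed
qed

text \<open>Nonnegativity was needed to integrate the inequalities between indicators and to add up
  the errors. Both sides of the expansion are linear in \<open>f\<close>, so it extends to the
  difference of positive and negative parts.\<close>

lemma expansion:
  assumes c: "0 < c" "\<And>\<nu> :: real ^ 'n. norm \<nu> = 1 \<Longrightarrow> hausdorff_ratio c \<nu>"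
    and f: "continuous_on UNIV f" and \<eta>: "0 < \<eta>"
  shows "\<forall>\<^sub>F \<delta> in nhds 0. \<bar>shift_diff f \<delta> + (vflux f \<bullet> \<delta>) / c\<bar> \<le> \<eta> * norm \<delta>"
proof -
  let ?f1 = "\<lambda>x. max (f x) 0" and ?f2 = "\<lambda>x. max (- f x) 0"
  have cont: "continuous_on UNIV ?f1" "continuous_on UNIV ?f2" by (intro continuous_intros f)+
  have eq: "f = (\<lambda>x. ?f1 x - ?f2 x)" by (auto simp: max_def)
  have "\<forall>\<^sub>F \<delta> in nhds 0. \<bar>shift_diff ?f1 \<delta> + (vflux ?f1 \<bullet> \<delta>) / c\<bar> \<le> \<eta> / 2 * norm \<delta>"
    by (rule expansion_nonneg[OF c cont(1)]) (use \<eta> in auto)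
  moreover have "\<forall>\<^sub>F \<delta> in nhds 0. \<bar>shift_diff ?f2 \<delta> + (vflux ?f2 \<bullet> \<delta>) / c\<bar> \<le> \<eta> / 2 * norm \<delta>"
    by (rule expansion_nonneg[OF c cont(2)]) (use \<eta> in auto)
  ultimately show ?thesis
  proof eventually_elim
    case (elim \<delta>)
    have "shift_diff f \<delta> + (vflux f \<bullet> \<delta>) / c
      = (shift_diff ?f1 \<delta> + (vflux ?f1 \<bullet> \<delta>) / c) - (shift_diff ?f2 \<delta> + (vflux ?f2 \<bullet> \<delta>) / c)"
      using shift_diff_minus[OF cont] by (simp only: eq[symmetric]) (simp add: inner_diff_left diff_divide_distrib)
    then show ?case using elim by linarith
  qed
qed

text \<open>The frontier is null, so \<Omega> is Lebesgue measurable and may be replaced by its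
  interior. Translating the variable by \<delta> then moves the increment from \<open>f\<close> to
  the region.\<close>

lemma Sigma_fun_shift:
  assumes f: "continuous_on UNIV f"
  shows "Sigma_fun f \<Omega> (m + \<delta>) = (LINT x|lborel. f (x - m) * indicator (interior \<Omega>) (x + \<delta>))"
proof -
  let ?O = "interior \<Omega>"
  have [measurable]: "f \<in> borel_measurable borel" by (rule borel_measurable_continuous_onI[OF f])
  have null: "frontier \<Omega> \<in> null_sets lebesgue"
    using null_frontier by (intro null_sets_completionI null_setsI) auto
  have eqO: "\<Omega> = ?O \<union> (\<Omega> \<inter> frontier \<Omega>)"
    using interior_subset closure_subset by (auto simp: frontier_def)
  have "\<Omega> \<inter> frontier \<Omega> \<in> null_sets lebesgue" using null by (rule null_sets_completion_subset[rotated]) auto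
  then have [measurable]: "\<Omega> \<in> sets lebesgue" by (subst eqO) auto
  have [measurable]: "(\<lambda>x. f (x - (m + \<delta>))) \<in> borel_measurable lebesgue"
    by (rule measurable_completion) measurable
  have [measurable]: "?O \<in> sets lebesgue" by simp
  have ae: "AE x in lebesgue. indicator \<Omega> x *\<^sub>R f (x - (m + \<delta>)) = indicator ?O x *\<^sub>R f (x - (m + \<delta>))"
    using AE_not_in[OF null]
  proof eventually_elim
    fix x assume "x \<notin> frontier \<Omega>"
    then have "x \<in> \<Omega> \<longleftrightarrow> x \<in> ?O" using eqO by blast
    then show "indicator \<Omega> x *\<^sub>R f (x - (m + \<delta>)) = indicator ?O x *\<^sub>R f (x - (m + \<delta>))" by (simp add: indicator_def)
  qed
  have "Sigma_fun f \<Omega> (m + \<delta>) = (LINT x|lebesgue. indicator ?O x *\<^sub>R f (x - (m + \<delta>)))"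
    unfolding Sigma_fun_def set_lebesgue_integral_def by (rule integral_cong_AE[OF _ _ ae]) measurable
  also have "\<dots> = (LINT x|lborel. indicator ?O x *\<^sub>R f (x - (m + \<delta>)))"
    by (rule integral_completion) measurable
  also have "\<dots> = (LINT x|distr lborel borel (\<lambda>x. x + \<delta>). indicator ?O x *\<^sub>R f (x - (m + \<delta>)))"
    by (simp add: lborel_distr_translation)
  also have "\<dots> = (LINT x|lborel. indicator ?O (x + \<delta>) *\<^sub>R f (x + \<delta> - (m + \<delta>)))"
    by (rule integral_distr) measurable
  finally show ?thesis by (simp add: mult.commute)
qed

lemma Sigma_fun_has_derivative:
  assumes c: "0 < c" "\<And>\<nu> :: real ^ 'n. norm \<nu> = 1 \<Longrightarrow> hausdorff_ratio c \<nu>"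
    and f: "continuous_on UNIV f"
  shows "(Sigma_fun f \<Omega> has_derivative (\<lambda>\<delta>. - (vflux (\<lambda>P. f (P - m)) \<bullet> \<delta>) / c)) (at m)"
  unfolding has_derivative_at_alt
proof (intro conjI allI impI)
  let ?V = "vflux (\<lambda>P. f (P - m))"
  have fm: "continuous_on UNIV (\<lambda>P. f (P - m))"
    by (rule continuous_on_compose2[OF f]) (auto intro: continuous_intros)
  show "bounded_linear (\<lambda>\<delta>. - (?V \<bullet> \<delta>) / c)"
    using bounded_linear_const_mult[OF bounded_linear_inner_right[of ?V], of "- 1 / c"] by simp
  fix \<eta> :: real assume "0 < \<eta>"
  from expansion[OF c fm this] obtain d where d: "0 < d"
    "\<And>\<delta>. dist \<delta> 0 < d \<Longrightarrow> \<bar>shift_diff (\<lambda>P. f (P - m)) \<delta> + (?V \<bullet> \<delta>) / c\<bar> \<le> \<eta> * norm \<delta>"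
    unfolding eventually_nhds_metric by blast
  have diff: "Sigma_fun f \<Omega> y - Sigma_fun f \<Omega> m = shift_diff (\<lambda>P. f (P - m)) (y - m)" for y
    unfolding shift_diff_def right_diff_distrib
    using Sigma_fun_shift[OF f, of m "y - m"] Sigma_fun_shift[OF f, of m 0] integrable_shift[OF fm, of "y - m"] integrable_shift[OF fm, of 0]
    by simp
  show "\<exists>d>0. \<forall>y. norm (y - m) < d \<longrightarrow>
      norm (Sigma_fun f \<Omega> y - Sigma_fun f \<Omega> m - - (?V \<bullet> (y - m)) / c) \<le> \<eta> * norm (y - m)"
    unfolding diff using d by (intro exI[of _ d]) auto
qed

end

theorem mainTheorem5:
  fixes f :: "real ^ 'n \<Rightarrow> real" and \<Omega> :: "(real ^ 'n) set" and m :: "real ^ 'n"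
  assumes "continuous_on UNIV f"
    and "bounded \<Omega>" and "region \<Omega>" and "piecewise_smooth_boundary \<Omega>"
  shows "critical_point (Sigma_fun f \<Omega>) m \<longleftrightarrow>
    (LINT P:frontier \<Omega>|hausdorff_measure (CARD('n) - 1). f (P - m) *\<^sub>R outward_normal \<Omega> P) = 0"
proof -
  interpret smooth_region \<Omega>
  proof
    have "frontier \<Omega> - smooth_boundary_points \<Omega> \<in> sets borel"
      using closed_nonsmooth by (rule borel_closed)
    then show "hausdorff_outer (CARD('n) - 1) (frontier \<Omega> - smooth_boundary_points \<Omega>) = 0"
      using assms(4) by (simp add: piecewise_smooth_boundary_def emeasure_hausdorff_measure)
    show "hausdorff_outer (CARD('n) - 1) (frontier \<Omega>) < top"
      using assms(4) by (simp add: piecewise_smooth_boundary_def emeasure_hausdorff_measure)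
  qed (rule assms)
  obtain c where c: "0 < c" "\<And>\<nu> :: real ^ 'n. norm \<nu> = 1 \<Longrightarrow> hausdorff_ratio c \<nu>"
    using hausdorff_eq_plane_measure[where ?'n = 'n] by blast
  let ?V = "vflux (\<lambda>P. f (P - m))"
  have der: "(Sigma_fun f \<Omega> has_derivative (\<lambda>\<delta>. - (?V \<bullet> \<delta>) / c)) (at m)"
    by (rule Sigma_fun_has_derivative[OF c assms(1)])
  have "critical_point (Sigma_fun f \<Omega>) m \<longleftrightarrow> ?V = 0"
  proof
    assume "critical_point (Sigma_fun f \<Omega>) m"
    then have "(\<lambda>\<delta>. - (?V \<bullet> \<delta>) / c) = (\<lambda>\<delta>. 0)"
      unfolding critical_point_def using der has_derivative_unique by blast
    \<comment> \<open>Evaluating the derivative in the direction of the boundary integral itself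
      makes its squared norm vanish.\<close>
    then have "- (?V \<bullet> ?V) / c = 0" by meson
    then show "?V = 0" using c(1) by simp
  next
    assume "?V = 0"
    then show "critical_point (Sigma_fun f \<Omega>) m" using der by (simp add: critical_point_def)
  qed
  then show ?thesis by (simp only: vflux_def)
qed

end
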